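(* Let $d_1,d_2$ be positive integers, let $F\in\Omega_2(d_1,d_2)$ and assume that $F$ has a generalized cusp at $a\in\mathbb{C}^2$. Then $F$ has a cusp at $a$ if and only if $\mu_a(F)=1$.
   Context: $\Omega_2(d_1,d_2)$ is the set of polynomial mappings $(f,g):\mathbb{C}^2\to\mathbb{C}^2$ with $\deg f\le d_1$, $\deg g\le d_2$. For $F=(f,g)$ put $J(F)=f_xg_y-f_yg_x$ and $J_{1,1}(F)=J(F)_xf_y-J(F)_yf_x$. $F$ has a cusp at $a$ if the germ of $F$ at $a$ is biholomorphically equivalent (biholomorphic changes in source and target) to $(x,y)\mapsto(x,y^3+xy)$ at $0$. $F$ has a generalized cusp at $a$ if the germ $F_a$ is proper (finite), the curve $\{J(F)=0\}$ is reduced near $a$, and the discriminant of $F_a$ (image of the critical locus germ) is not smooth at $F(a)$. Index: for a generic $T\in GL(2)$, $F'=(f',g')=T\circ F$ has $\nabla f'$ not vanishing identically on any branch of $\{J(F)=0\}$ near $a$, and $\mu_a(F):=\dim_{\mathbb{C}}\mathcal{O}_a/(J(F'),J_{1,1}(F'))-\dim_{\mathbb{C}}\mathcal{O}_a/(f'_x,f'_y)$. *)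

theory Defs
  imports "HOL-Analysis.Analysis" "HOL-Library.Extended_Nat"
begin

type_synonym c2 = "complex \<times> complex"
type_synonym pmap = "(c2 \<Rightarrow> complex) \<times> (c2 \<Rightarrow> complex)"

definition poly2_le :: "nat \<Rightarrow> (c2 \<Rightarrow> complex) \<Rightarrow> bool" where
  "poly2_le d f \<longleftrightarrow> (\<exists>c :: nat \<Rightarrow> nat \<Rightarrow> complex.
      \<forall>x y. f (x, y) = (\<Sum>i\<le>d. \<Sum>j\<le>d - i. c i j * x ^ i * y ^ j))"

definition Omega2 :: "nat \<Rightarrow> nat \<Rightarrow> pmap set" where
  "Omega2 d1 d2 = {(f, g). poly2_le d1 f \<and> poly2_le d2 g}"

definition app :: "pmap \<Rightarrow> c2 \<Rightarrow> c2" where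
  "app F z = (fst F z, snd F z)"

definition pdx :: "(c2 \<Rightarrow> complex) \<Rightarrow> c2 \<Rightarrow> complex" where
  "pdx f = (\<lambda>(x, y). deriv (\<lambda>t. f (t, y)) x)"
definition pdy :: "(c2 \<Rightarrow> complex) \<Rightarrow> c2 \<Rightarrow> complex" where
  "pdy f = (\<lambda>(x, y). deriv (\<lambda>t. f (x, t)) y)"

definition jac :: "pmap \<Rightarrow> c2 \<Rightarrow> complex" where
  "jac F = (\<lambda>z. pdx (fst F) z * pdy (snd F) z - pdy (fst F) z * pdx (snd F) z)"
definition jac11 :: "pmap \<Rightarrow> c2 \<Rightarrow> complex" where
  "jac11 F = (\<lambda>z. pdx (jac F) z * pdy (fst F) z - pdy (jac F) z * pdx (fst F) z)"

definition has_cderiv :: "(c2 \<Rightarrow> complex) \<Rightarrow> c2 \<Rightarrow> complex \<Rightarrow> complex \<Rightarrow> bool" where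
  "has_cderiv h z \<alpha> \<beta> \<longleftrightarrow> (h has_derivative (\<lambda>v. \<alpha> * fst v + \<beta> * snd v)) (at z)"

definition holo2_on :: "c2 set \<Rightarrow> (c2 \<Rightarrow> complex) \<Rightarrow> bool" where
  "holo2_on U h \<longleftrightarrow> open U \<and> (\<forall>z\<in>U. \<exists>\<alpha> \<beta>. has_cderiv h z \<alpha> \<beta>)"

definition germ_at :: "c2 \<Rightarrow> (c2 \<Rightarrow> complex) \<Rightarrow> bool" where
  "germ_at a h \<longleftrightarrow> (\<exists>U. a \<in> U \<and> holo2_on U h)"

definition in_ideal2 :: "c2 \<Rightarrow> (c2 \<Rightarrow> complex) \<Rightarrow> (c2 \<Rightarrow> complex) \<Rightarrow> (c2 \<Rightarrow> complex) \<Rightarrow> bool" where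
  "in_ideal2 a g h \<phi> \<longleftrightarrow> (\<exists>U u v. a \<in> U \<and> holo2_on U u \<and> holo2_on U v \<and>
      (\<forall>z\<in>U. \<phi> z = u z * g z + v z * h z))"

definition spans_quot :: "c2 \<Rightarrow> (c2 \<Rightarrow> complex) \<Rightarrow> (c2 \<Rightarrow> complex) \<Rightarrow> nat \<Rightarrow> bool" where
  "spans_quot a g h n \<longleftrightarrow> (\<exists>b :: nat \<Rightarrow> c2 \<Rightarrow> complex. (\<forall>k<n. germ_at a (b k)) \<and>
      (\<forall>\<psi>. germ_at a \<psi> \<longrightarrow>
         (\<exists>c :: nat \<Rightarrow> complex. in_ideal2 a g h (\<lambda>z. \<psi> z - (\<Sum>k<n. c k * b k z)))))"

text \<open>dim_C O_a/(g,h) (infinity if not finite dimensional).\<close>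
definition local_dim :: "c2 \<Rightarrow> (c2 \<Rightarrow> complex) \<Rightarrow> (c2 \<Rightarrow> complex) \<Rightarrow> enat" where
  "local_dim a g h = (INF n \<in> {n. spans_quot a g h n}. enat n)"

definition tcomp :: "complex^2^2 \<Rightarrow> pmap \<Rightarrow> pmap" where
  "tcomp T F = ((\<lambda>z. T$1$1 * fst F z + T$1$2 * snd F z),
                (\<lambda>z. T$2$1 * fst F z + T$2$2 * snd F z))"

text \<open>grad f' does not vanish identically on any branch of {J(F)=0} near a:
  the common zeros of J(F), f'_x, f'_y are isolated at a.\<close>
definition grad_transverse :: "c2 \<Rightarrow> pmap \<Rightarrow> pmap \<Rightarrow> bool" where
  "grad_transverse a F F' \<longleftrightarrow> (\<exists>V. open V \<and> a \<in> V \<and>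
      {z\<in>V. jac F z = 0 \<and> pdx (fst F') z = 0 \<and> pdy (fst F') z = 0} \<subseteq> {a})"

text \<open>mu_a(F) = m: for T in an open dense subset of GL(2) (generic T), the
  transversality condition holds and the difference of dimensions equals m.\<close>
definition cusp_index_is :: "c2 \<Rightarrow> pmap \<Rightarrow> int \<Rightarrow> bool" where
  "cusp_index_is a F m \<longleftrightarrow> (\<exists>U. open U \<and> U \<subseteq> {T. invertible T} \<and>
      {T. invertible T} \<subseteq> closure U \<and>
      (\<forall>T\<in>U. grad_transverse a F (tcomp T F) \<and>
         (\<exists>k1 k2. local_dim a (jac (tcomp T F)) (jac11 (tcomp T F)) = enat k1 \<and>
                  local_dim a (pdx (fst (tcomp T F))) (pdy (fst (tcomp T F))) = enat k2 \<and>
                  int k1 - int k2 = m)))"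

definition holo_map_on :: "c2 set \<Rightarrow> (c2 \<Rightarrow> c2) \<Rightarrow> bool" where
  "holo_map_on U \<phi> \<longleftrightarrow> holo2_on U (\<lambda>z. fst (\<phi> z)) \<and> holo2_on U (\<lambda>z. snd (\<phi> z))"

definition biholo :: "c2 set \<Rightarrow> c2 set \<Rightarrow> (c2 \<Rightarrow> c2) \<Rightarrow> bool" where
  "biholo U V \<phi> \<longleftrightarrow> holo_map_on U \<phi> \<and> open V \<and> \<phi> ` U = V \<and>
      (\<exists>\<psi>. holo_map_on V \<psi> \<and> (\<forall>z\<in>U. \<psi> (\<phi> z) = z))"

definition cusp_std :: "c2 \<Rightarrow> c2" where
  "cusp_std z = (fst z, snd z ^ 3 + fst z * snd z)"

definition has_cusp :: "(c2 \<Rightarrow> c2) \<Rightarrow> c2 \<Rightarrow> bool" where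
  "has_cusp G a \<longleftrightarrow> (\<exists>U U' W W' \<phi> \<psi>. a \<in> U \<and> biholo U U' \<phi> \<and> \<phi> a = (0, 0) \<and>
      G a \<in> W \<and> biholo W W' \<psi> \<and> \<psi> (G a) = (0, 0) \<and>
      (\<forall>z\<in>U. G z \<in> W \<and> \<psi> (G z) = cusp_std (\<phi> z)))"

definition finite_germ :: "(c2 \<Rightarrow> c2) \<Rightarrow> c2 \<Rightarrow> bool" where
  "finite_germ G a \<longleftrightarrow> (\<exists>V. open V \<and> a \<in> V \<and> {z\<in>V. G z = G a} = {a})"

definition reduced_at :: "c2 \<Rightarrow> (c2 \<Rightarrow> complex) \<Rightarrow> bool" where
  "reduced_at a h \<longleftrightarrow> \<not> (\<exists>U k u. a \<in> U \<and> holo2_on U k \<and> holo2_on U u \<and> k a = 0 \<and>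
      (\<forall>z\<in>U. h z = (k z)^2 * u z))"

text \<open>The discriminant germ (image of the critical locus germ {J=0} at a) is a
  smooth curve germ at G(a).\<close>
definition disc_smooth :: "(c2 \<Rightarrow> c2) \<Rightarrow> (c2 \<Rightarrow> complex) \<Rightarrow> c2 \<Rightarrow> bool" where
  "disc_smooth G J a \<longleftrightarrow> (\<exists>r>0. \<exists>W0 \<phi> \<alpha> \<beta>. holo2_on W0 \<phi> \<and> G a \<in> W0 \<and> \<phi> (G a) = 0 \<and>
      has_cderiv \<phi> (G a) \<alpha> \<beta> \<and> (\<alpha>, \<beta>) \<noteq> (0, 0) \<and>
      (\<forall>s. 0 < s \<and> s \<le> r \<longrightarrow> (\<exists>W. open W \<and> G a \<in> W \<and> W \<subseteq> W0 \<and>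
           G ` {z \<in> ball a s. J z = 0} \<inter> W = {w\<in>W. \<phi> w = 0})))"

definition generalized_cusp :: "pmap \<Rightarrow> c2 \<Rightarrow> bool" where
  "generalized_cusp F a \<longleftrightarrow> finite_germ (app F) a \<and> reduced_at a (jac F) \<and>
      \<not> disc_smooth (app F) (jac F) a"

end

theory Submission
  imports Defs "HOL-Complex_Analysis.Residue_Theorem"
begin

text \<open>
  Write \<open>{p, q} = p\<^sub>x q\<^sub>y - p\<^sub>y q\<^sub>x\<close>, so that \<open>J = {f, g}\<close> and \<open>J\<^sub>1\<^sub>1 = {J, f}\<close>.

  If \<open>F\<close> has a cusp at \<open>a\<close>, the chain rule for \<open>{\<cdot>, \<cdot>}\<close> shows, for generic \<open>T\<close>, that \<open>\<nabla>f'(a) \<noteq> 0\<close> and that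
  \<open>J\<close> and \<open>J\<^sub>1\<^sub>1\<close> vanish at \<open>a\<close> with independent gradients. They then generate the maximal ideal,
  so the index is \<open>1 - 0\<close>.

  Conversely, let the index be \<open>1\<close>. If \<open>dF(a) = 0\<close>, both \<open>J\<close> and \<open>J\<^sub>1\<^sub>1\<close> lie in \<open>\<mm>I\<close> for \<open>I = (f'\<^sub>x, f'\<^sub>y)\<close>,
  and \<open>f'\<^sub>x, f'\<^sub>y\<close> form a minimal system of generators of \<open>I\<close>; hence the two colengths differ by at least
  \<open>dim I/\<mm>I = 2\<close>, a contradiction. So \<open>\<nabla>f'(a) \<noteq> 0\<close> for generic \<open>T\<close>, the colength of \<open>(J, J\<^sub>1\<^sub>1)\<close> is \<open>1\<close>, and \<open>J\<close> and
  \<open>J\<^sub>1\<^sub>1\<close> have independent gradients at \<open>a\<close>. In coordinates with \<open>f' = x\<close> and \<open>g' = G(x, y)\<close> this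
  says that \<open>G(0, y)\<close> has order three and \<open>G\<^sub>x\<^sub>y \<noteq> 0\<close>. The monic cubic with coefficients in \<open>(x, Y)\<close> whose roots
  are the three solutions \<open>y\<close> of \<open>G(x, y) = Y\<close> then yields, after completing the cube, the
  biholomorphic changes to \<open>(x, y\<^sup>3 + x y)\<close>.
\<close>

section \<open>Holomorphic functions of two variables\<close>

text \<open>Both directions use adapted coordinates in which \<open>J = p u\<close> and
  \<open>J11 = q v + p e\<close> with \<open>u\<close>, \<open>v\<close> nonzero at
  \<open>a\<close>. The units and the term \<open>p e\<close> only multiply the Jacobian determinant
  at \<open>a\<close> by \<open>u v\<close>, so independence of the gradients can be tested on
  \<open>p\<close>, \<open>q\<close>. Genericity of \<open>T\<close> matters in two ways. For a
  cusp, \<open>f'\<close> must not have a differential that kills the tangent direction of the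
  discriminant, for otherwise \<open>J\<close> and \<open>J11\<close> have dependent gradients.
  Conversely, \<open>\<nabla>f' = 0\<close> forces \<open>J = 0\<close>, so transversality makes the
  zeros of \<open>\<nabla>f'\<close> isolated; as a holomorphic function of two variables has no
  isolated zeros, neither generator of \<open>I\<close> can be spared, which is the minimality
  behind the number 2. The cubic is known only through the identity that it satisfies on the graph
  of \<open>G\<close>. Differentiating this identity along \<open>y = 0\<close> gives the needed
  relations between its coefficients; that the constant term has nonzero derivative in
  \<open>Y\<close> comes instead from dividing by \<open>y^3\<close> on the line
  \<open>x = 0\<close>.\<close>

lemma has_cderiv_const [simp]: "has_cderiv (\<lambda>_. c) z 0 0"
  by (simp add: has_cderiv_def)

lemma has_cderiv_fst [simp]: "has_cderiv fst z 1 0"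
  unfolding has_cderiv_def by (auto intro!: derivative_eq_intros)

lemma has_cderiv_snd [simp]: "has_cderiv snd z 0 1"
  unfolding has_cderiv_def by (auto intro!: derivative_eq_intros)

lemma has_cderiv_add:
  assumes "has_cderiv f z \<alpha> \<beta>" "has_cderiv g z \<gamma> \<delta>"
  shows "has_cderiv (\<lambda>z. f z + g z) z (\<alpha> + \<gamma>) (\<beta> + \<delta>)"
  using assms unfolding has_cderiv_def
  by (auto intro!: derivative_eq_intros simp: algebra_simps)

lemma has_cderiv_diff:
  assumes "has_cderiv f z \<alpha> \<beta>" "has_cderiv g z \<gamma> \<delta>"
  shows "has_cderiv (\<lambda>z. f z - g z) z (\<alpha> - \<gamma>) (\<beta> - \<delta>)"
  using assms unfolding has_cderiv_def
  by (auto intro!: derivative_eq_intros simp: algebra_simps)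

lemma has_cderiv_mult:
  assumes "has_cderiv f z \<alpha> \<beta>" "has_cderiv g z \<gamma> \<delta>"
  shows "has_cderiv (\<lambda>z. f z * g z) z (\<alpha> * g z + f z * \<gamma>) (\<beta> * g z + f z * \<delta>)"
  using assms unfolding has_cderiv_def
  by (auto intro!: derivative_eq_intros simp: algebra_simps)

lemma has_cderiv_compose1:
  assumes "(h has_field_derivative \<gamma>) (at (f z))" "has_cderiv f z \<alpha> \<beta>"
  shows "has_cderiv (\<lambda>z. h (f z)) z (\<gamma> * \<alpha>) (\<gamma> * \<beta>)"
proof -
  have "(h has_derivative (*) \<gamma>) (at (f z))"
    using assms(1) by (simp add: has_field_derivative_def)
  from has_derivative_compose[OF assms(2)[unfolded has_cderiv_def] this]
  show ?thesis unfolding has_cderiv_def by (simp add: algebra_simps)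
qed

lemma has_cderiv_compose2:
  assumes "has_cderiv h (f z, g z) \<gamma> \<delta>" "has_cderiv f z \<alpha> \<beta>" "has_cderiv g z \<alpha>' \<beta>'"
  shows "has_cderiv (\<lambda>z. h (f z, g z)) z (\<gamma> * \<alpha> + \<delta> * \<alpha>') (\<gamma> * \<beta> + \<delta> * \<beta>')"
proof -
  have "((\<lambda>z. (f z, g z)) has_derivative (\<lambda>v. (\<alpha> * fst v + \<beta> * snd v, \<alpha>' * fst v + \<beta>' * snd v))) (at z)"
    using assms(2,3) unfolding has_cderiv_def by (rule has_derivative_Pair)
  from has_derivative_compose[OF this assms(1)[unfolded has_cderiv_def]]
  show ?thesis unfolding has_cderiv_def by (simp add: algebra_simps)
qed

lemma has_cderiv_section1:
  assumes "has_cderiv h (x, y) \<alpha> \<beta>"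
  shows "((\<lambda>t. h (t, y)) has_field_derivative \<alpha>) (at x)"
proof -
  have "((\<lambda>t. (t, y)) has_derivative (\<lambda>t. (t, 0))) (at x)"
    by (auto intro!: derivative_eq_intros)
  from has_derivative_compose[OF this assms[unfolded has_cderiv_def]]
  show ?thesis by (simp add: has_field_derivative_def)
qed

lemma has_cderiv_section2:
  assumes "has_cderiv h (x, y) \<alpha> \<beta>"
  shows "((\<lambda>t. h (x, t)) has_field_derivative \<beta>) (at y)"
proof -
  have "((\<lambda>t. (x, t)) has_derivative (\<lambda>t. (0, t))) (at y)"
    by (auto intro!: derivative_eq_intros)
  from has_derivative_compose[OF this assms[unfolded has_cderiv_def]]
  show ?thesis by (simp add: has_field_derivative_def)
qed

lemma has_cderiv_pdx: "has_cderiv h z \<alpha> \<beta> \<Longrightarrow> pdx h z = \<alpha>"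
  by (cases z) (auto simp: pdx_def intro: DERIV_imp_deriv has_cderiv_section1)

lemma has_cderiv_pdy: "has_cderiv h z \<alpha> \<beta> \<Longrightarrow> pdy h z = \<beta>"
  by (cases z) (auto simp: pdy_def intro: DERIV_imp_deriv has_cderiv_section2)

lemma has_cderiv_transform:
  assumes "has_cderiv f z \<alpha> \<beta>" "open U" "z \<in> U" "\<And>w. w \<in> U \<Longrightarrow> f w = g w"
  shows "has_cderiv g z \<alpha> \<beta>"
  using assms unfolding has_cderiv_def by (blast intro: has_derivative_transform_within_open)

lemma holo2_on_cderiv:
  assumes "holo2_on U h" "z \<in> U"
  shows "has_cderiv h z (pdx h z) (pdy h z)"
  using assms has_cderiv_pdx has_cderiv_pdy unfolding holo2_on_def by metis

lemma holo2_onI: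
  assumes "open U" "\<And>z. z \<in> U \<Longrightarrow> has_cderiv h z (\<alpha> z) (\<beta> z)"
  shows "holo2_on U h"
  using assms unfolding holo2_on_def by blast

lemma holo2_on_open: "holo2_on U h \<Longrightarrow> open U"
  by (simp add: holo2_on_def)

lemma holo2_on_subset: "holo2_on U h \<Longrightarrow> open V \<Longrightarrow> V \<subseteq> U \<Longrightarrow> holo2_on V h"
  unfolding holo2_on_def by blast

lemma holo2_on_cong:
  assumes "holo2_on U f" "\<And>z. z \<in> U \<Longrightarrow> f z = g z"
  shows "holo2_on U g"
  using assms has_cderiv_transform unfolding holo2_on_def by metis

lemma holo2_on_continuous: "holo2_on U h \<Longrightarrow> continuous_on U h"
  unfolding holo2_on_def has_cderiv_def
  by (meson continuous_at_imp_continuous_on has_derivative_continuous)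

lemma holo2_on_const: "open U \<Longrightarrow> holo2_on U (\<lambda>_. c)"
  unfolding holo2_on_def using has_cderiv_const by blast

lemma holo2_on_fst: "open U \<Longrightarrow> holo2_on U fst"
  unfolding holo2_on_def using has_cderiv_fst by blast

lemma holo2_on_snd: "open U \<Longrightarrow> holo2_on U snd"
  unfolding holo2_on_def using has_cderiv_snd by blast

lemma holo2_on_add: "holo2_on U f \<Longrightarrow> holo2_on U g \<Longrightarrow> holo2_on U (\<lambda>z. f z + g z)"
  by (rule holo2_onI[OF holo2_on_open has_cderiv_add]) (auto intro: holo2_on_cderiv)

lemma holo2_on_diff: "holo2_on U f \<Longrightarrow> holo2_on U g \<Longrightarrow> holo2_on U (\<lambda>z. f z - g z)"
  by (rule holo2_onI[OF holo2_on_open has_cderiv_diff]) (auto intro: holo2_on_cderiv)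

lemma holo2_on_mult: "holo2_on U f \<Longrightarrow> holo2_on U g \<Longrightarrow> holo2_on U (\<lambda>z. f z * g z)"
  by (rule holo2_onI[OF holo2_on_open has_cderiv_mult]) (auto intro: holo2_on_cderiv)

lemma holo2_on_power: "holo2_on U f \<Longrightarrow> holo2_on U (\<lambda>z. f z ^ n)"
  by (induction n) (auto intro: holo2_on_const holo2_on_open holo2_on_mult)

lemma holo2_on_sum:
  assumes "open U" "\<And>i. i \<in> I \<Longrightarrow> holo2_on U (f i)"
  shows "holo2_on U (\<lambda>z. \<Sum>i\<in>I. f i z)"
  using assms(2) by (induction I rule: infinite_finite_induct) (auto intro: holo2_on_const assms holo2_on_add)

lemma holo2_on_compose1:
  assumes "holo2_on U f" "h holomorphic_on S" "open S" "\<And>z. z \<in> U \<Longrightarrow> f z \<in> S"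
  shows "holo2_on U (\<lambda>z. h (f z))"
  by (rule holo2_onI[OF holo2_on_open has_cderiv_compose1])
     (use assms in \<open>auto intro: holo2_on_cderiv holomorphic_derivI\<close>)

lemma holo2_on_divide:
  assumes "holo2_on U f" "holo2_on U g" "\<And>z. z \<in> U \<Longrightarrow> g z \<noteq> 0"
  shows "holo2_on U (\<lambda>z. f z / g z)"
proof -
  have "holo2_on U (\<lambda>z. inverse (g z))"
    by (rule holo2_on_compose1[OF assms(2), of _ "-{0}"]) (use assms in \<open>auto intro!: holomorphic_intros\<close>)
  from holo2_on_mult[OF assms(1) this] show ?thesis by (simp add: divide_inverse)
qed

lemma holo2_on_compose2:
  assumes "holo2_on V h" "holo2_on U f" "holo2_on U g" "\<And>z. z \<in> U \<Longrightarrow> (f z, g z) \<in> V"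
  shows "holo2_on U (\<lambda>z. h (f z, g z))"
  by (rule holo2_onI[OF holo2_on_open has_cderiv_compose2])
     (use assms in \<open>auto intro: holo2_on_cderiv\<close>)

lemmas holo2_intros = holo2_on_const holo2_on_fst holo2_on_snd holo2_on_add holo2_on_diff
  holo2_on_mult holo2_on_power holo2_on_sum holo2_on_divide

lemma holo2_on_section1:
  assumes "holo2_on U h" "\<And>t. t \<in> S \<Longrightarrow> (t, y) \<in> U"
  shows "(\<lambda>t. h (t, y)) holomorphic_on S"
  using assms holo2_on_cderiv has_cderiv_section1 unfolding holomorphic_on_def
  by (meson field_differentiable_def field_differentiable_at_within)

lemma holo2_on_section2:
  assumes "holo2_on U h" "\<And>t. t \<in> S \<Longrightarrow> (x, t) \<in> U"
  shows "(\<lambda>t. h (x, t)) holomorphic_on S"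
  using assms holo2_on_cderiv has_cderiv_section2 unfolding holomorphic_on_def
  by (meson field_differentiable_def field_differentiable_at_within)

section \<open>Cauchy's formula and integrals that depend on parameters\<close>

lemma open_contains_bicball:
  fixes U :: "c2 set"
  assumes "open U" "(x, y) \<in> U"
  obtains r where "r > 0" "cball x r \<times> cball y r \<subseteq> U"
proof -
  obtain e where e: "e > 0" "ball (x, y) e \<subseteq> U"
    using assms open_contains_ball by blast
  have "cball x (e/3) \<times> cball y (e/3) \<subseteq> ball (x, y) e"
  proof safe
    fix u v assume "u \<in> cball x (e/3)" "v \<in> cball y (e/3)"
    then have "dist (x, y) (u, v) \<le> e/3 + e/3"
      using sqrt_sum_squares_le_sum_abs[of "dist x u" "dist y v"] by (simp add: dist_Pair_Pair)
    then show "(u, v) \<in> ball (x, y) e" using e by simp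
  qed
  then show ?thesis using that[of "e/3"] e by auto
qed

text \<open>Writing Cauchy's formula over a fixed real interval allows continuity and holomorphy in
  further parameters to be proved under the integral sign. The constant \<open>2 pi i\<close>
  cancels against the velocity of the circle.\<close>

lemma deriv_circle_integral:
  assumes "f holomorphic_on cball c r" "w \<in> ball c r" 
  shows "deriv f w = integral {0..1} (\<lambda>t. f (circlepath c r t) * (r * exp (2 * pi * \<i> * t)) / (circlepath c r t - w)\<^sup>2)"
proof -
  have "(2 * pi * \<i>) * deriv f w = contour_integral (circlepath c r) (\<lambda>u. f u / (u - w)\<^sup>2)"
    using Cauchy_contour_integral_circlepath_2[of c r f w] assms
    by (simp add: holomorphic_on_imp_continuous_on holomorphic_on_subset[OF assms(1) ball_subset_cball])
  also have "\<dots> = integral {0..1} (\<lambda>t. (2 * pi * \<i>) * (f (circlepath c r t) * (r * exp (2 * pi * \<i> * t)) / (circlepath c r t - w)\<^sup>2))"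
    unfolding contour_integral_integral by (simp add: vector_derivative_circlepath mult_ac)
  also have "\<dots> = (2 * pi * \<i>) * integral {0..1} (\<lambda>t. f (circlepath c r t) * (r * exp (2 * pi * \<i> * t)) / (circlepath c r t - w)\<^sup>2)"
    by (rule integral_mult_right)
  finally show ?thesis by (simp del: integral_mult_right)
qed

lemma circlepath_dist: "r \<ge> 0 \<Longrightarrow> dist c (circlepath c r t) = r"
  by (simp add: circlepath dist_norm norm_mult)

lemma circlepath_neq: "w \<in> ball c r \<Longrightarrow> circlepath c r t \<noteq> w"
  using circlepath_dist[of r c t] by (metis dist_nz dual_order.strict_trans2 mem_ball less_irrefl linear zero_le_dist)

lemma continuous_on_circlepath [continuous_intros]:
  "continuous_on S g \<Longrightarrow> continuous_on S (\<lambda>x. circlepath c r (g x))"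
  unfolding circlepath by (intro continuous_intros)

text \<open>Differentiation under the integral needs a jointly continuous derivative, while
  \<open>holo2_on\<close> only provides a derivative at each point. Cauchy's formula on a small
  circle in the first variable expresses the derivative by values of \<open>H\<close>, whose joint
  continuity is assumed.\<close>

lemma continuous_on_pdx_param:
  fixes H :: "c2 \<Rightarrow> 'b::metric_space \<Rightarrow> complex"
  assumes "continuous_on (U \<times> S) (\<lambda>(z, w). H z w)" "\<And>w. w \<in> S \<Longrightarrow> holo2_on U (\<lambda>z. H z w)" "open U"
  shows "continuous_on (U \<times> S) (\<lambda>(z, w). pdx (\<lambda>z. H z w) z)"
proof -
  have local: "\<exists>T. open T \<and> (z0, w0) \<in> T \<and> continuous_on ((U \<times> S) \<inter> T) (\<lambda>(z, w). pdx (\<lambda>z. H z w) z)"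
    if z0U: "z0 \<in> U" and w0S: "w0 \<in> S" for z0 w0
  proof -
    obtain x0 y0 where z0: "z0 = (x0, y0)" by (cases z0)
    then obtain r where r: "r > 0" "cball x0 r \<times> cball y0 r \<subseteq> U"
      using open_contains_bicball[OF assms(3), of x0 y0] z0U by blast
    define T where "T = (ball x0 r \<times> ball y0 r) \<times> (UNIV :: 'b set)"
    have eq: "pdx (\<lambda>z. H z w) (x, y) = integral {0..1} (\<lambda>t. H (circlepath x0 r t, y) w * (r * exp (2 * pi * \<i> * t)) / (circlepath x0 r t - x)\<^sup>2)"
      if "((x, y), w) \<in> (U \<times> S) \<inter> T" for x y w
      unfolding pdx_def prod.case using that r
      by (intro deriv_circle_integral holo2_on_section1[OF assms(2)]) (auto simp: T_def)
    have "continuous_on ((U \<times> S) \<inter> T) (\<lambda>p. integral (cbox 0 1) (\<lambda>t. H (circlepath x0 r t, snd (fst p)) (snd p) * (r * exp (2 * pi * \<i> * t)) / (circlepath x0 r t - fst (fst p))\<^sup>2))"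
    proof (rule integral_continuous_on_param)
      have "continuous_on (((U \<times> S) \<inter> T) \<times> cbox 0 1) (\<lambda>q. (\<lambda>(z, w). H z w) ((circlepath x0 r (snd q), snd (fst (fst q))), snd (fst q)))"
        by (rule continuous_on_compose2[OF assms(1)])
           (use r in \<open>auto intro!: continuous_intros subsetD[OF r(2)] simp: T_def circlepath_dist\<close>)
      then show "continuous_on (((U \<times> S) \<inter> T) \<times> cbox 0 1) (\<lambda>(p, t). H (circlepath x0 r t, snd (fst p)) (snd p) * (r * exp (2 * pi * \<i> * t)) / (circlepath x0 r t - fst (fst p))\<^sup>2)"
        unfolding case_prod_unfold
        by (intro continuous_intros) (auto simp: T_def dest: circlepath_neq)
    qed
    then have "continuous_on ((U \<times> S) \<inter> T) (\<lambda>(z, w). pdx (\<lambda>z. H z w) z)"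
      by (rule continuous_on_eq) (use eq in auto)
    moreover have "open T" "(z0, w0) \<in> T" using r by (auto simp: T_def z0 open_Times)
    ultimately show ?thesis by blast
  qed
  show ?thesis
  proof (rule iffD2[OF continuous_on_eq_continuous_within], clarify)
    fix x y w assume "(x, y) \<in> U" "w \<in> S"
    then obtain T where T: "open T" "((x, y), w) \<in> T" "continuous_on ((U \<times> S) \<inter> T) (\<lambda>(z, w). pdx (\<lambda>z. H z w) z)"
      using local by blast
    have "at ((x, y), w) within ((U \<times> S) \<inter> T) = at ((x, y), w) within (U \<times> S)"
      by (rule at_within_nhd[OF T(2,1)]) auto
    then show "continuous (at ((x, y), w) within U \<times> S) (\<lambda>(z, w). pdx (\<lambda>z. H z w) z)"
      using T \<open>(x, y) \<in> U\<close> \<open>w \<in> S\<close> unfolding continuous_on_eq_continuous_within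
      by (metis IntI SigmaI)
  qed
qed

lemma continuous_on_pdy_param:
  fixes H :: "c2 \<Rightarrow> 'b::metric_space \<Rightarrow> complex"
  assumes "continuous_on (U \<times> S) (\<lambda>(z, w). H z w)" "\<And>w. w \<in> S \<Longrightarrow> holo2_on U (\<lambda>z. H z w)" "open U"
  shows "continuous_on (U \<times> S) (\<lambda>(z, w). pdy (\<lambda>z. H z w) z)"
proof -
  \<comment> \<open>Exchanging the two coordinates turns \<open>pdy\<close> into
    \<open>pdx\<close>.\<close>
  define U' :: "c2 set" where "U' = prod.swap -` U"
  have "continuous_on UNIV (prod.swap :: c2 \<Rightarrow> c2)" by (intro continuous_intros)
  then have U': "open U'" unfolding U'_def using assms(3) open_vimage by blast
  have "continuous_on (U' \<times> S) (\<lambda>(z, w). pdx (\<lambda>z. H (snd z, fst z) w) z)"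
  proof (rule continuous_on_pdx_param[OF _ _ U'])
    have "continuous_on (U' \<times> S) (\<lambda>p. (\<lambda>(z, w). H z w) ((snd (fst p), fst (fst p)), snd p))"
      by (rule continuous_on_compose2[OF assms(1)]) (auto intro!: continuous_intros simp: U'_def)
    then show "continuous_on (U' \<times> S) (\<lambda>(z, w). H (snd z, fst z) w)"
      by (simp add: case_prod_unfold)
    show "holo2_on U' (\<lambda>z. H (snd z, fst z) w)" if "w \<in> S" for w
      by (rule holo2_on_compose2[OF assms(2)[OF that]]) (use U' in \<open>auto intro!: holo2_intros simp: U'_def\<close>)
  qed
  then have "continuous_on (U \<times> S) (\<lambda>p. (\<lambda>(z, w). pdx (\<lambda>z. H (snd z, fst z) w) z) ((snd (fst p), fst (fst p)), snd p))"
    by (rule continuous_on_compose2) (auto intro!: continuous_intros simp: U'_def)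
  then show ?thesis by (simp add: case_prod_unfold pdx_def pdy_def)
qed

text \<open>The differential as an element of a normed space, so that its continuous dependence on
  the point can be stated for the Leibniz rule and the inverse function theorem.\<close>

definition cblin :: "complex \<Rightarrow> complex \<Rightarrow> c2 \<Rightarrow>\<^sub>L complex" where
  "cblin \<alpha> \<beta> = (blinfun_mult_right \<alpha> o\<^sub>L fst_blinfun) + (blinfun_mult_right \<beta> o\<^sub>L snd_blinfun)"

lemma cblin_apply [simp]: "blinfun_apply (cblin \<alpha> \<beta>) v = \<alpha> * fst v + \<beta> * snd v"
  by (simp add: cblin_def blinfun.add_left)

lemma continuous_on_cblin [continuous_intros]:
  "continuous_on S f \<Longrightarrow> continuous_on S g \<Longrightarrow> continuous_on S (\<lambda>x. cblin (f x) (g x))"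
  unfolding cblin_def by (intro continuous_intros)

lemma has_cderiv_cblin: "has_cderiv h z \<alpha> \<beta> \<longleftrightarrow> (h has_derivative blinfun_apply (cblin \<alpha> \<beta>)) (at z)"
proof -
  have "blinfun_apply (cblin \<alpha> \<beta>) = (\<lambda>v. \<alpha> * fst v + \<beta> * snd v)" by auto
  then show ?thesis by (simp add: has_cderiv_def)
qed

lemma holo2_on_integral:
  fixes H :: "c2 \<Rightarrow> real \<Rightarrow> complex"
  assumes "open U" "continuous_on (U \<times> {0..1}) (\<lambda>(z, t). H z t)" "\<And>t. t \<in> {0..1} \<Longrightarrow> holo2_on U (\<lambda>z. H z t)"
  shows "holo2_on U (\<lambda>z. integral {0..1} (H z))"
proof (rule holo2_onI[OF assms(1)])
  fix z0 assume "z0 \<in> U"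
  then obtain e where e: "e > 0" "ball z0 e \<subseteq> U"
    using assms(1) open_contains_ball by blast
  define a where "a z t = pdx (\<lambda>z. H z t) z" for z t
  define b where "b z t = pdy (\<lambda>z. H z t) z" for z t
  have ca: "continuous_on (U \<times> {0..1}) (\<lambda>p. a (fst p) (snd p))"
    using continuous_on_pdx_param[OF assms(2,3,1)] by (simp add: case_prod_unfold a_def)
  have cb: "continuous_on (U \<times> {0..1}) (\<lambda>p. b (fst p) (snd p))"
    using continuous_on_pdy_param[OF assms(2,3,1)] by (simp add: case_prod_unfold b_def)
  have cblin_cont: "continuous_on (ball z0 e \<times> cbox 0 1) (\<lambda>(z, t). cblin (a z t) (b z t))"
    unfolding case_prod_unfold
    by (intro continuous_intros continuous_on_subset[OF ca] continuous_on_subset[OF cb]) (use e in auto)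
  have "((\<lambda>z. integral (cbox 0 1) (H z)) has_derivative integral (cbox 0 1) (\<lambda>t. cblin (a z0 t) (b z0 t))) (at z0 within ball z0 e)"
  proof (rule leibniz_rule[OF _ _ cblin_cont])
    fix z and t :: real assume z: "z \<in> ball z0 e" and t: "t \<in> cbox 0 1"
    have "has_cderiv (\<lambda>z. H z t) z (a z t) (b z t)"
      unfolding a_def b_def by (rule holo2_on_cderiv[OF assms(3)]) (use z t e in auto)
    then show "((\<lambda>z. H z t) has_derivative blinfun_apply (cblin (a z t) (b z t))) (at z within ball z0 e)"
      unfolding has_cderiv_cblin by (rule has_derivative_at_withinI)
  next
    fix z assume z: "z \<in> ball z0 e"
    have "continuous_on {0..1} (\<lambda>t. (\<lambda>(z, t). H z t) (z, t))"
      by (rule continuous_on_compose2[OF assms(2)]) (use z e in \<open>auto intro!: continuous_intros\<close>)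
    then show "H z integrable_on cbox 0 1" by (simp add: integrable_continuous_real)
  qed (use e in auto)
  \<comment> \<open>The Leibniz rule returns an integral of linear maps; evaluating it on a vector
    shows that its coefficients are the integrals of the two partial derivatives.\<close>
  moreover have "integral (cbox 0 1) (\<lambda>t. cblin (a z0 t) (b z0 t)) = cblin (integral {0..1} (a z0)) (integral {0..1} (b z0))"
  proof (rule blinfun_eqI)
    fix v :: c2
    have ia: "continuous_on {0..1} (a z0)" "continuous_on {0..1} (b z0)"
      using continuous_on_compose2[OF ca continuous_on_Pair[OF continuous_on_const continuous_on_id], of z0 "{0..1}"]
        continuous_on_compose2[OF cb continuous_on_Pair[OF continuous_on_const continuous_on_id], of z0 "{0..1}"] \<open>z0 \<in> U\<close>
      by auto
    have "blinfun_apply (integral (cbox 0 1) (\<lambda>t. cblin (a z0 t) (b z0 t))) v = integral (cbox 0 1) (\<lambda>t. blinfun_apply (cblin (a z0 t) (b z0 t)) v)"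
      by (rule blinfun_apply_integral) (use ia in \<open>auto intro!: integrable_continuous_real continuous_intros\<close>)
    also have "\<dots> = integral {0..1} (a z0) * fst v + integral {0..1} (b z0) * snd v"
      using ia by (simp add: integral_add integrable_continuous_real continuous_on_mult_right)
    finally show "blinfun_apply (integral (cbox 0 1) (\<lambda>t. cblin (a z0 t) (b z0 t))) v
      = blinfun_apply (cblin (integral {0..1} (a z0)) (integral {0..1} (b z0))) v" by simp
  qed
  ultimately show "has_cderiv (\<lambda>z. integral {0..1} (H z)) z0 (integral {0..1} (a z0)) (integral {0..1} (b z0))"
    using e by (simp add: has_cderiv_cblin at_within_open[of z0 "ball z0 e"])
qed

lemma holo2_on_local:
  assumes "open U" "\<And>z. z \<in> U \<Longrightarrow> \<exists>V. z \<in> V \<and> holo2_on V h"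
  shows "holo2_on U h"
  using assms unfolding holo2_on_def by blast

text \<open>\<open>holo2_on\<close> asks for one complex derivative only. Locally Cauchy's formula
  shows \<open>pdx h\<close> as an integral of functions holomorphic in \<open>z\<close>, so
  \<open>holo2_on_integral\<close> applies.\<close>

lemma holo2_on_pdx:
  assumes "holo2_on U h"
  shows "holo2_on U (pdx h)"
proof (rule holo2_on_local[OF holo2_on_open[OF assms]])
  fix z0 assume z0: "z0 \<in> U"
  obtain x0 y0 where z0_eq: "z0 = (x0, y0)" by (cases z0)
  obtain r where r: "r > 0" "cball x0 r \<times> cball y0 r \<subseteq> U"
    using open_contains_bicball[OF holo2_on_open[OF assms], of x0 y0] z0 z0_eq by blast
  define V where "V = ball x0 r \<times> ball y0 r"
  have V: "open V" "z0 \<in> V" using r by (auto simp: V_def z0_eq open_Times)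
  have "holo2_on V (\<lambda>z. integral {0..1} (\<lambda>t. h (circlepath x0 r t, snd z) * (r * exp (2 * pi * \<i> * t)) / (circlepath x0 r t - fst z)\<^sup>2))"
  proof (rule holo2_on_integral[OF V(1)])
    have "continuous_on (V \<times> {0..1}) (\<lambda>p. h (circlepath x0 r (snd p), snd (fst p)))"
      by (rule continuous_on_compose2[OF holo2_on_continuous[OF assms]])
         (use r in \<open>auto intro!: continuous_intros subsetD[OF r(2)] simp: V_def circlepath_dist\<close>)
    then show "continuous_on (V \<times> {0..1}) (\<lambda>(z, t). h (circlepath x0 r t, snd z) * (r * exp (2 * pi * \<i> * t)) / (circlepath x0 r t - fst z)\<^sup>2)"
      unfolding case_prod_unfold by (intro continuous_intros) (auto simp: V_def dest: circlepath_neq)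
    fix t :: real
    have "holo2_on V (\<lambda>z. h (circlepath x0 r t, snd z))"
      by (rule holo2_on_compose2[OF assms holo2_on_const[OF V(1)] holo2_on_snd[OF V(1)]])
         (use r in \<open>auto intro!: subsetD[OF r(2)] simp: V_def circlepath_dist\<close>)
    then show "holo2_on V (\<lambda>z. h (circlepath x0 r t, snd z) * (r * exp (2 * pi * \<i> * t)) / (circlepath x0 r t - fst z)\<^sup>2)"
      by (intro holo2_intros V) (auto simp: V_def dest: circlepath_neq)
  qed
  moreover have "integral {0..1} (\<lambda>t. h (circlepath x0 r t, snd z) * (r * exp (2 * pi * \<i> * t)) / (circlepath x0 r t - fst z)\<^sup>2) = pdx h z"
    if "z \<in> V" for z
    unfolding pdx_def case_prod_unfold using that r
    by (intro deriv_circle_integral[symmetric] holo2_on_section1[OF assms]) (auto simp: V_def)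
  ultimately show "\<exists>V. z0 \<in> V \<and> holo2_on V (pdx h)"
    using V holo2_on_cong by blast
qed

lemma holo2_on_pdy:
  assumes "holo2_on U h"
  shows "holo2_on U (pdy h)"
proof -
  define U' :: "c2 set" where "U' = prod.swap -` U"
  have "continuous_on UNIV (prod.swap :: c2 \<Rightarrow> c2)" by (intro continuous_intros)
  then have U': "open U'" unfolding U'_def using holo2_on_open[OF assms] open_vimage by blast
  have "holo2_on U' (pdx (\<lambda>z. h (snd z, fst z)))"
    by (intro holo2_on_pdx holo2_on_compose2[OF assms] holo2_intros U') (auto simp: U'_def)
  then have "holo2_on U (\<lambda>z. pdx (\<lambda>z. h (snd z, fst z)) (snd z, fst z))"
    by (rule holo2_on_compose2) (use holo2_on_open[OF assms] in \<open>auto intro!: holo2_intros simp: U'_def\<close>)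
  then show ?thesis by (rule holo2_on_cong) (auto simp: pdx_def pdy_def)
qed

section \<open>Biholomorphic maps and local algebras of dimension at most one\<close>

lemma holo2_on_jac: "holo2_on U p \<Longrightarrow> holo2_on U q \<Longrightarrow> holo2_on U (jac (p, q))"
  unfolding jac_def fst_conv snd_conv by (intro holo2_intros holo2_on_pdx holo2_on_pdy)

lemma jac_eqI:
  assumes "has_cderiv p z \<alpha> \<beta>" "has_cderiv q z \<gamma> \<delta>"
  shows "jac (p, q) z = \<alpha> * \<delta> - \<beta> * \<gamma>"
  using assms by (simp add: jac_def has_cderiv_pdx has_cderiv_pdy)

lemma jac_compose:
  assumes "holo2_on V P" "holo2_on V Q" "holo2_on U f" "holo2_on U g" "z \<in> U" "(f z, g z) \<in> V"
  shows "jac (\<lambda>z. P (f z, g z), \<lambda>z. Q (f z, g z)) z = jac (P, Q) (f z, g z) * jac (f, g) z"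
proof -
  note d = holo2_on_cderiv[OF assms(1,6)] holo2_on_cderiv[OF assms(2,6)]
    holo2_on_cderiv[OF assms(3,5)] holo2_on_cderiv[OF assms(4,5)]
  show ?thesis
    unfolding jac_eqI[OF has_cderiv_compose2[OF d(1,3,4)] has_cderiv_compose2[OF d(2,3,4)]]
    by (simp add: jac_def algebra_simps)
qed

lemma pd_cong:
  assumes "open U" "z \<in> U" "\<And>w. w \<in> U \<Longrightarrow> f w = g w" "holo2_on U f"
  shows "pdx f z = pdx g z" "pdy f z = pdy g z"
  using has_cderiv_transform[OF holo2_on_cderiv[OF assms(4,2)] assms(1-3)]
  by (simp_all add: has_cderiv_pdx has_cderiv_pdy)

lemma jac_cong:
  assumes "z \<in> U" "holo2_on U p" "holo2_on U q" "\<And>w. w \<in> U \<Longrightarrow> p w = p' w" "\<And>w. w \<in> U \<Longrightarrow> q w = q' w"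
  shows "jac (p, q) z = jac (p', q') z"
  using pd_cong[of U z p p'] pd_cong[of U z q q'] assms holo2_on_open by (simp add: jac_def)

text \<open>The image of an open subset is its preimage under the continuous inverse, hence
  open.\<close>

lemma biholo_restrict:
  assumes "biholo U V \<phi>" "open U'" "U' \<subseteq> U"
  shows "biholo U' (\<phi> ` U') \<phi>"
proof -
  obtain \<psi> where \<psi>: "holo_map_on V \<psi>" "\<forall>z\<in>U. \<psi> (\<phi> z) = z"
    and V: "open V" "\<phi> ` U = V" and \<phi>: "holo_map_on U \<phi>"
    using assms(1) unfolding biholo_def by blast
  have "continuous_on V \<psi>"
    using \<psi>(1) continuous_on_Pair[of V "\<lambda>z. fst (\<psi> z)" "\<lambda>z. snd (\<psi> z)"]
    unfolding holo_map_on_def by (simp add: holo2_on_continuous)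
  moreover have "\<phi> ` U' = V \<inter> \<psi> -` U'"
    using \<psi>(2) V(2) assms(3) by (auto simp: subset_iff)
  ultimately have "open (\<phi> ` U')"
    using V(1) assms(2) continuous_open_preimage by metis
  moreover have "\<phi> ` U' \<subseteq> V" using V assms(3) by blast
  ultimately show ?thesis
    using \<phi> \<psi> assms(2,3) unfolding biholo_def holo_map_on_def
    by (meson holo2_on_subset subsetD)
qed

text \<open>A complex 2 by 2 matrix acting on pairs, assembled from compositions so that continuity
  in the entries is immediate.\<close>

definition cblin2 :: "complex \<Rightarrow> complex \<Rightarrow> complex \<Rightarrow> complex \<Rightarrow> c2 \<Rightarrow>\<^sub>L c2" where
  "cblin2 \<alpha> \<beta> \<gamma> \<delta> = (Blinfun (\<lambda>x. (x, 0)) o\<^sub>L cblin \<alpha> \<beta>) + (Blinfun (\<lambda>x. (0, x)) o\<^sub>L cblin \<gamma> \<delta>)"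

lemma cblin2_apply [simp]: "blinfun_apply (cblin2 \<alpha> \<beta> \<gamma> \<delta>) v = (\<alpha> * fst v + \<beta> * snd v, \<gamma> * fst v + \<delta> * snd v)"
proof -
  have "bounded_linear (\<lambda>x::complex. (x, 0::complex))" "bounded_linear (\<lambda>x::complex. (0::complex, x))"
    by (auto intro!: bounded_linear_intros bounded_linear_Pair)
  then show ?thesis by (simp add: cblin2_def blinfun.add_left bounded_linear_Blinfun_apply)
qed

text \<open>The real inverse function theorem gives a differentiable local inverse. Its derivative
  is the inverse of a complex matrix, hence again complex linear, and this makes the local inverse
  holomorphic.\<close>

lemma holo_inverse_function:
  assumes p: "holo2_on U p" and q: "holo2_on U q" and a: "a \<in> U" and nz: "jac (p, q) a \<noteq> 0"
  obtains U' V where "a \<in> U'" "open U'" "U' \<subseteq> U" "biholo U' V (\<lambda>z. (p z, q z))"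
proof -
  define U0 where "U0 = U \<inter> jac (p, q) -` (-{0})"
  have "continuous_on U (jac (p, q))" using p q holo2_on_jac holo2_on_continuous by blast
  then have U0: "open U0" "U0 \<subseteq> U" "a \<in> U0"
    unfolding U0_def using holo2_on_open[OF p] a nz by (auto intro: continuous_open_preimage)
  have p0: "holo2_on U0 p" and q0: "holo2_on U0 q"
    using holo2_on_subset[OF _ U0(1,2)] p q by auto
  define f' where "f' z = cblin2 (pdx p z) (pdy p z) (pdx q z) (pdy q z)" for z
  define f where "f z = (p z, q z)" for z
  define J where "J = jac (p, q)"
  have J: "J z \<noteq> 0" if "z \<in> U0" for z using that by (auto simp: U0_def J_def)
  have derf: "(f has_derivative blinfun_apply (f' z)) (at z)" if "z \<in> U0" for z
  proof -
    have "(f has_derivative (\<lambda>v. (pdx p z * fst v + pdy p z * snd v, pdx q z * fst v + pdy q z * snd v))) (at z)"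
      unfolding f_def using holo2_on_cderiv[OF p0 that] holo2_on_cderiv[OF q0 that]
      unfolding has_cderiv_def by (rule has_derivative_Pair)
    moreover have "blinfun_apply (f' z) = (\<lambda>v. (pdx p z * fst v + pdy p z * snd v, pdx q z * fst v + pdy q z * snd v))"
      by (auto simp: f'_def)
    ultimately show ?thesis by simp
  qed
  have contf: "continuous_on U0 f'"
    unfolding f'_def cblin2_def
    by (intro continuous_intros holo2_on_continuous holo2_on_pdx holo2_on_pdy p0 q0)
  \<comment> \<open>The adjugate matrix divided by the Jacobian; \<open>U0\<close> was chosen so
    that this makes sense at each of its points.\<close>
  define g' where "g' z = cblin2 (pdy q z / J z) (- pdy p z / J z) (- pdx q z / J z) (pdx p z / J z)" for z
  have inv1: "blinfun_apply (g' z) (blinfun_apply (f' z) v) = v"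
    and inv2: "blinfun_apply (f' z) (blinfun_apply (g' z) v) = v" if "z \<in> U0" for z v
  proof -
    have nz: "J z \<noteq> 0" using J that by simp
    obtain x y where v: "v = (x, y)" by (cases v)
    have 1: "J z = pdx p z * pdy q z - pdy p z * pdx q z" by (simp add: J_def jac_def)
    have e: "b / J z = x" if "b = J z * x" for b x using that nz by simp
    have "(pdy q z * (pdx p z * x + pdy p z * y) - pdy p z * (pdx q z * x + pdy q z * y)) / J z = x"
      "(pdx p z * (pdx q z * x + pdy q z * y) - pdx q z * (pdx p z * x + pdy p z * y)) / J z = y"
      "(pdx p z * (pdy q z * x - pdy p z * y) + pdy p z * (pdx p z * y - pdx q z * x)) / J z = x"
      "(pdx q z * (pdy q z * x - pdy p z * y) + pdy q z * (pdx p z * y - pdx q z * x)) / J z = y"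
      by (rule e, simp add: 1 algebra_simps)+
    then show "blinfun_apply (g' z) (blinfun_apply (f' z) v) = v"
      "blinfun_apply (f' z) (blinfun_apply (g' z) v) = v"
      unfolding v f'_def g'_def by (simp_all add: add_divide_distrib diff_divide_distrib algebra_simps)
  qed
  have "g' a o\<^sub>L f' a = id_blinfun"
    by (rule blinfun_eqI) (simp add: inv1 U0)
  then obtain U' V g gd where *: "open U'" "U' \<subseteq> U0" "a \<in> U'" "open V" "f a \<in> V" "homeomorphism U' V f g"
    "\<And>y. y \<in> V \<Longrightarrow> (g has_derivative (gd y)) (at y)"
    "\<And>y. y \<in> V \<Longrightarrow> gd y = inv (blinfun_apply (f'(g y)))"
    "\<And>y. y \<in> V \<Longrightarrow> bij (blinfun_apply (f'(g y)))"
    using inverse_function_theorem[OF U0(1) derf contf U0(3), of "g' a"] by metis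
  have fg: "f ` U' = V" "\<And>z. z \<in> U' \<Longrightarrow> g (f z) = z" "\<And>y. y \<in> V \<Longrightarrow> g y \<in> U'"
    using *(6) unfolding homeomorphism_def by auto
  have gder: "(g has_derivative blinfun_apply (g' (g y))) (at y)" if "y \<in> V" for y
  proof -
    have "gd y = blinfun_apply (g' (g y))"
      unfolding *(8)[OF that]
      by (rule inv_equality; rule inv1 inv2; rule subsetD[OF *(2) fg(3)[OF that]])
    then show ?thesis using *(7)[OF that] by simp
  qed
  have "holo2_on V (\<lambda>y. fst (g y))"
  proof (rule holo2_onI[OF *(4)])
    fix y assume "y \<in> V"
    from has_derivative_fst[OF gder[OF this]]
    show "has_cderiv (\<lambda>y. fst (g y)) y (pdy q (g y) / J (g y)) (- pdy p (g y) / J (g y))"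
      unfolding has_cderiv_def by (simp add: g'_def)
  qed
  moreover have "holo2_on V (\<lambda>y. snd (g y))"
  proof (rule holo2_onI[OF *(4)])
    fix y assume "y \<in> V"
    from has_derivative_snd[OF gder[OF this]]
    show "has_cderiv (\<lambda>y. snd (g y)) y (- pdx q (g y) / J (g y)) (pdx p (g y) / J (g y))"
      unfolding has_cderiv_def by (simp add: g'_def)
  qed
  moreover have "holo_map_on U' f"
    unfolding holo_map_on_def f_def using p0 q0 *(1,2) by (simp add: holo2_on_subset)
  ultimately have "biholo U' V f"
    unfolding biholo_def holo_map_on_def using fg *(4) by blast
  then show ?thesis using that[of U' V] * U0 unfolding f_def by blast
qed

text \<open>By the chain rule the Jacobian 1 of the identity is a product with the Jacobian of
  \<open>\<phi>\<close> as a factor.\<close>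

lemma biholo_jac_nz:
  assumes "biholo U V \<phi>" "a \<in> U"
  shows "jac (\<lambda>z. fst (\<phi> z), \<lambda>z. snd (\<phi> z)) a \<noteq> 0"
proof -
  obtain \<psi> where \<psi>: "holo_map_on V \<psi>" "\<forall>z\<in>U. \<psi> (\<phi> z) = z"
    and V: "open V" "\<phi> ` U = V" and \<phi>: "holo_map_on U \<phi>"
    using assms(1) unfolding biholo_def by blast
  note h = \<psi>(1)[unfolded holo_map_on_def] \<phi>[unfolded holo_map_on_def]
  have "open U" using h holo2_on_open by blast
  have "jac (\<lambda>z. fst (\<psi> (\<phi> z)), \<lambda>z. snd (\<psi> (\<phi> z))) a = jac (fst, snd) a"
    by (rule jac_cong[symmetric, OF assms(2)]) (use \<psi>(2) \<open>open U\<close> in \<open>auto intro: holo2_intros\<close>)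
  also have "\<dots> = 1" using jac_eqI[OF has_cderiv_fst has_cderiv_snd, of a] by simp
  finally show ?thesis
    using jac_compose[of V "\<lambda>z. fst (\<psi> z)" "\<lambda>z. snd (\<psi> z)" U "\<lambda>z. fst (\<phi> z)" "\<lambda>z. snd (\<phi> z)" a] h assms(2) V(2)
    by auto
qed

text \<open>Integrate the derivative of \<open>\<eta>\<close> along the segment from the origin to
  \<open>z\<close>: the factors \<open>u\<close> and \<open>v\<close> are the means of the partial
  derivatives over the segment, and they are holomorphic in \<open>z\<close>.\<close>

lemma hadamard_lemma:
  assumes h: "holo2_on U \<eta>" and U: "ball (0, 0) r \<subseteq> U" and r: "r > 0" and 0: "\<eta> (0, 0) = 0"
  obtains u v where "holo2_on (ball (0, 0) r) u" "holo2_on (ball (0, 0) r) v"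
    "\<And>z. z \<in> ball (0, 0) r \<Longrightarrow> \<eta> z = u z * fst z + v z * snd z"
proof -
  define B :: "c2 set" where "B = ball (0, 0) r"
  have sc: "(of_real t * fst z, of_real t * snd z) \<in> U" if "z \<in> B" "t \<in> {0..1}" for t :: real and z
  proof -
    have "(of_real t * fst z, of_real t * snd z) = t *\<^sub>R z"
      by (cases z) (simp add: scaleR_conv_of_real)
    moreover have "norm (t *\<^sub>R z) \<le> norm z" using that(2) by (simp add: mult_left_le_one_le)
    ultimately have "(of_real t * fst z, of_real t * snd z) \<in> ball 0 r"
      using that(1) by (simp add: B_def flip: zero_prod_def)
    then show ?thesis using U by (auto simp: zero_prod_def)
  qed
  have holo: "holo2_on B (\<lambda>z. integral {0..1} (\<lambda>t. k (of_real t * fst z, of_real t * snd z)))"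
    if k: "holo2_on U k" for k
  proof (rule holo2_on_integral)
    show "open B" by (simp add: B_def)
    show "continuous_on (B \<times> {0..1}) (\<lambda>(z, t). k (of_real t * fst z, of_real t * snd z))"
      unfolding case_prod_unfold
      by (rule continuous_on_compose2[OF holo2_on_continuous[OF k]])
         (use sc in \<open>auto intro!: continuous_intros\<close>)
    show "holo2_on B (\<lambda>z. k (of_real t * fst z, of_real t * snd z))" if "t \<in> {0..1}" for t
      by (intro holo2_on_compose2[OF k] holo2_intros) (use sc that in \<open>auto simp: B_def\<close>)
  qed
  have eq: "\<eta> z = integral {0..1} (\<lambda>t. pdx \<eta> (of_real t * fst z, of_real t * snd z)) * fst z
    + integral {0..1} (\<lambda>t. pdy \<eta> (of_real t * fst z, of_real t * snd z)) * snd z" if z: "z \<in> B" for z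
  proof -
    define \<gamma> where "\<gamma> t = (of_real t * fst z, of_real t * snd z)" for t :: real
    have cont: "continuous_on {0..1} (\<lambda>t. k (\<gamma> t))" if "holo2_on U k" for k
      unfolding \<gamma>_def by (rule continuous_on_compose2[OF holo2_on_continuous[OF that]])
         (use sc z in \<open>auto intro!: continuous_intros\<close>)
    note int = integrable_continuous_real[OF cont]
    have "((\<lambda>t. pdx \<eta> (\<gamma> t) * fst z + pdy \<eta> (\<gamma> t) * snd z) has_integral (\<eta> (\<gamma> 1) - \<eta> (\<gamma> 0))) {0..1}"
    proof (rule fundamental_theorem_of_calculus)
      fix t :: real assume t: "t \<in> {0..1}"
      have "(\<gamma> has_derivative (\<lambda>s. (of_real s * fst z, of_real s * snd z))) (at t within {0..1})"
        unfolding \<gamma>_def by (auto intro!: derivative_eq_intros)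
      moreover have "(\<eta> has_derivative (\<lambda>v. pdx \<eta> (\<gamma> t) * fst v + pdy \<eta> (\<gamma> t) * snd v)) (at (\<gamma> t))"
        using holo2_on_cderiv[OF h, of "\<gamma> t"] sc[OF z t] by (simp add: \<gamma>_def has_cderiv_def)
      ultimately have "((\<lambda>t. \<eta> (\<gamma> t)) has_derivative (\<lambda>s. pdx \<eta> (\<gamma> t) * (of_real s * fst z) + pdy \<eta> (\<gamma> t) * (of_real s * snd z))) (at t within {0..1})"
        by (auto dest: has_derivative_compose)
      then show "((\<lambda>t. \<eta> (\<gamma> t)) has_vector_derivative (pdx \<eta> (\<gamma> t) * fst z + pdy \<eta> (\<gamma> t) * snd z)) (at t within {0..1})"
        by (simp add: has_vector_derivative_def scaleR_conv_of_real algebra_simps)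
    qed simp
    moreover have "\<gamma> 1 = z" "\<gamma> 0 = (0, 0)" by (simp_all add: \<gamma>_def)
    ultimately have "\<eta> z = integral {0..1} (\<lambda>t. pdx \<eta> (\<gamma> t) * fst z + pdy \<eta> (\<gamma> t) * snd z)"
      using 0 by (simp add: integral_unique)
    also have "\<dots> = integral {0..1} (\<lambda>t. pdx \<eta> (\<gamma> t)) * fst z + integral {0..1} (\<lambda>t. pdy \<eta> (\<gamma> t)) * snd z"
      using int[OF holo2_on_pdx[OF h]] int[OF holo2_on_pdy[OF h]]
      by (subst integral_add) (auto intro: integrable_on_mult_left)
    finally show ?thesis by (simp add: \<gamma>_def)
  qed
  show ?thesis
    using that[OF holo[OF holo2_on_pdx[OF h], unfolded B_def] holo[OF holo2_on_pdy[OF h], unfolded B_def]] eq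
    unfolding B_def by blast
qed

text \<open>Here \<open>p\<close> and \<open>q\<close> are local coordinates vanishing at
  \<open>a\<close>, so Hadamard's lemma, applied to \<open>\<psi>\<close> written in them, exhibits
  \<open>\<psi>\<close> as a combination of \<open>p\<close> and \<open>q\<close>.\<close>

lemma in_ideal2_of_jac_nz:
  assumes p: "holo2_on U p" and q: "holo2_on U q" and a: "a \<in> U" and nz: "jac (p, q) a \<noteq> 0"
    and 0: "p a = 0" "q a = 0" and \<psi>: "germ_at a \<psi>" "\<psi> a = 0"
  shows "in_ideal2 a p q \<psi>"
proof -
  obtain U1 where U1: "a \<in> U1" "holo2_on U1 \<psi>" using \<psi>(1) unfolding germ_at_def by blast
  obtain U2 V where U2: "a \<in> U2" "open U2" "U2 \<subseteq> U" "biholo U2 V (\<lambda>z. (p z, q z))"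
    using holo_inverse_function[OF p q a nz] by blast
  define U3 where "U3 = U1 \<inter> U2"
  have U3: "a \<in> U3" "open U3" "U3 \<subseteq> U2" "U3 \<subseteq> U1" using U1 U2 holo2_on_open by (auto simp: U3_def)
  define V3 where "V3 = (\<lambda>z. (p z, q z)) ` U3"
  have b: "biholo U3 V3 (\<lambda>z. (p z, q z))"
    using biholo_restrict[OF U2(4) U3(2,3)] by (simp add: V3_def)
  then obtain \<theta> where \<theta>: "holo_map_on V3 \<theta>" "\<forall>z\<in>U3. \<theta> (p z, q z) = z" and V3: "open V3"
    unfolding biholo_def by blast
  have img: "\<theta> w \<in> U3" if "w \<in> V3" for w using that \<theta>(2) by (auto simp: V3_def)
  define \<eta> where "\<eta> = (\<lambda>w. \<psi> (\<theta> w))"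
  have h: "holo2_on V3 \<eta>"
    using holo2_on_compose2[OF U1(2), of V3 "\<lambda>w. fst (\<theta> w)" "\<lambda>w. snd (\<theta> w)"] \<theta>(1) img U3(4)
    unfolding holo_map_on_def \<eta>_def by auto
  have "(0, 0) \<in> V3" using U3(1) 0 by (force simp: V3_def)
  then obtain r where r: "r > 0" "ball (0, 0) r \<subseteq> V3"
    using V3 open_contains_ball by blast
  have "\<theta> (0, 0) = a" using \<theta>(2) U3(1) 0 by force
  then have "\<eta> (0, 0) = 0" using \<psi> by (simp add: \<eta>_def)
  from hadamard_lemma[OF h r(2,1) this] obtain u v where
    uv: "holo2_on (ball (0, 0) r) u" "holo2_on (ball (0, 0) r) v"
    "\<And>z. z \<in> ball (0, 0) r \<Longrightarrow> \<eta> z = u z * fst z + v z * snd z" by blast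
  define U4 where "U4 = U3 \<inter> (\<lambda>z. (p z, q z)) -` ball (0, 0) r"
  have p3: "holo2_on U3 p" and q3: "holo2_on U3 q"
    using holo2_on_subset[OF _ U3(2)] U3 U2 p q by blast+
  have U4: "open U4" unfolding U4_def
    by (intro continuous_open_preimage continuous_intros holo2_on_continuous p3 q3 U3) simp
  have p4: "holo2_on U4 p" and q4: "holo2_on U4 q"
    using holo2_on_subset[OF _ U4] p3 q3 by (auto simp: U4_def)
  have "\<psi> z = u (p z, q z) * p z + v (p z, q z) * q z" if "z \<in> U4" for z
    using uv(3)[of "(p z, q z)"] \<theta>(2) that by (auto simp: U4_def \<eta>_def)
  moreover have "holo2_on U4 (\<lambda>z. u (p z, q z))" "holo2_on U4 (\<lambda>z. v (p z, q z))"
    by (rule holo2_on_compose2[OF uv(1) p4 q4]; auto simp: U4_def)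
       (rule holo2_on_compose2[OF uv(2) p4 q4]; auto simp: U4_def)
  moreover have "a \<in> U4" using U3 0 r by (auto simp: U4_def)
  ultimately show ?thesis unfolding in_ideal2_def by blast
qed

text \<open>The ideal is the maximal ideal: \<open>\<psi> - \<psi> a\<close> always lies in it, so
  the germ 1 spans the quotient, and 1 itself does not lie in it, so no empty family does.\<close>

lemma local_dim_eq_1:
  assumes "holo2_on U p" "holo2_on U q" "a \<in> U" "jac (p, q) a \<noteq> 0" "p a = 0" "q a = 0"
  shows "local_dim a p q = enat 1"
proof -
  have "spans_quot a p q 1"
    unfolding spans_quot_def
  proof (intro exI[of _ "\<lambda>_ _. 1"] conjI allI impI)
    show "germ_at a (\<lambda>_. 1)" unfolding germ_at_def using holo2_on_const[of UNIV] by blast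
    fix \<psi> assume "germ_at a \<psi>"
    then obtain V where V: "a \<in> V" "holo2_on V \<psi>" unfolding germ_at_def by blast
    then have "holo2_on V (\<lambda>z. \<psi> z - \<psi> a)" by (intro holo2_intros holo2_on_open)
    then have "in_ideal2 a p q (\<lambda>z. \<psi> z - \<psi> a)"
      by (intro in_ideal2_of_jac_nz[OF assms]) (use V in \<open>auto simp: germ_at_def\<close>)
    then show "\<exists>c :: nat \<Rightarrow> complex. in_ideal2 a p q (\<lambda>z. \<psi> z - (\<Sum>k<1. c k * 1))"
      by (intro exI[of _ "\<lambda>_. \<psi> a"]) simp
  qed
  moreover have "\<not> spans_quot a p q 0"
  proof
    assume "spans_quot a p q 0"
    moreover have "germ_at a (\<lambda>_. 1)" unfolding germ_at_def using holo2_on_const[of UNIV] by blast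
    ultimately have "in_ideal2 a p q (\<lambda>z. 1)" unfolding spans_quot_def by force
    then show False unfolding in_ideal2_def using assms by force
  qed
  ultimately show ?thesis unfolding local_dim_def
    by (intro antisym INF_lower INF_greatest) (auto simp: Suc_le_eq intro!: gr0I)
qed

text \<open>A generator that is nonzero at \<open>a\<close> is a unit of the local ring; dividing by
  it puts every germ into the ideal.\<close>

lemma local_dim_eq_0:
  assumes "holo2_on U p" "holo2_on U q" "a \<in> U" "p a \<noteq> 0 \<or> q a \<noteq> 0"
  shows "local_dim a p q = enat 0"
proof -
  have ideal: "in_ideal2 a p q \<psi>" if g: "germ_at a \<psi>" for \<psi>
  proof -
    obtain V where V: "a \<in> V" "holo2_on V \<psi>" using g unfolding germ_at_def by blast
    define W where "W k = V \<inter> (U \<inter> k -` (-{0}))" for k :: "c2 \<Rightarrow> complex"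
    have W: "open (W k)" if "holo2_on U k" for k
      unfolding W_def using holo2_on_open[OF that] holo2_on_continuous[OF that] holo2_on_open[OF V(2)]
      by (intro open_Int continuous_open_preimage) auto
    have quot: "holo2_on (W k) (\<lambda>z. \<psi> z / k z)" if "holo2_on U k" for k
      by (intro holo2_intros holo2_on_subset[OF V(2) W] holo2_on_subset[OF that W] that)
         (auto simp: W_def)
    show ?thesis
    proof (cases "p a = 0")
      case False
      show ?thesis unfolding in_ideal2_def
        by (rule exI[of _ "W p"], rule exI[of _ "\<lambda>z. \<psi> z / p z"], rule exI[of _ "\<lambda>_. 0"])
           (use quot W False assms V in \<open>auto simp: holo2_on_const\<close>, auto simp: W_def)
    next
      case True
      show ?thesis unfolding in_ideal2_def
        by (rule exI[of _ "W q"], rule exI[of _ "\<lambda>_. 0"], rule exI[of _ "\<lambda>z. \<psi> z / q z"])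
           (use quot W True assms V in \<open>auto simp: holo2_on_const\<close>, auto simp: W_def)
    qed
  qed
  then have "spans_quot a p q 0" unfolding spans_quot_def by simp
  then show ?thesis unfolding local_dim_def
    by (metis INF_lower enat_0 le_zero_eq mem_Collect_eq)
qed

section \<open>Maps with vanishing differential\<close>

text \<open>A Hartogs type argument. If the zero were isolated, the maximum principle for the
  reciprocal of \<open>h\<close> on the discs \<open>x = const\<close> would keep
  \<open>h (x, y0)\<close> away from 0 for all \<open>x\<close> near \<open>x0\<close> other than
  \<open>x0\<close>, against continuity.\<close>

lemma holo2_zeros_not_isolated:
  assumes h: "holo2_on U h" and a: "a \<in> U" "h a = 0" and V: "open V" "a \<in> V"
  shows "\<exists>z\<in>V. z \<noteq> a \<and> h z = 0"
proof (rule ccontr)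
  assume contra: "\<not> ?thesis"
  obtain x0 y0 where a_eq: "a = (x0, y0)" by (cases a)
  have "open (U \<inter> V)" using V holo2_on_open[OF h] by blast
  then obtain r where r: "r > 0" "cball x0 r \<times> cball y0 r \<subseteq> U \<inter> V"
    using open_contains_bicball[of "U \<inter> V" x0 y0] a V a_eq by blast
  have nz: "h (x, y) \<noteq> 0" if "x \<in> cball x0 r" "y \<in> cball y0 r" "(x, y) \<noteq> (x0, y0)" for x y
  proof -
    have "(x, y) \<in> V" using r(2) that(1,2) by blast
    then show ?thesis using contra that(3) a_eq by blast
  qed
  define K where "K = sphere y0 r"
  have K: "compact K" "K \<noteq> {}" using r by (auto simp: K_def)
  have "continuous_on K (\<lambda>y. norm (h (x0, y)))"
    by (intro continuous_intros continuous_on_compose2[OF holo2_on_continuous[OF h]])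
       (use r in \<open>auto simp: K_def subset_iff\<close>)
  then obtain y1 where y1: "y1 \<in> K" "\<forall>y\<in>K. norm (h (x0, y1)) \<le> norm (h (x0, y))"
    using continuous_attains_inf[OF K] by blast
  \<comment> \<open>Half of the minimum on the circle leaves room for a strict bound on a whole
    neighbourhood of \<open>{x0} \<times> K\<close>.\<close>
  define m where "m = norm (h (x0, y1)) / 2"
  have "y1 \<noteq> y0" using y1(1) r by (auto simp: K_def)
  then have m: "m > 0" using nz[of x0 y1] y1(1) r unfolding m_def by (simp add: K_def)
  define W where "W = U \<inter> h -` {w. norm w > m}"
  have "open {w::complex. norm w > m}" by (intro open_Collect_less continuous_intros)
  then have "open W" unfolding W_def
    by (intro continuous_open_preimage holo2_on_continuous[OF h] holo2_on_open[OF h])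
  moreover have "{x0} \<times> K \<subseteq> W"
  proof safe
    fix y assume y: "y \<in> K"
    then have "norm (h (x0, y)) \<ge> 2 * m" using y1 by (simp add: m_def)
    then show "(x0, y) \<in> W" using m y r by (auto simp: W_def K_def)
  qed
  \<comment> \<open>The circle is compact, so one neighbourhood \<open>X\<close> of
    \<open>x0\<close> serves all its points.\<close>
  ultimately obtain X where X: "x0 \<in> X" "open X" "X \<times> K \<subseteq> W"
    using Elementary_Topology.tube_lemma[OF K(1)] by metis
  have big: "norm (h (x, y0)) \<ge> m" if x: "x \<in> X" "x \<in> ball x0 r" "x \<noteq> x0" for x
  proof -
    have hx: "(\<lambda>y. h (x, y)) holomorphic_on cball y0 r"
      by (rule holo2_on_section2[OF h]) (use r x in auto)
    have nzx: "h (x, y) \<noteq> 0" if "y \<in> cball y0 r" for y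
      using nz[of x y] x that by auto
    have "norm (inverse (h (x, y0))) \<le> inverse m"
    proof (rule maximum_modulus_frontier[where f="\<lambda>y. inverse (h (x, y))" and S="cball y0 r"])
      show "(\<lambda>y. inverse (h (x, y))) holomorphic_on interior (cball y0 r)"
        by (intro holomorphic_intros holomorphic_on_subset[OF hx]) (use nzx in auto)
      show "continuous_on (closure (cball y0 r)) (\<lambda>y. inverse (h (x, y)))"
        using nzx by (auto intro!: continuous_intros holomorphic_on_imp_continuous_on[OF hx])
      show "norm (inverse (h (x, y))) \<le> inverse m" if "y \<in> frontier (cball y0 r)" for y
      proof -
        have "(x, y) \<in> W" using that r X(3) x(1) by (auto simp: K_def)
        then have "norm (h (x, y)) > m" by (simp add: W_def)
        then show ?thesis using m by (simp add: norm_inverse le_imp_inverse_le)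
      qed
    qed (use r in auto)
    then show ?thesis using m nzx[of y0] r by (simp add: norm_inverse)
  qed
  have "((\<lambda>x. h (x, y0)) has_field_derivative pdx h (x0, y0)) (at x0)"
    using has_cderiv_section1 holo2_on_cderiv[OF h] a a_eq by blast
  then have "isCont (\<lambda>x. h (x, y0)) x0" by (rule DERIV_isCont)
  then have "((\<lambda>x. norm (h (x, y0))) \<longlongrightarrow> 0) (at x0)"
    using a a_eq by (auto simp: isCont_def intro: tendsto_norm_zero)
  then have "eventually (\<lambda>x. norm (h (x, y0)) < m) (at x0)"
    using m by (rule order_tendstoD)
  moreover have "eventually (\<lambda>x. x \<in> X \<inter> ball x0 r) (at x0)"
    by (rule eventually_at_in_open') (use X r in auto)
  moreover have "eventually (\<lambda>x. x \<noteq> x0) (at x0)" by (simp add: eventually_at_filter)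
  ultimately have "eventually (\<lambda>x. False) (at x0)"
    by eventually_elim (use big in force)
  then show False by simp
qed

text \<open>A variant of \<open>spans_quot\<close> in which \<open>N\<close> need not be an ideal
  and the index set is an arbitrary finite set. This is what allows enlarging \<open>N\<close> by
  one function at a time while removing one member of the spanning family.\<close>

definition spans_mod :: "c2 \<Rightarrow> (c2 \<Rightarrow> complex) set \<Rightarrow> (nat \<Rightarrow> c2 \<Rightarrow> complex) \<Rightarrow> nat set \<Rightarrow> bool" where
  "spans_mod a N b K \<longleftrightarrow> finite K \<and> (\<forall>k\<in>K. germ_at a (b k)) \<and>
     (\<forall>\<psi>. germ_at a \<psi> \<longrightarrow> (\<exists>c. (\<lambda>z. \<psi> z - (\<Sum>k\<in>K. c k * b k z)) \<in> N))"

text \<open>Steinitz exchange: since \<open>p\<close> is not in \<open>N\<close>, some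
  \<open>b j\<close> has a nonzero coefficient in the expansion of \<open>p\<close>, so modulo
  \<open>N\<close> and \<open>p\<close> it is a combination of the other members.\<close>

lemma spans_mod_drop:
  assumes N: "\<And>\<phi> \<xi> c. \<phi> \<in> N \<Longrightarrow> \<xi> \<in> N \<Longrightarrow> (\<lambda>z. \<phi> z + c * \<xi> z) \<in> N"
    and p: "germ_at a p" "p \<notin> N" and sp: "spans_mod a N b K"
  shows "\<exists>j\<in>K. spans_mod a {\<lambda>z. \<phi> z + c * p z |\<phi> c. \<phi> \<in> N} b (K - {j})"
proof -
  have K: "finite K" using sp by (simp add: spans_mod_def)
  obtain c where c: "(\<lambda>z. p z - (\<Sum>k\<in>K. c k * b k z)) \<in> N"
    using sp p(1) unfolding spans_mod_def by blast
  obtain j where j: "j \<in> K" "c j \<noteq> 0"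
  proof (rule ccontr)
    assume "\<not> thesis"
    then have "(\<Sum>k\<in>K. c k * b k z) = 0" for z using that by (intro sum.neutral) auto
    then show False using c p(2) by simp
  qed
  have "\<exists>e. (\<lambda>z. \<psi> z - (\<Sum>k\<in>K-{j}. e k * b k z)) \<in> {\<lambda>z. \<phi> z + c * p z |\<phi> c. \<phi> \<in> N}"
    if \<psi>: "germ_at a \<psi>" for \<psi>
  proof -
    obtain d where d: "(\<lambda>z. \<psi> z - (\<Sum>k\<in>K. d k * b k z)) \<in> N"
      using sp \<psi> unfolding spans_mod_def by blast
    \<comment> \<open>Subtracting \<open>q\<close> times the expansion of \<open>p\<close> cancels
      the coefficient of \<open>b j\<close> in that of \<open>\<psi>\<close>.\<close>
    define q where "q = d j / c j"
    define e where "e k = d k - q * c k" for k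
    have "q * c j = d j" using j by (simp add: q_def)
    moreover have "(\<Sum>k\<in>K. d k * b k z) = d j * b j z + (\<Sum>k\<in>K-{j}. d k * b k z)"
      "(\<Sum>k\<in>K. c k * b k z) = c j * b j z + (\<Sum>k\<in>K-{j}. c k * b k z)" for z
      using K j by (simp_all add: sum.remove)
    moreover have "(\<Sum>k\<in>K-{j}. e k * b k z) = (\<Sum>k\<in>K-{j}. d k * b k z) - q * (\<Sum>k\<in>K-{j}. c k * b k z)" for z
      by (simp add: e_def algebra_simps sum_subtractf sum_distrib_left)
    ultimately have eq: "\<psi> z - (\<Sum>k\<in>K-{j}. e k * b k z) =
        ((\<psi> z - (\<Sum>k\<in>K. d k * b k z)) + (-q) * (p z - (\<Sum>k\<in>K. c k * b k z))) + q * p z" for z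
      by (simp add: algebra_simps)
    define \<phi> where "\<phi> = (\<lambda>z. (\<psi> z - (\<Sum>k\<in>K. d k * b k z)) + (-q) * (p z - (\<Sum>k\<in>K. c k * b k z)))"
    have "(\<lambda>z. \<psi> z - (\<Sum>k\<in>K-{j}. e k * b k z)) = (\<lambda>z. \<phi> z + q * p z)"
      unfolding \<phi>_def by (rule ext, rule eq)
    moreover have "\<phi> \<in> N" unfolding \<phi>_def by (rule N[OF d c])
    ultimately have "(\<lambda>z. \<psi> z - (\<Sum>k\<in>K-{j}. e k * b k z)) \<in> {\<lambda>z. \<phi> z + c * p z |\<phi> c. \<phi> \<in> N}" by blast
    then show ?thesis by blast
  qed
  then show ?thesis using sp j unfolding spans_mod_def by blast
qed

text \<open>Renumbers the members that survive the exchanges by an initial segment of the naturals,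
  as \<open>spans_quot\<close> requires.\<close>

lemma spans_mod_imp_spans_quot:
  assumes "spans_mod a N b K" "\<And>\<phi>. \<phi> \<in> N \<Longrightarrow> in_ideal2 a g h \<phi>"
  shows "spans_quot a g h (card K)"
proof -
  have K: "finite K" using assms by (simp add: spans_mod_def)
  obtain \<sigma> where \<sigma>: "bij_betw \<sigma> {..<card K} K"
    using ex_bij_betw_nat_finite[OF K] by (auto simp: atLeast0LessThan)
  have eq: "(\<Sum>k\<in>K. c k * b k z) = (\<Sum>i<card K. c (\<sigma> i) * b (\<sigma> i) z)" for c z
    by (rule sum.reindex_bij_betw[OF \<sigma>, symmetric])
  have "\<exists>c. in_ideal2 a g h (\<lambda>z. \<psi> z - (\<Sum>i<card K. c i * b (\<sigma> i) z))" if "germ_at a \<psi>" for \<psi>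
  proof -
    obtain c where "(\<lambda>z. \<psi> z - (\<Sum>k\<in>K. c k * b k z)) \<in> N"
      using assms(1) \<open>germ_at a \<psi>\<close> unfolding spans_mod_def by blast
    then show ?thesis using assms(2) eq by (intro exI[of _ "\<lambda>i. c (\<sigma> i)"]) simp
  qed
  moreover have "\<forall>i<card K. germ_at a (b (\<sigma> i))"
    using assms \<sigma> unfolding spans_mod_def by (auto simp: bij_betw_def)
  ultimately show ?thesis unfolding spans_quot_def by (intro exI[of _ "\<lambda>i. b (\<sigma> i)"]) auto
qed

lemma in_ideal2_lin:
  assumes "in_ideal2 a g h \<phi>" "in_ideal2 a g h \<xi>"
  shows "in_ideal2 a g h (\<lambda>z. \<phi> z + c * \<xi> z)"
proof -
  obtain U u v where 1: "a \<in> U" "holo2_on U u" "holo2_on U v" "\<forall>z\<in>U. \<phi> z = u z * g z + v z * h z"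
    using assms(1) unfolding in_ideal2_def by blast
  obtain U' u' v' where 2: "a \<in> U'" "holo2_on U' u'" "holo2_on U' v'" "\<forall>z\<in>U'. \<xi> z = u' z * g z + v' z * h z"
    using assms(2) unfolding in_ideal2_def by blast
  have o: "open (U \<inter> U')" using 1 2 holo2_on_open by blast
  have "holo2_on (U \<inter> U') (\<lambda>z. u z + c * u' z)" "holo2_on (U \<inter> U') (\<lambda>z. v z + c * v' z)"
    using 1(2,3) 2(2,3) by (auto intro!: holo2_intros o elim: holo2_on_subset[OF _ o])
  moreover have "\<forall>z\<in>U \<inter> U'. \<phi> z + c * \<xi> z = (u z + c * u' z) * g z + (v z + c * v' z) * h z"
    using 1(4) 2(4) by (simp add: algebra_simps)
  ultimately show ?thesis unfolding in_ideal2_def using 1(1) 2(1) by blast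
qed

lemma jac11_eq_jac: "jac11 (f, g) = jac (jac (f, g), f)"
  by (simp add: jac11_def jac_def fun_eq_iff)

text \<open>Both \<open>f_x\<close> and \<open>f_y\<close>, even together, are independent modulo
  the ideal \<open>(J, J11)\<close>. Adjoining them one after the other costs two members of the
  spanning family, and what remains spans modulo \<open>(f_x, f_y)\<close>.\<close>

lemma spans_quot_rank0:
  assumes f: "holo2_on UNIV f" and g: "holo2_on UNIV g"
    and f0: "pdx f a = 0" "pdy f a = 0" and g0: "pdx g a = 0" "pdy g a = 0"
    and V: "open V" "a \<in> V" "{z\<in>V. pdx f z = 0 \<and> pdy f z = 0} \<subseteq> {a}"
    and sp: "spans_quot a (jac (f, g)) (jac11 (f, g)) n"
  shows "n \<ge> 2" "spans_quot a (pdx f) (pdy f) (n - 2)"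
proof -
  define J where "J = jac (f, g)"
  note pf = holo2_on_pdx[OF f] holo2_on_pdy[OF f]
  note pg = holo2_on_pdx[OF g] holo2_on_pdy[OF g]
  have Jh: "holo2_on UNIV J" unfolding J_def by (rule holo2_on_jac[OF f g])
  note pJ = holo2_on_pdx[OF Jh] holo2_on_pdy[OF Jh]
  \<comment> \<open>\<open>J\<close> is a difference of products of two functions vanishing at
    \<open>a\<close>.\<close>
  have "has_cderiv J a 0 0"
    using has_cderiv_diff[OF has_cderiv_mult[OF holo2_on_cderiv[OF pf(1)] holo2_on_cderiv[OF pg(2)]]
        has_cderiv_mult[OF holo2_on_cderiv[OF pf(2)] holo2_on_cderiv[OF pg(1)]], of a]
    by (simp add: J_def jac_def f0 g0)
  then have J0: "pdx J a = 0" "pdy J a = 0" by (auto simp: has_cderiv_pdx has_cderiv_pdy)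
  \<comment> \<open>In \<open>J = g_y f_x - g_x f_y\<close> and
    \<open>J11 = J_x f_y - J_y f_x\<close> the coefficients of \<open>f_x\<close> and
    \<open>f_y\<close> vanish at \<open>a\<close>.\<close>
  have in_mI: "\<exists>U u v. a \<in> U \<and> holo2_on U u \<and> holo2_on U v \<and> u a = 0 \<and> v a = 0 \<and>
      (\<forall>z\<in>U. \<phi> z = u z * pdx f z + v z * pdy f z)"
    if \<phi>: "in_ideal2 a J (jac11 (f, g)) \<phi>" for \<phi>
  proof -
    obtain U u v where 1: "a \<in> U" "holo2_on U u" "holo2_on U v" "\<forall>z\<in>U. \<phi> z = u z * J z + v z * jac11 (f, g) z"
      using \<phi> unfolding in_ideal2_def by blast
    have o: "open U" using 1 holo2_on_open by blast
    have "holo2_on U (\<lambda>z. u z * pdy g z - v z * pdy J z)" "holo2_on U (\<lambda>z. v z * pdx J z - u z * pdx g z)"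
      by (intro holo2_intros 1 holo2_on_subset[OF pg(1) o] holo2_on_subset[OF pg(2) o]
          holo2_on_subset[OF pJ(1) o] holo2_on_subset[OF pJ(2) o]; simp)+
    moreover have "\<phi> z = (u z * pdy g z - v z * pdy J z) * pdx f z + (v z * pdx J z - u z * pdx g z) * pdy f z"
      if "z \<in> U" for z
    proof -
      have "J z = pdx f z * pdy g z - pdy f z * pdx g z" "jac11 (f, g) z = pdx J z * pdy f z - pdy J z * pdx f z"
        by (simp_all add: J_def jac_def jac11_def)
      moreover have "\<phi> z = u z * J z + v z * jac11 (f, g) z" using 1(4) that by blast
      ultimately show ?thesis by (simp only:) (simp add: algebra_simps)
    qed
    ultimately show ?thesis using 1(1) g0 J0
      by (intro exI[of _ U] exI[of _ "\<lambda>z. u z * pdy g z - v z * pdy J z"]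
          exI[of _ "\<lambda>z. v z * pdx J z - u z * pdx g z"]) simp
  qed
  have indep: "\<not> in_ideal2 a J (jac11 (f, g)) (\<lambda>z. \<alpha> * pdx f z + \<beta> * pdy f z)" if nz: "\<alpha> \<noteq> 0 \<or> \<beta> \<noteq> 0" for \<alpha> \<beta>
  proof
    assume "in_ideal2 a J (jac11 (f, g)) (\<lambda>z. \<alpha> * pdx f z + \<beta> * pdy f z)"
    from in_mI[OF this] obtain U u v where uv: "a \<in> U" "holo2_on U u" "holo2_on U v" "u a = 0" "v a = 0"
      and eq: "\<forall>z\<in>U. \<alpha> * pdx f z + \<beta> * pdy f z = u z * pdx f z + v z * pdy f z" by blast
    have o: "open U" using uv holo2_on_open by blast
    show False
    proof (cases "\<alpha> = 0")
      case False
      \<comment> \<open>On \<open>W\<close> the factor \<open>\<alpha> - u\<close> has no zero, so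
        the relation forces \<open>f_x = 0\<close> wherever \<open>f_y = 0\<close>. Since
        \<open>f_y\<close> has zeros in \<open>W\<close> other than \<open>a\<close>, this
        contradicts the isolation of the common zeros.\<close>
      define W where "W = V \<inter> (U \<inter> u -` (-{\<alpha>}))"
      have "open W" unfolding W_def
        by (intro open_Int[OF V(1)] continuous_open_preimage holo2_on_continuous[OF uv(2)] o open_Compl closed_singleton)
      moreover have "a \<in> W" using V uv False by (simp add: W_def)
      ultimately obtain z where z: "z \<in> W" "z \<noteq> a" "pdy f z = 0"
        using holo2_zeros_not_isolated[OF pf(2), of a W] f0 by auto
      have "\<alpha> * pdx f z + \<beta> * pdy f z = u z * pdx f z + v z * pdy f z"
        using eq z(1) by (simp add: W_def)
      then have "(\<alpha> - u z) * pdx f z = 0" using z(3) by (simp add: left_diff_distrib)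
      then have "pdx f z = 0" using z by (auto simp: W_def)
      then show False using V(3) z by (auto simp: W_def)
    next
      case True
      then have "\<beta> \<noteq> 0" using nz by simp
      define W where "W = V \<inter> (U \<inter> v -` (-{\<beta>}))"
      have "open W" unfolding W_def
        by (intro open_Int[OF V(1)] continuous_open_preimage holo2_on_continuous[OF uv(3)] o open_Compl closed_singleton)
      moreover have "a \<in> W" using V uv \<open>\<beta> \<noteq> 0\<close> by (simp add: W_def)
      ultimately obtain z where z: "z \<in> W" "z \<noteq> a" "pdx f z = 0"
        using holo2_zeros_not_isolated[OF pf(1), of a W] f0 by auto
      have "\<alpha> * pdx f z + \<beta> * pdy f z = u z * pdx f z + v z * pdy f z"
        using eq z(1) by (simp add: W_def)
      then have "(\<beta> - v z) * pdy f z = 0" using z(3) by (simp add: left_diff_distrib)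
      then have "pdy f z = 0" using z by (auto simp: W_def)
      then show False using V(3) z by (auto simp: W_def)
    qed
  qed
  \<comment> \<open>\<open>N0\<close> is the ideal \<open>(J, J11)\<close>; \<open>N1\<close> and
    \<open>N2\<close> add only constant multiples of \<open>f_x\<close> and \<open>f_y\<close> and
    are used merely as vector spaces.\<close>
  define N0 where "N0 = {\<phi>. in_ideal2 a J (jac11 (f, g)) \<phi>}"
  define N1 where "N1 = {\<lambda>z. \<phi> z + c * pdx f z |\<phi> c. \<phi> \<in> N0}"
  define N2 where "N2 = {\<lambda>z. \<phi> z + c * pdy f z |\<phi> c. \<phi> \<in> N1}"
  have lin0: "(\<lambda>z. \<phi> z + c * \<xi> z) \<in> N0" if "\<phi> \<in> N0" "\<xi> \<in> N0" for \<phi> \<xi> c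
    using that in_ideal2_lin unfolding N0_def by blast
  have lin1: "(\<lambda>z. \<phi> z + c * \<xi> z) \<in> N1" if "\<phi> \<in> N1" "\<xi> \<in> N1" for \<phi> \<xi> c
  proof -
    obtain \<phi>' d \<xi>' e where 1: "\<phi>' \<in> N0" "\<xi>' \<in> N0" "\<phi> = (\<lambda>z. \<phi>' z + d * pdx f z)" "\<xi> = (\<lambda>z. \<xi>' z + e * pdx f z)"
      using \<open>\<phi> \<in> N1\<close> \<open>\<xi> \<in> N1\<close> unfolding N1_def by blast
    then have "(\<lambda>z. \<phi> z + c * \<xi> z) = (\<lambda>z. (\<phi>' z + c * \<xi>' z) + (d + c * e) * pdx f z)"
      by (auto simp: algebra_simps)
    then show ?thesis using lin0[OF 1(1,2), of c] unfolding N1_def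
      by (intro CollectI exI[of _ "\<lambda>z. \<phi>' z + c * \<xi>' z"] exI[of _ "d + c * e"] conjI)
  qed
  have germs: "germ_at a (pdx f)" "germ_at a (pdy f)" using pf unfolding germ_at_def by blast+
  obtain b where b: "spans_mod a N0 b {..<n}"
    using sp unfolding spans_quot_def spans_mod_def N0_def J_def by auto
  have "pdx f \<notin> N0" using indep[of 1 0] by (simp add: N0_def)
  from spans_mod_drop[OF lin0 germs(1) this b]
  have "\<exists>i\<in>{..<n}. spans_mod a N1 b ({..<n} - {i})" unfolding N1_def .
  then obtain i where i: "i < n" "spans_mod a N1 b ({..<n} - {i})" by blast
  have "pdy f \<notin> N1"
  proof
    assume "pdy f \<in> N1"
    then obtain \<phi> c where 1: "\<phi> \<in> N0" "pdy f = (\<lambda>z. \<phi> z + c * pdx f z)" unfolding N1_def by blast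
    then have "\<phi> = (\<lambda>z. (-c) * pdx f z + 1 * pdy f z)" by (simp add: fun_eq_iff)
    then show False using indep[of "-c" 1] 1(1) by (simp add: N0_def)
  qed
  from spans_mod_drop[OF lin1 germs(2) this i(2)]
  have "\<exists>j\<in>{..<n} - {i}. spans_mod a N2 b ({..<n} - {i} - {j})" unfolding N2_def .
  then obtain j where j: "j < n" "j \<noteq> i" "spans_mod a N2 b ({..<n} - {i} - {j})" by blast
  show "n \<ge> 2" using i(1) j(1,2) by linarith
  \<comment> \<open>\<open>N2\<close> lies in the ideal of the partial derivatives, because
    \<open>J\<close> and \<open>J11\<close> do.\<close>
  have "in_ideal2 a (pdx f) (pdy f) \<phi>" if \<phi>: "\<phi> \<in> N2" for \<phi>
  proof -
    obtain \<phi>' c d where 1: "\<phi>' \<in> N0" "\<phi> = (\<lambda>z. \<phi>' z + c * pdx f z + d * pdy f z)"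
    proof -
      obtain \<phi>\<^sub>1 d where 2: "\<phi>\<^sub>1 \<in> N1" "\<phi> = (\<lambda>z. \<phi>\<^sub>1 z + d * pdy f z)" using \<phi> unfolding N2_def by blast
      obtain \<phi>' c where "\<phi>' \<in> N0" "\<phi>\<^sub>1 = (\<lambda>z. \<phi>' z + c * pdx f z)" using 2(1) unfolding N1_def by blast
      with 2(2) show ?thesis using that by simp
    qed
    obtain U u v where uv: "a \<in> U" "holo2_on U u" "holo2_on U v"
      and eq: "\<forall>z\<in>U. \<phi>' z = u z * pdx f z + v z * pdy f z"
      using in_mI 1(1) unfolding N0_def by blast
    have "holo2_on U (\<lambda>z. u z + c)" "holo2_on U (\<lambda>z. v z + d)"
      by (intro holo2_intros uv holo2_on_open[OF uv(2)])+
    moreover have "\<forall>z\<in>U. \<phi> z = (u z + c) * pdx f z + (v z + d) * pdy f z"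
      using eq 1(2) by (simp add: algebra_simps)
    ultimately show ?thesis unfolding in_ideal2_def using uv(1) by blast
  qed
  from spans_mod_imp_spans_quot[OF j(3) this] show "spans_quot a (pdx f) (pdy f) (n - 2)"
    using i(1) j(1,2) by (simp add: card_Diff_subset numeral_2_eq_2)
qed

section \<open>Weierstrass polynomials of degree three\<close>

lemma sum_mset_replicate:
  fixes f :: "'a \<Rightarrow> complex"
  assumes "finite Z"
  shows "sum_mset (image_mset f (\<Sum>p\<in>Z. replicate_mset (m p) p)) = (\<Sum>p\<in>Z. of_nat (m p) * f p)"
  using assms by (induction Z rule: finite_induct) (auto simp: image_replicate_mset sum_mset_replicate_mset)

text \<open>On the circle \<open>h\<close> is a small perturbation of \<open>g\<close>, which has a
  triple zero at 0, so by Rouche's theorem \<open>h\<close> has three zeros inside, counted with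
  multiplicity. The argument principle weighted by \<open>y ^ k\<close> sums their powers.\<close>

lemma cubic_root_power_sums:
  fixes h g u :: "complex \<Rightarrow> complex"
  assumes h: "h holomorphic_on ball 0 R" and u: "u holomorphic_on ball 0 R" and r: "0 < r" "r < R"
    and g: "\<And>y. y \<in> ball 0 R \<Longrightarrow> g y = y ^ 3 * u y" "\<And>y. y \<in> ball 0 R \<Longrightarrow> u y \<noteq> 0"
    and less: "\<And>y. norm y = r \<Longrightarrow> norm (h y - g y) < norm (g y)"
  obtains p q s where "{y. norm y < r \<and> h y = 0} = {p, q, s}"
    "\<And>k. contour_integral (circlepath 0 r) (\<lambda>y. deriv h y * y ^ k / h y) = 2 * pi * \<i> * (p ^ k + q ^ k + s ^ k)"
proof -
  \<comment> \<open>The theorems used want an open set around the circle with finitely many zeros in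
    it; the closed disc of radius \<open>\<rho>\<close> is still compact inside the domain.\<close>
  define \<rho> where "\<rho> = (r + R) / 2"
  have \<rho>: "r < \<rho>" "\<rho> < R" using r by (auto simp: \<rho>_def)
  define S where "S = ball (0::complex) \<rho>"
  have S: "open S" "connected S" "S \<subseteq> ball 0 R" "cball 0 \<rho> \<subseteq> ball (0::complex) R"
    using \<rho> by (auto simp: S_def)
  have "(\<lambda>y. y ^ 3 * u y) holomorphic_on ball 0 R" by (intro holomorphic_intros u)
  then have gh: "g holomorphic_on ball 0 R" by (rule holomorphic_transform) (use g in auto)
  have hr: "h y \<noteq> 0" if "norm y = r" for y using less[OF that] by auto
  have finh: "finite {p\<in>S. h p = 0}"
  \<comment> \<open>Finiteness of zeros needs a nonconstant function; a constant \<open>h\<close>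
    has no zeros, because it is nonzero on the circle.\<close>
  proof (cases "h constant_on ball 0 R")
    case True
    then obtain c where c: "\<And>y. y \<in> ball 0 R \<Longrightarrow> h y = c" unfolding constant_on_def by blast
    have "h (of_real r) = c" using c r by simp
    moreover have "h (of_real r) \<noteq> 0" using hr r by simp
    ultimately have "{p\<in>S. h p = 0} = {}" using c S by auto
    then show ?thesis by (metis finite.emptyI)
  next
    case False
    have "finite {z\<in>cball 0 \<rho>. h z = 0}"
      by (rule holomorphic_compact_finite_zeros[OF h _ _ _ S(4) False]) auto
    then show ?thesis by (rule finite_subset[rotated]) (auto simp: S_def)
  qed
  have g0: "{p\<in>S. g p = 0} = {0}" using g S r \<rho> by (auto simp: S_def)
  define \<gamma> where "\<gamma> = circlepath 0 r"
  have \<gamma>: "valid_path \<gamma>" "pathfinish \<gamma> = pathstart \<gamma>" "path_image \<gamma> = sphere 0 r"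
    using r by (simp_all add: \<gamma>_def)
  have w1: "winding_number \<gamma> p = 1" if "norm p < r" for p
    unfolding \<gamma>_def using that by (simp add: winding_number_circlepath)
  have w0: "winding_number \<gamma> p = 0" if "norm p > r" for p
    by (rule winding_number_zero_outside[of _ "cball 0 r"]) (use that \<gamma> in \<open>auto simp: valid_path_imp_path\<close>)
  have homo: "\<forall>z. z \<notin> S \<longrightarrow> winding_number \<gamma> z = 0" using w0 \<rho> by (auto simp: S_def)
  define Z where "Z = {y. norm y < r \<and> h y = 0}"
  have Z: "Z \<subseteq> {p\<in>S. h p = 0}" using \<rho> by (auto simp: Z_def S_def)
  then have finZ: "finite Z" using finh finite_subset by blast
  \<comment> \<open>Zeros in \<open>S\<close> outside the circle have winding number 0 and drop out
    of the sums.\<close>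
  have restrict: "(\<Sum>p\<in>{p\<in>S. h p = 0}. winding_number \<gamma> p * e p) = (\<Sum>p\<in>Z. e p)" for e
  proof (rule sum.mono_neutral_cong_right[OF finh Z])
    show "\<forall>p\<in>{p \<in> S. h p = 0} - Z. winding_number \<gamma> p * e p = 0"
    proof
      fix p assume "p \<in> {p \<in> S. h p = 0} - Z"
      then have "norm p > r" using hr[of p] by (auto simp: Z_def not_less less_le)
      then show "winding_number \<gamma> p * e p = 0" using w0 by simp
    qed
  qed (auto simp: Z_def w1)
  have "zorder g 0 = 3"
    by (rule zorder_eqI[of "ball 0 R" _ u]) (use r g u in auto)
  have fg: "g y + (h y - g y) = h y" for y by simp
  have "(\<Sum>p\<in>{p\<in>S. h p = 0}. winding_number \<gamma> p * zorder h p) = (\<Sum>p\<in>{p\<in>S. g p = 0}. winding_number \<gamma> p * zorder g p)"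
  proof (rule Rouche_theorem[OF S(1,2), of g "\<lambda>y. h y - g y" \<gamma>, unfolded fg])
    show "finite {p \<in> S. g p = 0}" using g0 by simp
    show "g holomorphic_on S" "(\<lambda>y. h y - g y) holomorphic_on S"
      by (intro holomorphic_intros holomorphic_on_subset[OF gh S(3)] holomorphic_on_subset[OF h S(3)])+
    show "path_image \<gamma> \<subseteq> S" using \<gamma> \<rho> by (auto simp: S_def)
    show "\<forall>z\<in>path_image \<gamma>. norm (h z - g z) < norm (g z)" using \<gamma> less by simp
  qed (use finh \<gamma> homo in auto)
  also have "\<dots> = 3" using g0 w1[of 0] r \<open>zorder g 0 = 3\<close> by simp
  finally have sum3: "(\<Sum>p\<in>Z. complex_of_int (zorder h p)) = 3"
    using restrict by simp
  have pos: "zorder h p > 0" if "p \<in> Z" for p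
  proof -
    have "\<exists>w\<in>ball 0 R. h w \<noteq> 0" using hr[of "of_real r"] r by (intro bexI[of _ "of_real r"]) auto
    then show ?thesis
      using zorder_exist_zero[OF h, of p] that r by (auto simp: Z_def)
  qed
  define m where "m p = nat (zorder h p)" for p
  have m: "of_nat (m p) = complex_of_int (zorder h p)" "m p > 0" if "p \<in> Z" for p
    using pos[OF that] by (simp_all add: m_def)
  \<comment> \<open>Repeating each zero according to its order turns the count 3 into a list
    \<open>p\<close>, \<open>q\<close>, \<open>s\<close> of possibly equal roots.\<close>
  define M where "M = (\<Sum>p\<in>Z. replicate_mset (m p) p)"
  have setM: "set_mset M = Z" using m finZ by (auto simp: M_def set_mset_sum)
  have "of_nat (size M) = (\<Sum>p\<in>Z. of_nat (m p) :: complex)"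
    by (simp add: M_def size_multiset_sum)
  also have "\<dots> = 3" using sum3 m by simp
  finally have "of_nat (size M) = (of_nat 3 :: complex)" by simp
  then have "size M = 3" using of_nat_eq_iff by blast
  then obtain p M1 where M1: "M = add_mset p M1" "size M1 = 2"
    using size_eq_Suc_imp_eq_union[of M 2] by auto
  then obtain q M2 where M2: "M1 = add_mset q M2" "size M2 = 1"
    using size_eq_Suc_imp_eq_union[of M1 1] by auto
  then obtain s where s: "M2 = {#s#}" using size_1_singleton_mset by blast
  have Mpqs: "M = {#p, q, s#}" using M1 M2 s by simp
  have "{y. norm y < r \<and> h y = 0} = {p, q, s}"
    using setM Mpqs by (auto simp: Z_def)
  moreover have "contour_integral (circlepath 0 r) (\<lambda>y. deriv h y * y ^ k / h y) = 2 * pi * \<i> * (p ^ k + q ^ k + s ^ k)" for k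
  proof -
    have "contour_integral \<gamma> (\<lambda>y. deriv h y * y ^ k / h y) = 2 * pi * \<i> * (\<Sum>p\<in>{p\<in>S. h p = 0}. winding_number \<gamma> p * p ^ k * zorder h p)"
    proof (rule argument_principle[OF S(1,2), of h "{}" "\<lambda>y. y ^ k" \<gamma>, unfolded empty_iff simp_thms Diff_empty Int_empty_right])
      show "h holomorphic_on S" "(\<lambda>y. y ^ k) holomorphic_on S"
        by (intro holomorphic_intros holomorphic_on_subset[OF h S(3)])+
      show "path_image \<gamma> \<subseteq> S - {w \<in> S. h w = 0}" using \<gamma> \<rho> hr by (auto simp: S_def)
    qed (use finh \<gamma> homo in auto)
    also have "(\<Sum>p\<in>{p\<in>S. h p = 0}. winding_number \<gamma> p * p ^ k * zorder h p) = (\<Sum>p\<in>Z. of_nat (m p) * p ^ k)"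
      using restrict[of "\<lambda>p. p ^ k * zorder h p"] m by (simp add: mult_ac)
    also have "\<dots> = sum_mset (image_mset (\<lambda>p. p ^ k) M)"
      unfolding M_def by (rule sum_mset_replicate[OF finZ, symmetric])
    also have "\<dots> = p ^ k + q ^ k + s ^ k" using Mpqs by (simp add: add_ac)
    finally show ?thesis by (simp add: \<gamma>_def)
  qed
  ultimately show ?thesis using that by blast
qed

text \<open>Newton's identities: the three coefficients are, up to sign, the elementary symmetric
  functions of \<open>p\<close>, \<open>q\<close>, \<open>s\<close>, so the cubic is
  \<open>(y - p) (y - q) (y - s)\<close>.\<close>

lemma cubic_of_power_sums:
  fixes y p q s :: complex
  assumes "y \<in> {p, q, s}" and "s1 = p + q + s" "s2 = p\<^sup>2 + q\<^sup>2 + s\<^sup>2" "s3 = p ^ 3 + q ^ 3 + s ^ 3"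
  shows "y ^ 3 + (- s1) * y\<^sup>2 + ((s1\<^sup>2 - s2) / 2) * y + (3 * s1 * s2 - s1 ^ 3 - 2 * s3) / 6 = 0"
proof -
  have 1: "(s1\<^sup>2 - s2) / 2 = p * q + p * s + q * s"
    by (simp add: assms(2-) power2_eq_square algebra_simps)
  have "3 * s1 * s2 - s1 ^ 3 - 2 * s3 = 6 * (- (p * q * s))"
    by (simp add: assms(2-) power2_eq_square power3_eq_cube algebra_simps)
  then have 2: "(3 * s1 * s2 - s1 ^ 3 - 2 * s3) / 6 = - (p * q * s)" by simp
  have "(y - p) * (y - q) * (y - s) = 0" using assms(1) by auto
  then show ?thesis unfolding 1 2 unfolding assms(2) by (simp add: power2_eq_square power3_eq_cube algebra_simps)
qed

text \<open>The derivatives of \<open>G (0, -)\<close> at 0 vanish up to order two and not in order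
  three, so \<open>u\<close> is the unit left after taking out \<open>y^3\<close>.\<close>

lemma cubic_zero_factor:
  assumes G: "holo2_on N G" and N: "(0, 0) \<in> N" and G0: "G (0, 0) = 0" "pdy G (0, 0) = 0"
    "pdy (pdy G) (0, 0) = 0" and G3: "pdy (pdy (pdy G)) (0, 0) \<noteq> 0"
  obtains u r where "r > 0" "u holomorphic_on ball 0 r" "\<And>y. y \<in> ball 0 r \<Longrightarrow> G (0, y) = y ^ 3 * u y"
    "\<And>y. y \<in> ball 0 r \<Longrightarrow> u y \<noteq> 0"
proof -
  obtain R0 where R0: "R0 > 0" "cball 0 R0 \<times> cball 0 R0 \<subseteq> N"
    using open_contains_bicball[OF holo2_on_open[OF G] N] by blast
  define g where "g y = G (0, y)" for y
  have g_holo: "g holomorphic_on ball 0 R0"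
    unfolding g_def by (rule holo2_on_section2[OF G]) (use R0 in auto)
  have d1: "deriv g = (\<lambda>y. pdy G (0, y))" by (simp add: g_def[abs_def] pdy_def)
  have d2: "deriv (\<lambda>y. pdy G (0, y)) = (\<lambda>y. pdy (pdy G) (0, y))" by (simp add: pdy_def[of "pdy G"])
  have d3: "deriv (\<lambda>y. pdy (pdy G) (0, y)) = (\<lambda>y. pdy (pdy (pdy G)) (0, y))" by (simp add: pdy_def[of "pdy (pdy G)"])
  have nz3: "(deriv ^^ 3) g 0 \<noteq> 0" using G3 by (simp add: numeral_3_eq_3 d1 d2 d3)
  have z3: "(deriv ^^ i) g 0 = 0" if "0 < i" "i < 3" for i
  proof -
    have "i = 1 \<or> i = 2" using that by auto
    then show ?thesis using G0 by (auto simp: numeral_2_eq_2 d1 d2)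
  qed
  have c: "0 \<in> ball (0::complex) R0" "(0::nat) < 3" using R0 by auto
  obtain u r0 where u: "r0 > 0" "u holomorphic_on ball 0 r0"
    "\<And>y. y \<in> ball 0 r0 \<Longrightarrow> g y - g 0 = (y - 0) ^ 3 * u y" "\<And>y. y \<in> ball 0 r0 \<Longrightarrow> u y \<noteq> 0"
    by (rule holomorphic_factor_order_of_zero[OF g_holo open_ball c nz3 z3]) (assumption | rule that)+
  show ?thesis by (rule that[OF u(1,2) _ u(4)]) (use u(3) G0 in \<open>auto simp: g_def\<close>)
qed

text \<open>A Weierstrass polynomial of \<open>G(x, y) - Y\<close> in \<open>y\<close>: its coefficients are symmetric functions of the three
  roots \<open>y\<close> near \<open>0\<close>, hence polynomials in the power sums, which are contour integrals depending
  holomorphically on \<open>(x, Y)\<close>.\<close>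

lemma weierstrass_cubic:
  assumes G: "holo2_on N G" and N: "(0, 0) \<in> N" and G0: "G (0, 0) = 0" "pdy G (0, 0) = 0"
    "pdy (pdy G) (0, 0) = 0" and G3: "pdy (pdy (pdy G)) (0, 0) \<noteq> 0"
  obtains W M A B C where "holo2_on W A" "holo2_on W B" "holo2_on W C" "(0, 0) \<in> W"
    "A (0, 0) = 0" "B (0, 0) = 0" "C (0, 0) = 0" "open M" "(0, 0) \<in> M" "M \<subseteq> N"
    "\<And>x y. (x, y) \<in> M \<Longrightarrow> (x, G (x, y)) \<in> W \<and>
       y ^ 3 + C (x, G (x, y)) * y\<^sup>2 + B (x, G (x, y)) * y + A (x, G (x, y)) = 0"
proof -
  obtain R0 where R0: "R0 > 0" "cball 0 R0 \<times> cball 0 R0 \<subseteq> N"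
    using open_contains_bicball[OF holo2_on_open[OF G] N] by blast
  define g where "g y = G (0, y)" for y
  obtain u r0 where u: "r0 > 0" "u holomorphic_on ball 0 r0"
    "\<And>y. y \<in> ball 0 r0 \<Longrightarrow> G (0, y) = y ^ 3 * u y" "\<And>y. y \<in> ball 0 r0 \<Longrightarrow> u y \<noteq> 0"
    by (rule cubic_zero_factor[OF G N G0 G3]) (assumption | rule that)+
  define R where "R = min r0 R0"
  have R: "R > 0" "R \<le> r0" "R \<le> R0" using u R0 by (auto simp: R_def)
  have gu: "g y = y ^ 3 * u y" "u y \<noteq> 0" if "y \<in> ball 0 R" for y
    using u(3)[of y] u(4)[of y] that R by (auto simp: g_def)
  have u_holo: "u holomorphic_on ball 0 R" by (rule holomorphic_on_subset[OF u(2)]) (use R in auto)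
  define r where "r = R / 2"
  have r: "0 < r" "r < R" using R by (auto simp: r_def)
  define D :: "(c2 \<times> complex) set" where "D = (ball 0 R \<times> UNIV) \<times> ball 0 R"
  have D: "open D" by (simp add: D_def open_Times)
  have DN: "(fst (fst q), snd q) \<in> N" "(0, snd q) \<in> N" if "q \<in> D" for q
    using that R R0 by (auto simp: D_def intro!: subsetD[OF R0(2)])
  \<comment> \<open>\<open>E\<close> collects the parameters \<open>(x, Y)\<close> and points
    \<open>y\<close> at which the Rouche inequality between \<open>G (x, y) - Y\<close> and
    \<open>g y\<close> holds. It contains the circle over \<open>(0, 0)\<close>, where the
    difference is 0, and the tube lemma gives a neighbourhood \<open>W\<close> of
    parameters.\<close>
  define E where "E = D \<inter> (\<lambda>q. norm (g (snd q)) - norm (G (fst (fst q), snd q) - snd (fst q) - g (snd q))) -` {0<..}"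
  have "open E"
    unfolding E_def g_def
    by (intro continuous_open_preimage D continuous_intros continuous_on_compose2[OF holo2_on_continuous[OF G]])
       (use DN in auto)
  moreover have "{(0, 0)} \<times> sphere 0 r \<subseteq> E"
    using r gu by (auto simp: E_def D_def g_def)
  ultimately obtain W where W: "(0, 0) \<in> W" "open W" "W \<times> sphere 0 r \<subseteq> E"
    using Elementary_Topology.tube_lemma[OF compact_sphere, of E "(0, 0)" 0 r] by metis
  have WE: "((x, Y), y) \<in> E" if "(x, Y) \<in> W" "norm y = r" for x Y y
    using W(3) that by auto
  have Wx: "norm x < R" if "(x, Y) \<in> W" for x Y
    using WE[OF that, of "of_real r"] r by (auto simp: E_def D_def)
  have Wless: "norm (G (x, y) - Y - g y) < norm (g y)" if "(x, Y) \<in> W" "norm y = r" for x Y y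
    using WE[OF that] by (simp add: E_def)
  have circ: "norm (circlepath 0 r t) = r" for t using circlepath_dist[of r 0 t] r by simp
  have inN: "(x, y) \<in> N" if "norm x < R" "norm y < R" for x y
    by (rule subsetD[OF R0(2)]) (use that R in auto)
  \<comment> \<open>The contour integral of the argument principle divided by \<open>2 pi i\<close>.
    The velocity of the circle around 0 is \<open>2 pi i\<close> times the point itself, whence the
    last factor.\<close>
  define s where "s k z = integral {0..1} (\<lambda>t. pdy G (fst z, circlepath 0 r t) * circlepath 0 r t ^ k
      / (G (fst z, circlepath 0 r t) - snd z) * circlepath 0 r t)" for k z
  have s_holo: "holo2_on W (s k)" for k
    unfolding s_def
  proof (rule holo2_on_integral[OF W(2)])
    have nz: "G (fst z, circlepath 0 r t) - snd z \<noteq> 0" if "z \<in> W" for z t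
      using Wless[of "fst z" "snd z" "circlepath 0 r t"] that circ by auto
    have 1: "(fst z, circlepath 0 r t) \<in> N" if "z \<in> W" for z t
      using inN[of "fst z" "circlepath 0 r t"] Wx[of "fst z" "snd z"] circ r that by auto
    have 2: "continuous_on (W \<times> {0..1}) (\<lambda>q. k (fst (fst q), circlepath 0 r (snd q)))" if "holo2_on N k" for k
      by (rule continuous_on_compose2[OF holo2_on_continuous[OF that]])
         (use 1 in \<open>auto intro!: continuous_intros\<close>)
    show "continuous_on (W \<times> {0..1}) (\<lambda>(z, t). pdy G (fst z, circlepath 0 r t) * circlepath 0 r t ^ k
      / (G (fst z, circlepath 0 r t) - snd z) * circlepath 0 r t)"
      unfolding case_prod_unfold
      by (intro continuous_intros 2[OF G] 2[OF holo2_on_pdy[OF G]]) (use nz in auto)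
    have 3: "holo2_on W (\<lambda>z. k (fst z, circlepath 0 r t))" if "holo2_on N k" for k t
      by (intro holo2_on_compose2[OF that] holo2_intros W) (use 1 in auto)
    show "holo2_on W (\<lambda>z. pdy G (fst z, circlepath 0 r t) * circlepath 0 r t ^ k
      / (G (fst z, circlepath 0 r t) - snd z) * circlepath 0 r t)" for t
      by (intro holo2_intros 3[OF G] 3[OF holo2_on_pdy[OF G]] W) (use nz in auto)
  qed
  have roots: "\<exists>p q t. {y. norm y < r \<and> G (x, y) = Y} = {p, q, t} \<and> (\<forall>k. s k (x, Y) = p ^ k + q ^ k + t ^ k)"
    if xY: "(x, Y) \<in> W" for x Y
  proof -
    define h where "h y = G (x, y) - Y" for y
    have h: "h holomorphic_on ball 0 R" unfolding h_def
      by (intro holomorphic_intros holo2_on_section2[OF G]) (use inN Wx[OF xY] in auto)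
    have dh: "deriv h y = pdy G (x, y)" if "norm y < R" for y
    proof -
      have "((\<lambda>t. G (x, t)) has_field_derivative pdy G (x, y)) (at y)"
        using has_cderiv_section2[OF holo2_on_cderiv[OF G]] inN Wx[OF xY] that by blast
      then have "(h has_field_derivative pdy G (x, y)) (at y)"
        unfolding h_def by (auto intro!: derivative_eq_intros)
      then show ?thesis by (rule DERIV_imp_deriv)
    qed
    have less: "norm (h y - g y) < norm (g y)" if "norm y = r" for y
      using Wless[OF xY that] by (simp add: h_def)
    obtain p q t where pqt: "{y. norm y < r \<and> h y = 0} = {p, q, t}"
      "\<And>k. contour_integral (circlepath 0 r) (\<lambda>y. deriv h y * y ^ k / h y) = 2 * pi * \<i> * (p ^ k + q ^ k + t ^ k)"
      by (rule cubic_root_power_sums[OF h u_holo r gu less]) (assumption | rule that)+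
    have vd: "vector_derivative (circlepath 0 r) (at \<tau>) = 2 * pi * \<i> * circlepath 0 r \<tau>" for \<tau>
      unfolding vector_derivative_circlepath by (simp add: circlepath)
    have "s k (x, Y) = p ^ k + q ^ k + t ^ k" for k
    proof -
      have "2 * pi * \<i> * (p ^ k + q ^ k + t ^ k) = contour_integral (circlepath 0 r) (\<lambda>y. deriv h y * y ^ k / h y)"
        by (simp add: pqt)
      also have "\<dots> = integral {0..1} (\<lambda>\<tau>. (2 * pi * \<i>) * (pdy G (x, circlepath 0 r \<tau>) * circlepath 0 r \<tau> ^ k
          / (G (x, circlepath 0 r \<tau>) - Y) * circlepath 0 r \<tau>))"
        unfolding contour_integral_integral using circ r
        by (simp add: vd dh h_def mult_ac)
      also have "\<dots> = 2 * pi * \<i> * s k (x, Y)" unfolding s_def fst_conv snd_conv by (rule integral_mult_right)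
      finally show ?thesis by simp
    qed
    moreover have "{y. norm y < r \<and> G (x, y) = Y} = {p, q, t}" using pqt(1) by (simp add: h_def)
    ultimately show ?thesis by blast
  qed
  define C where "C z = - s 1 z" for z
  define B where "B z = ((s 1 z)\<^sup>2 - s 2 z) / 2" for z
  define A where "A z = (3 * s 1 z * s 2 z - s 1 z ^ 3 - 2 * s 3 z) / 6" for z
  have holo: "holo2_on W A" "holo2_on W B" "holo2_on W C"
  proof -
    show "holo2_on W A" "holo2_on W B" unfolding A_def B_def
      by (intro holo2_intros s_holo W; simp)+
    have "holo2_on W (\<lambda>z. 0 - s 1 z)" by (intro holo2_intros s_holo W)
    then show "holo2_on W C" unfolding C_def by simp
  qed
  \<comment> \<open>For the parameter \<open>(0, 0)\<close> the only root is 0, taken three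
    times.\<close>
  have s0: "s k (0, 0) = 0" if k: "k > 0" for k
  proof -
    obtain p q t where pqt: "{y. norm y < r \<and> G (0, y) = 0} = {p, q, t}" "s k (0, 0) = p ^ k + q ^ k + t ^ k"
      using roots[OF W(1)] by blast
    have "y = 0" if "norm y < r" "G (0, y) = 0" for y
      using gu[of y] that r by (auto simp: g_def)
    then have "p = 0" "q = 0" "t = 0" using pqt(1) by blast+
    then show ?thesis using pqt(2) k by simp
  qed
  \<comment> \<open>For \<open>(x, y)\<close> in \<open>M\<close> the number \<open>y\<close> is
    itself one of the three roots for the parameter \<open>(x, G (x, y))\<close>, so it satisfies
    the cubic.\<close>
  define M where "M = (N \<inter> (\<lambda>z. (fst z, G z)) -` W) \<inter> {z. norm (snd z) < r}"
  have "open M" unfolding M_def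
    by (intro open_Int continuous_open_preimage continuous_intros holo2_on_continuous[OF G] holo2_on_open[OF G] W
        open_Collect_less)
  moreover have "(0, 0) \<in> M" using N W r G0 by (simp add: M_def)
  moreover have "(x, G (x, y)) \<in> W \<and> y ^ 3 + C (x, G (x, y)) * y\<^sup>2 + B (x, G (x, y)) * y + A (x, G (x, y)) = 0"
    if xy: "(x, y) \<in> M" for x y
  proof -
    have w: "(x, G (x, y)) \<in> W" "norm y < r" using xy by (auto simp: M_def)
    obtain p q t where pqt: "{y'. norm y' < r \<and> G (x, y') = G (x, y)} = {p, q, t}"
      "\<forall>k. s k (x, G (x, y)) = p ^ k + q ^ k + t ^ k" using roots[OF w(1)] by blast
    have "y \<in> {p, q, t}" using pqt(1) w(2) by blast
    from cubic_of_power_sums[OF this, of "s 1 (x, G (x, y))" "s 2 (x, G (x, y))" "s 3 (x, G (x, y))"] pqt(2) w(1)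
    show ?thesis by (simp add: A_def B_def C_def)
  qed
  moreover have "A (0, 0) = 0" "B (0, 0) = 0" "C (0, 0) = 0"
    using s0 by (simp_all add: A_def B_def C_def)
  moreover have "M \<subseteq> N" by (auto simp: M_def)
  ultimately show ?thesis using that[OF holo W(1)] by blast
qed

section \<open>The normal form of a cusp\<close>

text \<open>With \<open>t = y + C / 3\<close> the cubic becomes \<open>t^3 + B' t = A'\<close>.
  Hence \<open>(B', A')\<close> serves as a chart in the target and \<open>(B', t)\<close>, pulled
  back along the graph map \<open>\<Gamma>\<close>, as a chart in the source. Both Jacobians reduce
  to the derivative of \<open>A\<close> in \<open>Y\<close> and the mixed derivative of
  \<open>G\<close>.\<close>

lemma cusp_normal_form:
  assumes G: "holo2_on N G" and N: "(0, 0) \<in> N" and G0: "G (0, 0) = 0" "pdy G (0, 0) = 0"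
    "pdy (pdy G) (0, 0) = 0" and G3: "pdy (pdy (pdy G)) (0, 0) \<noteq> 0" and Gxy: "pdx (pdy G) (0, 0) \<noteq> 0"
  obtains M W \<phi>\<^sub>1 \<phi>\<^sub>2 \<psi>\<^sub>1 \<psi>\<^sub>2 where "holo2_on M \<phi>\<^sub>1" "holo2_on M \<phi>\<^sub>2" "(0, 0) \<in> M" "M \<subseteq> N"
    "holo2_on W \<psi>\<^sub>1" "holo2_on W \<psi>\<^sub>2" "(0, 0) \<in> W"
    "\<phi>\<^sub>1 (0, 0) = 0" "\<phi>\<^sub>2 (0, 0) = 0" "jac (\<phi>\<^sub>1, \<phi>\<^sub>2) (0, 0) \<noteq> 0"
    "\<psi>\<^sub>1 (0, 0) = 0" "\<psi>\<^sub>2 (0, 0) = 0" "jac (\<psi>\<^sub>1, \<psi>\<^sub>2) (0, 0) \<noteq> 0"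
    "\<And>z. z \<in> M \<Longrightarrow> (fst z, G z) \<in> W \<and>
       (\<psi>\<^sub>1 (fst z, G z), \<psi>\<^sub>2 (fst z, G z)) = cusp_std (\<phi>\<^sub>1 z, \<phi>\<^sub>2 z)"
proof -
  obtain W M A B C where hA: "holo2_on W A" and hB: "holo2_on W B" and hC: "holo2_on W C" and W: "(0, 0) \<in> W"
    and 0: "A (0, 0) = 0" "B (0, 0) = 0" "C (0, 0) = 0" and M: "open M" "(0, 0) \<in> M" "M \<subseteq> N"
    and MW: "\<And>x y. (x, y) \<in> M \<Longrightarrow> (x, G (x, y)) \<in> W \<and>
       y ^ 3 + C (x, G (x, y)) * y\<^sup>2 + B (x, G (x, y)) * y + A (x, G (x, y)) = 0"
    by (rule weierstrass_cubic[OF G N G0 G3]) (assumption | rule that)+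
  define \<Gamma> where "\<Gamma> z = (fst z, G z)" for z
  have GM: "holo2_on M G" by (rule holo2_on_subset[OF G M(1,3)])
  have \<Gamma>W: "\<Gamma> z \<in> W" if "z \<in> M" for z using MW[of "fst z" "snd z"] that by (simp add: \<Gamma>_def)
  have comp: "holo2_on M (\<lambda>z. k (\<Gamma> z))" if "holo2_on W k" for k
    unfolding \<Gamma>_def by (rule holo2_on_compose2[OF that holo2_on_fst[OF M(1)] GM]) (use \<Gamma>W in \<open>auto simp: \<Gamma>_def\<close>)
  have dcomp: "has_cderiv (\<lambda>z. k (\<Gamma> z)) z (pdx k (\<Gamma> z) + pdy k (\<Gamma> z) * pdx G z) (pdy k (\<Gamma> z) * pdy G z)"
    if "holo2_on W k" "z \<in> M" for k z
    using has_cderiv_compose2[of k fst z G, OF holo2_on_cderiv[OF that(1)] has_cderiv_fst holo2_on_cderiv[OF GM that(2)]]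
      \<Gamma>W[OF that(2)] by (simp add: \<Gamma>_def)
  have \<Gamma>0: "\<Gamma> (0, 0) = (0, 0)" using G0 by (simp add: \<Gamma>_def)
  define P where "P z = snd z ^ 3 + C (\<Gamma> z) * (snd z)\<^sup>2 + B (\<Gamma> z) * snd z + A (\<Gamma> z)" for z
  have P0: "P z = 0" if "z \<in> M" for z using MW[of "fst z" "snd z"] that by (simp add: P_def \<Gamma>_def)
  have M0: "open {x. (x, 0) \<in> M}"
  proof -
    have "open ((\<lambda>x. (x, 0)) -` M)" using M(1) by (intro open_vimage continuous_intros)
    then show ?thesis by (simp add: vimage_def)
  qed
  \<comment> \<open>The tool for differentiating, in \<open>x\<close>, identities that hold on the
    line \<open>y = 0\<close>.\<close>
  have pdx0: "\<alpha> = 0" if k: "has_cderiv k (0, 0) \<alpha> \<beta>" "\<And>x. (x, 0) \<in> M \<Longrightarrow> k (x, 0) = 0" for k \<alpha> \<beta>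
  proof -
    have "((\<lambda>x. 0) has_field_derivative \<alpha>) (at 0)"
      by (rule has_field_derivative_transform_within_open[OF has_cderiv_section1[OF k(1)] M0])
         (use k(2) M(2) in auto)
    then show ?thesis using DERIV_unique DERIV_const by blast
  qed
  have AX: "pdx A (0, 0) + pdy A (0, 0) * pdx G (0, 0) = 0"
  proof (rule pdx0)
    show "has_cderiv (\<lambda>z. A (\<Gamma> z)) (0, 0) (pdx A (0, 0) + pdy A (0, 0) * pdx G (0, 0)) (pdy A (0, 0) * pdy G (0, 0))"
      using dcomp[OF hA M(2)] by (simp add: \<Gamma>0)
    show "A (\<Gamma> (x, 0)) = 0" if "(x, 0) \<in> M" for x using P0[OF that] by (simp add: P_def)
  qed
  \<comment> \<open>The \<open>y\<close>-derivative of \<open>P\<close> on \<open>y = 0\<close> is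
    \<open>B + A_Y G_y\<close>, evaluated along \<open>\<Gamma>\<close>. It vanishes identically
    there; its \<open>x\<close>-derivative at the origin gives the relation, because
    \<open>G_y\<close> is 0 there.\<close>
  have BX: "pdx B (0, 0) + pdy B (0, 0) * pdx G (0, 0) = - (pdy A (0, 0) * pdx (pdy G) (0, 0))"
  proof -
    have 1: "B (\<Gamma> (x, 0)) + pdy A (\<Gamma> (x, 0)) * pdy G (x, 0) = 0" if x: "(x, 0) \<in> M" for x
    proof -
      have s: "((\<lambda>y. k (\<Gamma> (x, y))) has_field_derivative pdy k (\<Gamma> (x, 0)) * pdy G (x, 0)) (at 0)"
        if "holo2_on W k" for k
        using has_cderiv_section2[OF dcomp[OF that x]] .
      have "((\<lambda>y. P (x, y)) has_field_derivative B (\<Gamma> (x, 0)) + pdy A (\<Gamma> (x, 0)) * pdy G (x, 0)) (at 0)"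
        unfolding P_def snd_conv by (rule derivative_eq_intros s[OF hA] s[OF hB] s[OF hC] | simp)+
      moreover have "((\<lambda>y. P (x, y)) has_field_derivative 0) (at 0)"
      proof (rule has_field_derivative_transform_within_open[OF DERIV_const])
        show "open ((\<lambda>y. (x, y)) -` M)" using M(1) by (intro open_vimage continuous_intros)
      qed (use x P0 in auto)
      ultimately show ?thesis by (rule DERIV_unique)
    qed
    have "(pdx B (0, 0) + pdy B (0, 0) * pdx G (0, 0)) +
       ((pdx (pdy A) (0, 0) + pdy (pdy A) (0, 0) * pdx G (0, 0)) * pdy G (0, 0) + pdy A (0, 0) * pdx (pdy G) (0, 0)) = 0"
    proof (rule pdx0)
      show "has_cderiv (\<lambda>z. B (\<Gamma> z) + pdy A (\<Gamma> z) * pdy G z) (0, 0)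
        ((pdx B (0, 0) + pdy B (0, 0) * pdx G (0, 0)) +
       ((pdx (pdy A) (0, 0) + pdy (pdy A) (0, 0) * pdx G (0, 0)) * pdy G (0, 0) + pdy A (0, 0) * pdx (pdy G) (0, 0)))
        (pdy B (0, 0) * pdy G (0, 0) + (pdy (pdy A) (0, 0) * pdy G (0, 0) * pdy G (0, 0) + pdy A (0, 0) * pdy (pdy G) (0, 0)))"
        using has_cderiv_add[OF dcomp[OF hB M(2)] has_cderiv_mult[OF dcomp[OF holo2_on_pdy[OF hA] M(2)]
          holo2_on_cderiv[OF holo2_on_pdy[OF GM] M(2)]]] by (simp add: \<Gamma>0)
    qed (use 1 in auto)
    then show ?thesis using G0 by (simp add: eq_neg_iff_add_eq_0)
  qed
  \<comment> \<open>On \<open>x = 0\<close> each of \<open>A\<close>, \<open>B\<close>,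
    \<open>C\<close> is a multiple of \<open>Y = y^3 u\<close>. If the factor of \<open>A\<close>
    vanished at the origin, dividing the cubic by \<open>y^3\<close> would leave
    \<open>\<Theta>\<close>, which is 0 for small nonzero \<open>y\<close> and yet tends to
    1.\<close>
  have AY: "pdy A (0, 0) \<noteq> 0"
  proof
    assume A0: "pdy A (0, 0) = 0"
    obtain \<rho> where \<rho>: "\<rho> > 0" "ball (0, 0) \<rho> \<subseteq> W"
      using holo2_on_open[OF hA] W open_contains_ball by blast
    have factor: "\<exists>v. holo2_on (ball (0, 0) \<rho>) v \<and> v (0, 0) = pdy k (0, 0) \<and> (\<forall>Y. ((0, Y) :: c2) \<in> ball (0, 0) \<rho> \<longrightarrow> k (0, Y) = v (0, Y) * Y)"
      if k: "holo2_on W k" "k (0, 0) = 0" for k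
    proof -
      obtain u v where uv: "holo2_on (ball (0, 0) \<rho>) u" "holo2_on (ball (0, 0) \<rho>) v"
        "\<And>z. z \<in> ball (0, 0) \<rho> \<Longrightarrow> k z = u z * fst z + v z * snd z"
        by (rule hadamard_lemma[OF k(1) \<rho>(2,1) k(2)]) (assumption | rule that)+
      have o: "(0, 0) \<in> ball ((0, 0) :: c2) \<rho>" using \<rho> by simp
      have "has_cderiv k (0, 0) (u (0, 0)) (v (0, 0))"
        by (rule has_cderiv_transform[OF _ open_ball o uv(3)[symmetric]])
           (use has_cderiv_add[OF has_cderiv_mult[OF holo2_on_cderiv[OF uv(1) o] has_cderiv_fst]
              has_cderiv_mult[OF holo2_on_cderiv[OF uv(2) o] has_cderiv_snd]] in auto)
      then have "v (0, 0) = pdy k (0, 0)" by (simp add: has_cderiv_pdy)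
      moreover have "\<forall>Y. ((0, Y) :: c2) \<in> ball (0, 0) \<rho> \<longrightarrow> k (0, Y) = v (0, Y) * Y"
        using uv(3)[of "(0, Y)" for Y] by simp
      ultimately show ?thesis using uv(2) by blast
    qed
    obtain vA where vA: "holo2_on (ball (0, 0) \<rho>) vA" "vA (0, 0) = 0" "\<And>Y. ((0, Y) :: c2) \<in> ball (0, 0) \<rho> \<Longrightarrow> A (0, Y) = vA (0, Y) * Y"
      using factor[OF hA 0(1)] A0 by metis
    obtain vB where vB: "holo2_on (ball (0, 0) \<rho>) vB" "\<And>Y. ((0, Y) :: c2) \<in> ball (0, 0) \<rho> \<Longrightarrow> B (0, Y) = vB (0, Y) * Y"
      using factor[OF hB 0(2)] by metis
    obtain vC where vC: "holo2_on (ball (0, 0) \<rho>) vC" "\<And>Y. ((0, Y) :: c2) \<in> ball (0, 0) \<rho> \<Longrightarrow> C (0, Y) = vC (0, Y) * Y"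
      using factor[OF hC 0(3)] by metis
    define g where "g y = G (0, y)" for y
    obtain R0 where R0: "R0 > 0" "cball 0 R0 \<times> cball 0 R0 \<subseteq> M"
      using open_contains_bicball[OF M(1,2)] by blast
    have g_holo: "g holomorphic_on ball 0 R0"
      unfolding g_def by (rule holo2_on_section2[OF GM]) (use R0 in auto)
    obtain u r0 where u: "r0 > 0" "u holomorphic_on ball 0 r0" "\<And>y. y \<in> ball 0 r0 \<Longrightarrow> G (0, y) = y ^ 3 * u y"
      by (rule cubic_zero_factor[OF GM M(2) G0 G3]) (assumption | rule that)+
    have gc: "isCont g 0" 
      using holomorphic_on_imp_continuous_on[OF g_holo] R0 by (simp add: continuous_on_eq_continuous_at)
    have uc: "isCont u 0"
      using holomorphic_on_imp_continuous_on[OF u(2)] u(1) by (simp add: continuous_on_eq_continuous_at)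
    have g0: "g 0 = 0" using G0 by (simp add: g_def)
    have vc: "isCont (\<lambda>y. v (0, g y)) 0" if "holo2_on (ball (0, 0) \<rho>) v" for v
    proof -
      have "isCont v (0, g 0)"
        using holo2_on_continuous[OF that] \<rho>(1) g0 by (simp add: continuous_on_eq_continuous_at)
      moreover have "isCont (\<lambda>y. (0, g y)) 0" using gc by (intro continuous_intros)
      ultimately show ?thesis by (rule isCont_o2[rotated])
    qed
    define \<Theta> where "\<Theta> y = 1 + vC (0, g y) * u y * y\<^sup>2 + vB (0, g y) * u y * y + vA (0, g y) * u y" for y
    have "isCont \<Theta> 0" unfolding \<Theta>_def by (intro continuous_intros vc vA vB vC uc)
    then have "(\<Theta> \<longlongrightarrow> 1) (at 0)" by (simp add: isCont_def \<Theta>_def g0 vA(2))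
    moreover have "eventually (\<lambda>y. \<Theta> y = 0) (at 0)"
    proof -
      have "eventually (\<lambda>y. y \<in> ball 0 (min R0 r0)) (at 0)"
        by (rule eventually_at_in_open') (use R0 u in auto)
      moreover have "eventually (\<lambda>y. (0, g y) \<in> ball ((0, 0) :: c2) \<rho>) (at 0)"
      proof -
        have "((\<lambda>y. (0, g y)) \<longlongrightarrow> (0, 0)) (at (0::complex))"
          using gc g0 by (auto simp: isCont_def intro!: tendsto_intros)
        then show ?thesis using \<rho>(1) by (auto dest!: topological_tendstoD[where S="ball (0, 0) \<rho>"])
      qed
      moreover have "eventually (\<lambda>y. y \<noteq> 0) (at (0::complex))" by (simp add: eventually_at_filter)
      ultimately show ?thesis
      proof eventually_elim
        fix y :: complex assume y: "y \<in> ball 0 (min R0 r0)" "(0, g y) \<in> ball ((0, 0) :: c2) \<rho>" "y \<noteq> 0"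
        have "(0, y) \<in> M" using R0 y(1) by (intro subsetD[OF R0(2)]) auto
        then have "y ^ 3 + C (0, g y) * y\<^sup>2 + B (0, g y) * y + A (0, g y) = 0"
          using P0[of "(0, y)"] by (simp add: P_def \<Gamma>_def g_def)
        then have "y ^ 3 + vC (0, g y) * g y * y\<^sup>2 + vB (0, g y) * g y * y + vA (0, g y) * g y = 0"
          using vA(3) vB(2) vC(2) y(2) by simp
        moreover have "g y = y ^ 3 * u y" using u(3) y(1) by (simp add: g_def)
        ultimately have "y ^ 3 + vC (0, g y) * (y ^ 3 * u y) * y\<^sup>2 + vB (0, g y) * (y ^ 3 * u y) * y + vA (0, g y) * (y ^ 3 * u y) = 0"
          by simp
        moreover have "y ^ 3 + vC (0, g y) * (y ^ 3 * u y) * y\<^sup>2 + vB (0, g y) * (y ^ 3 * u y) * y + vA (0, g y) * (y ^ 3 * u y) = y ^ 3 * \<Theta> y"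
          by (simp add: \<Theta>_def algebra_simps)
        ultimately show "\<Theta> y = 0" using y(3) by simp
      qed
    qed
    then have "(\<Theta> \<longlongrightarrow> 0) (at 0)" by (rule tendsto_eventually)
    ultimately show False using tendsto_unique[OF at_neq_bot] by fastforce
  qed
  \<comment> \<open>The coefficients of the depressed cubic. Since \<open>B\<close> and
    \<open>C\<close> vanish at the origin, their products do not affect the differentials of
    \<open>B'\<close> and \<open>A'\<close> there.\<close>
  define B' where "B' w = B w - C w ^ 2 / 3" for w
  define A' where "A' w = B w * C w / 3 - A w - 2 * C w ^ 3 / 27" for w
  have hB': "holo2_on W B'" and hA': "holo2_on W A'"
    unfolding A'_def B'_def power2_eq_square by (intro holo2_intros hA hB hC holo2_on_open[OF hA]; simp)+
  have dB': "has_cderiv B' (0, 0) (pdx B (0, 0)) (pdy B (0, 0))"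
    using has_cderiv_diff[OF holo2_on_cderiv[OF hB W]
        has_cderiv_mult[OF has_cderiv_mult[OF holo2_on_cderiv[OF hC W] holo2_on_cderiv[OF hC W]] has_cderiv_const[of "1/3"]]]
    by (simp add: 0 B'_def[abs_def] power2_eq_square)
  have dA': "has_cderiv A' (0, 0) (- pdx A (0, 0)) (- pdy A (0, 0))"
    using has_cderiv_diff[OF has_cderiv_diff[OF
          has_cderiv_mult[OF has_cderiv_mult[OF holo2_on_cderiv[OF hB W] holo2_on_cderiv[OF hC W]] has_cderiv_const[of "1/3"]]
          holo2_on_cderiv[OF hA W]]
        has_cderiv_mult[OF has_cderiv_mult[OF has_cderiv_mult[OF holo2_on_cderiv[OF hC W] holo2_on_cderiv[OF hC W]]
            holo2_on_cderiv[OF hC W]] has_cderiv_const[of "2/27"]]]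
    by (simp add: 0 A'_def[abs_def] power3_eq_cube mult_ac)
  \<comment> \<open>By \<open>AX\<close> and \<open>BX\<close> this Jacobian equals
    \<open>A_Y^2 G_xy\<close> at the origin.\<close>
  have "jac (B', A') (0, 0) = - (pdx B (0, 0) * pdy A (0, 0) - pdy B (0, 0) * pdx A (0, 0))"
    by (simp add: jac_eqI[OF dB' dA'])
  also have "pdx A (0, 0) = - (pdy A (0, 0) * pdx G (0, 0))" using AX by (simp add: eq_neg_iff_add_eq_0)
  also have "- (pdx B (0, 0) * pdy A (0, 0) - pdy B (0, 0) * - (pdy A (0, 0) * pdx G (0, 0)))
     = - (pdy A (0, 0) * (pdx B (0, 0) + pdy B (0, 0) * pdx G (0, 0)))" by (simp add: algebra_simps)
  finally have jac\<psi>: "jac (B', A') (0, 0) \<noteq> 0" using BX AY Gxy by simp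
  define \<phi>\<^sub>2 where "\<phi>\<^sub>2 z = snd z + C (\<Gamma> z) / 3" for z
  have h\<phi>\<^sub>2: "holo2_on M \<phi>\<^sub>2" unfolding \<phi>\<^sub>2_def by (intro holo2_intros comp hC M; simp)
  \<comment> \<open>The \<open>y\<close>-derivative is 0 because \<open>G_y\<close> vanishes at the
    origin, so the source Jacobian is just the \<open>x\<close>-derivative given here.\<close>
  have d1: "has_cderiv (\<lambda>z. B' (\<Gamma> z)) (0, 0) (pdx B (0, 0) + pdy B (0, 0) * pdx G (0, 0)) 0"
    using dcomp[OF hB' M(2)] dB' G0 by (simp add: \<Gamma>0 has_cderiv_pdx has_cderiv_pdy)
  have d2: "\<exists>c. has_cderiv \<phi>\<^sub>2 (0, 0) c 1"
    using has_cderiv_add[OF has_cderiv_snd has_cderiv_mult[OF dcomp[OF hC M(2)] has_cderiv_const[of "1/3"]]] G0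
    by (auto simp: \<phi>\<^sub>2_def[abs_def])
  have jac\<phi>: "jac (\<lambda>z. B' (\<Gamma> z), \<phi>\<^sub>2) (0, 0) \<noteq> 0"
    using d2 jac_eqI[OF d1] BX AY Gxy by auto
  have eq: "(B' (\<Gamma> z), A' (\<Gamma> z)) = cusp_std (B' (\<Gamma> z), \<phi>\<^sub>2 z)" if "z \<in> M" for z
  proof -
    have A: "A (\<Gamma> z) = - (snd z ^ 3 + C (\<Gamma> z) * (snd z)\<^sup>2 + B (\<Gamma> z) * snd z)"
      using P0[OF that] unfolding P_def by algebra
    have "A' (\<Gamma> z) = \<phi>\<^sub>2 z ^ 3 + B' (\<Gamma> z) * \<phi>\<^sub>2 z"
      unfolding A'_def B'_def \<phi>\<^sub>2_def A by (simp add: power2_eq_square power3_eq_cube field_simps)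
    then show ?thesis by (simp add: cusp_std_def)
  qed
  show ?thesis
  proof (rule that[OF comp[OF hB'] h\<phi>\<^sub>2 M(2,3) hB' hA' W _ _ jac\<phi> _ _ jac\<psi>])
    show "(fst z, G z) \<in> W \<and> (B' (fst z, G z), A' (fst z, G z)) = cusp_std (B' (\<Gamma> z), \<phi>\<^sub>2 z)" if "z \<in> M" for z
      using eq[OF that] \<Gamma>W[OF that] by (simp add: \<Gamma>_def)
  qed (use 0 in \<open>auto simp: A'_def B'_def \<phi>\<^sub>2_def \<Gamma>0\<close>)
qed

section \<open>Recognizing a cusp from \<open>J\<close> and \<open>J11\<close>\<close>

lemma jac_mult_left:
  assumes "holo2_on U p" "holo2_on U q" "holo2_on U r" "z \<in> U"
  shows "jac (\<lambda>z. p z * q z, r) z = q z * jac (p, r) z + p z * jac (q, r) z"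
  unfolding jac_eqI[OF has_cderiv_mult[OF holo2_on_cderiv[OF assms(1,4)] holo2_on_cderiv[OF assms(2,4)]]
      holo2_on_cderiv[OF assms(3,4)]]
  by (simp add: jac_def algebra_simps)

text \<open>At a common zero of \<open>p\<close> and \<open>q\<close> the gradients of the new pair
  arise from those of \<open>p\<close> and \<open>q\<close> by a triangular matrix with diagonal
  \<open>u a\<close>, \<open>v a\<close>.\<close>

lemma jac_combination:
  assumes "holo2_on U p" "holo2_on U q" "holo2_on U u" "holo2_on U v" "holo2_on U e" "a \<in> U" "p a = 0" "q a = 0"
  shows "jac (\<lambda>z. p z * u z, \<lambda>z. q z * v z + p z * e z) a = u a * v a * jac (p, q) a"
proof -
  note d = holo2_on_cderiv[OF assms(1,6)] holo2_on_cderiv[OF assms(2,6)] holo2_on_cderiv[OF assms(3,6)]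
    holo2_on_cderiv[OF assms(4,6)] holo2_on_cderiv[OF assms(5,6)]
  show ?thesis
    unfolding jac_eqI[OF has_cderiv_mult[OF d(1,3)] has_cderiv_add[OF has_cderiv_mult[OF d(2,4)] has_cderiv_mult[OF d(1,5)]]]
    using assms(7,8) by (simp add: jac_def algebra_simps)
qed

text \<open>Pairs with nonzero Jacobian are local charts, so their inverses need not be supplied;
  the source chart is shrunk until \<open>G\<close> maps it into the target chart.\<close>

lemma has_cuspI:
  assumes \<phi>: "holo2_on U \<phi>\<^sub>1" "holo2_on U \<phi>\<^sub>2" "a \<in> U" "\<phi>\<^sub>1 a = 0" "\<phi>\<^sub>2 a = 0" "jac (\<phi>\<^sub>1, \<phi>\<^sub>2) a \<noteq> 0"
    and \<psi>: "holo2_on W \<psi>\<^sub>1" "holo2_on W \<psi>\<^sub>2" "\<psi>\<^sub>1 (G a) = 0" "\<psi>\<^sub>2 (G a) = 0" "jac (\<psi>\<^sub>1, \<psi>\<^sub>2) (G a) \<noteq> 0"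
    and G: "continuous_on UNIV G"
    and eq: "\<And>z. z \<in> U \<Longrightarrow> G z \<in> W \<and> (\<psi>\<^sub>1 (G z), \<psi>\<^sub>2 (G z)) = cusp_std (\<phi>\<^sub>1 z, \<phi>\<^sub>2 z)"
  shows "has_cusp G a"
proof -
  obtain U1 V1 where U1: "a \<in> U1" "open U1" "U1 \<subseteq> U" "biholo U1 V1 (\<lambda>z. (\<phi>\<^sub>1 z, \<phi>\<^sub>2 z))"
    by (rule holo_inverse_function[OF \<phi>(1,2,3,6)]) (assumption | rule that)+
  have "G a \<in> W" using eq \<phi>(3) by blast
  obtain W1 V2 where W1: "G a \<in> W1" "open W1" "W1 \<subseteq> W" "biholo W1 V2 (\<lambda>z. (\<psi>\<^sub>1 z, \<psi>\<^sub>2 z))"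
    by (rule holo_inverse_function[OF \<psi>(1,2) \<open>G a \<in> W\<close> \<psi>(5)]) (assumption | rule that)+
  define U2 where "U2 = U1 \<inter> G -` W1"
  have U2: "a \<in> U2" "open U2" "U2 \<subseteq> U1"
    using U1 W1 G open_vimage[of W1 G] by (auto simp: U2_def)
  have b: "biholo U2 ((\<lambda>z. (\<phi>\<^sub>1 z, \<phi>\<^sub>2 z)) ` U2) (\<lambda>z. (\<phi>\<^sub>1 z, \<phi>\<^sub>2 z))"
    by (rule biholo_restrict[OF U1(4) U2(2,3)])
  show ?thesis
    unfolding has_cusp_def
    by (rule exI[of _ U2], rule exI, rule exI[of _ W1], rule exI[of _ V2], rule exI,
        rule exI[of _ "\<lambda>z. (\<psi>\<^sub>1 z, \<psi>\<^sub>2 z)"], intro conjI, rule U2, rule b)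
       (use U1 U2 W1 eq \<phi> \<psi> in \<open>auto simp: U2_def\<close>)
qed

lemma mult_cnj_add_neq_0:
  assumes "\<alpha> \<noteq> 0 \<or> \<beta> \<noteq> 0"
  shows "\<alpha> * cnj \<alpha> + \<beta> * cnj \<beta> \<noteq> 0"
proof -
  have "\<alpha> * cnj \<alpha> + \<beta> * cnj \<beta> = of_real ((norm \<alpha>)\<^sup>2 + (norm \<beta>)\<^sup>2)"
    by (simp only: of_real_add complex_norm_square)
  moreover have "(norm \<alpha>)\<^sup>2 + (norm \<beta>)\<^sup>2 \<noteq> 0" using assms by (auto simp: sum_power2_eq_zero_iff)
  ultimately show ?thesis by (simp only: of_real_eq_0_iff) simp
qed

text \<open>In the coordinates \<open>(f0, l)\<close> the second component becomes \<open>G\<close>,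
  and \<open>J = \<Delta> G_y\<close>, \<open>J11 = - \<Delta>^2 G_yy + e G_y\<close>. The
  hypotheses on \<open>J\<close> and \<open>J11\<close> thus become those of the normal form of a
  cusp.\<close>

lemma whitney_cusp:
  assumes f: "holo2_on UNIV f" and g: "holo2_on UNIV g" and df: "pdx f a \<noteq> 0 \<or> pdy f a \<noteq> 0"
    and J0: "jac (f, g) a = 0" "jac11 (f, g) a = 0" and J: "jac (jac (f, g), jac11 (f, g)) a \<noteq> 0"
  shows "has_cusp (\<lambda>z. (f z, g z)) a"
proof -
  \<comment> \<open>The linear form \<open>l\<close> completes \<open>f0\<close> to a chart: these
    conjugates make the Jacobian at \<open>a\<close> equal to
    \<open>|f_x|^2 + |f_y|^2\<close>.\<close>
  define c\<^sub>1 where "c\<^sub>1 = - cnj (pdy f a)"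
  define c\<^sub>2 where "c\<^sub>2 = cnj (pdx f a)"
  define l where "l z = c\<^sub>1 * (fst z - fst a) + c\<^sub>2 * (snd z - snd a)" for z
  define f0 where "f0 z = f z - f a" for z
  have l: "holo2_on UNIV l" unfolding l_def by (intro holo2_intros; simp)
  have f0: "holo2_on UNIV f0" unfolding f0_def by (intro holo2_intros f; simp)
  have df0: "has_cderiv f0 z (pdx f z) (pdy f z)" for z
    using has_cderiv_diff[OF holo2_on_cderiv[OF f] has_cderiv_const[of "f a"], of z] by (simp add: f0_def[abs_def])
  have dl: "has_cderiv l z c\<^sub>1 c\<^sub>2" for z
    using has_cderiv_add[OF has_cderiv_mult[OF has_cderiv_const[of c\<^sub>1] has_cderiv_diff[OF has_cderiv_fst has_cderiv_const[of "fst a"]]]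
        has_cderiv_mult[OF has_cderiv_const[of c\<^sub>2] has_cderiv_diff[OF has_cderiv_snd has_cderiv_const[of "snd a"]]], of z]
    by (simp add: l_def[abs_def])
  define \<Delta> where "\<Delta> = jac (f0, l)"
  have "\<Delta> a = pdx f a * cnj (pdx f a) + pdy f a * cnj (pdy f a)"
    unfolding \<Delta>_def jac_eqI[OF df0 dl] by (simp add: c\<^sub>1_def c\<^sub>2_def)
  also have "\<dots> \<noteq> 0" by (rule mult_cnj_add_neq_0[OF df])
  finally have \<Delta>a: "\<Delta> a \<noteq> 0" .
  obtain U V where U: "a \<in> U" "open U" "biholo U V (\<lambda>z. (f0 z, l z))"
    by (rule holo_inverse_function[OF f0 l UNIV_I \<Delta>a[unfolded \<Delta>_def]]) (assumption | rule that)+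
  define \<Phi> where "\<Phi> z = (f0 z, l z)" for z
  obtain \<Psi> where \<Psi>: "holo_map_on V \<Psi>" "\<forall>z\<in>U. \<Psi> (\<Phi> z) = z" and V: "open V" "\<Phi> ` U = V"
    using U(3) unfolding biholo_def \<Phi>_def[symmetric] by blast
  have f0U: "holo2_on U f0" and lU: "holo2_on U l" and fU: "holo2_on U f" and gU: "holo2_on U g" and \<Delta>U: "holo2_on U \<Delta>"
    using holo2_on_subset[OF _ U(2)] f0 l f g holo2_on_jac[OF f0 l] by (auto simp: \<Delta>_def)
  define G where "G w = g (\<Psi> w) - g a" for w
  have G: "holo2_on V G"
  proof -
    have "holo2_on V (\<lambda>w. g (fst (\<Psi> w), snd (\<Psi> w)))"
      by (rule holo2_on_compose2[OF g]) (use \<Psi>(1) in \<open>auto simp: holo_map_on_def\<close>)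
    then have "holo2_on V (\<lambda>w. g (\<Psi> w))" by simp
    then show ?thesis unfolding G_def by (intro holo2_intros V)
  qed
  have \<Phi>V: "(f0 z, l z) \<in> V" if "z \<in> U" for z using V(2) that by (auto simp: \<Phi>_def)
  have gG: "g z - g a = G (f0 z, l z)" if "z \<in> U" for z
    using \<Psi>(2) that by (simp add: G_def \<Phi>_def)
  have \<Phi>a: "\<Phi> a = (0, 0)" by (simp add: \<Phi>_def f0_def l_def)
  note Gy = holo2_on_pdy[OF G] and Gyy = holo2_on_pdy[OF holo2_on_pdy[OF G]]
  define p where "p z = pdy G (f0 z, l z)" for z
  define q where "q z = pdy (pdy G) (f0 z, l z)" for z
  have pU: "holo2_on U p" unfolding p_def by (rule holo2_on_compose2[OF Gy f0U lU \<Phi>V])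
  have qU: "holo2_on U q" unfolding q_def by (rule holo2_on_compose2[OF Gyy f0U lU \<Phi>V])
  have fstV: "holo2_on V fst" by (rule holo2_on_fst[OF V(1)])
  have jf: "jac (fst, k) w = pdy k w" "jac (k, fst) w = - pdy k w" if "holo2_on V k" "w \<in> V" for k w
    using jac_eqI[OF has_cderiv_fst holo2_on_cderiv[OF that]] jac_eqI[OF holo2_on_cderiv[OF that] has_cderiv_fst]
    by simp_all
  have J_eq: "jac (f, g) z = p z * \<Delta> z" if z: "z \<in> U" for z
  proof -
    have dg: "has_cderiv (\<lambda>z. g z - g a) z (pdx g z) (pdy g z)"
      using has_cderiv_diff[OF holo2_on_cderiv[OF gU z] has_cderiv_const[of "g a"]] by simp
    have "jac (f, g) z = jac (f0, \<lambda>z. g z - g a) z"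
      unfolding jac_eqI[OF df0 dg] by (simp add: jac_def)
    also have "\<dots> = jac (\<lambda>z. fst (f0 z, l z), \<lambda>z. G (f0 z, l z)) z"
      by (rule jac_cong[OF z f0U]) (use gG gU U(2) in \<open>auto intro!: holo2_intros\<close>)
    also have "\<dots> = jac (fst, G) (f0 z, l z) * jac (f0, l) z"
      by (rule jac_compose[OF fstV G f0U lU z \<Phi>V[OF z]])
    finally show ?thesis using jf(1)[OF G \<Phi>V[OF z]] by (simp add: p_def \<Delta>_def)
  qed
  define e where "e = jac (\<Delta>, f0)"
  have eU: "holo2_on U e" unfolding e_def by (rule holo2_on_jac[OF \<Delta>U f0U])
  define v where "v z = - (\<Delta> z * \<Delta> z)" for z
  have vU: "holo2_on U v"
  proof -
    have "holo2_on U (\<lambda>z. 0 - \<Delta> z * \<Delta> z)" by (intro holo2_intros \<Delta>U U)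
    then show ?thesis by (simp add: v_def[abs_def])
  qed
  have p\<Delta>U: "holo2_on U (\<lambda>z. p z * \<Delta> z)" by (intro holo2_intros pU \<Delta>U)
  have J11_eq: "jac11 (f, g) z = q z * v z + p z * e z" if z: "z \<in> U" for z
  proof -
    have "jac11 (f, g) z = jac (jac (f, g), f) z" by (simp add: jac11_eq_jac)
    also have "\<dots> = jac (\<lambda>z. p z * \<Delta> z, f) z"
      by (rule jac_cong[symmetric, OF z p\<Delta>U fU]) (use J_eq in auto)
    also have "\<dots> = jac (\<lambda>z. p z * \<Delta> z, f0) z"
      unfolding jac_eqI[OF holo2_on_cderiv[OF p\<Delta>U z] df0] by (simp add: jac_def)
    also have "\<dots> = \<Delta> z * jac (p, f0) z + p z * jac (\<Delta>, f0) z"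
      by (rule jac_mult_left[OF pU \<Delta>U f0U z])
    also have "jac (p, f0) z = jac (pdy G, fst) (f0 z, l z) * jac (f0, l) z"
      unfolding p_def using jac_compose[OF Gy fstV f0U lU z \<Phi>V[OF z]] by simp
    also have "\<dots> = - (q z * \<Delta> z)"
      using jf(2)[OF Gy \<Phi>V[OF z]] by (simp add: q_def \<Delta>_def)
    finally show ?thesis by (simp add: v_def e_def algebra_simps)
  qed
  have "p a = 0" using J_eq[OF U(1)] J0 \<Delta>a by simp
  then have "q a = 0" using J11_eq[OF U(1)] J0 \<Delta>a by (simp add: v_def)
  have G1: "pdy G (0, 0) = 0" and G2: "pdy (pdy G) (0, 0) = 0"
    using \<open>p a = 0\<close> \<open>q a = 0\<close> \<Phi>a by (simp_all add: p_def q_def \<Phi>_def)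
  have "jac (jac (f, g), jac11 (f, g)) a = jac (\<lambda>z. p z * \<Delta> z, \<lambda>z. q z * v z + p z * e z) a"
    by (rule jac_cong[symmetric, OF U(1) p\<Delta>U])
       (use J_eq J11_eq pU qU eU vU in \<open>auto intro!: holo2_intros\<close>)
  also have "\<dots> = \<Delta> a * v a * jac (p, q) a"
    by (rule jac_combination[OF pU qU \<Delta>U vU eU U(1) \<open>p a = 0\<close> \<open>q a = 0\<close>])
  finally have "jac (p, q) a \<noteq> 0" using J by auto
  moreover have "jac (p, q) a = jac (pdy G, pdy (pdy G)) (0, 0) * jac (f0, l) a"
    unfolding p_def q_def using jac_compose[OF Gy Gyy f0U lU U(1) \<Phi>V[OF U(1)]] \<Phi>a by (simp add: \<Phi>_def)
  ultimately have "jac (pdy G, pdy (pdy G)) (0, 0) \<noteq> 0" by auto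
  \<comment> \<open>As \<open>G_yy\<close> vanishes at the origin, the Jacobian there is the single
    product \<open>G_xy G_yyy\<close>.\<close>
  then have G3: "pdy (pdy (pdy G)) (0, 0) \<noteq> 0" and Gxy: "pdx (pdy G) (0, 0) \<noteq> 0"
    using G2 by (auto simp: jac_def)
  have V0: "(0, 0) \<in> V" using V(2) U(1) \<Phi>a by force
  have Gz: "G (0, 0) = 0" using gG[OF U(1)] \<Phi>a by (simp add: \<Phi>_def)
  obtain M W \<phi>\<^sub>1 \<phi>\<^sub>2 \<psi>\<^sub>1 \<psi>\<^sub>2 where n: "holo2_on M \<phi>\<^sub>1" "holo2_on M \<phi>\<^sub>2" "(0, 0) \<in> M" "M \<subseteq> V"
    "holo2_on W \<psi>\<^sub>1" "holo2_on W \<psi>\<^sub>2" "(0, 0) \<in> W"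
    "\<phi>\<^sub>1 (0, 0) = 0" "\<phi>\<^sub>2 (0, 0) = 0" "jac (\<phi>\<^sub>1, \<phi>\<^sub>2) (0, 0) \<noteq> 0"
    "\<psi>\<^sub>1 (0, 0) = 0" "\<psi>\<^sub>2 (0, 0) = 0" "jac (\<psi>\<^sub>1, \<psi>\<^sub>2) (0, 0) \<noteq> 0"
    and n_eq: "\<And>z. z \<in> M \<Longrightarrow> (fst z, G z) \<in> W \<and>
       (\<psi>\<^sub>1 (fst z, G z), \<psi>\<^sub>2 (fst z, G z)) = cusp_std (\<phi>\<^sub>1 z, \<phi>\<^sub>2 z)"
    by (rule cusp_normal_form[OF G V0 Gz G1 G2 G3 Gxy]) (assumption | rule that)+
  define U' where "U' = U \<inter> \<Phi> -` M"
  have "continuous_on U \<Phi>" unfolding \<Phi>_def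
    by (intro continuous_intros holo2_on_continuous f0U lU)
  then have U': "open U'" unfolding U'_def
    using U(2) holo2_on_open[OF n(1)] by (rule continuous_open_preimage)
  have aU': "a \<in> U'" using U(1) \<Phi>a n(3) by (simp add: U'_def)
  have f0U': "holo2_on U' f0" and lU': "holo2_on U' l" using holo2_on_subset[OF _ U'] f0 l by auto
  have \<Phi>M: "(f0 z, l z) \<in> M" if "z \<in> U'" for z using that by (simp add: U'_def \<Phi>_def)
  \<comment> \<open>The normal form is centred at the origin, so the target is translated by
    \<open>F(a)\<close>.\<close>
  define W' where "W' = (\<lambda>w. w - (f a, g a)) -` W"
  have W': "open W'" unfolding W'_def
    using holo2_on_open[OF n(5)] by (intro open_vimage continuous_intros)
  define \<tau>\<^sub>1 where "\<tau>\<^sub>1 w = fst w - f a" for w :: c2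
  define \<tau>\<^sub>2 where "\<tau>\<^sub>2 w = snd w - g a" for w :: c2
  have \<tau>: "holo2_on W' \<tau>\<^sub>1" "holo2_on W' \<tau>\<^sub>2" unfolding \<tau>\<^sub>1_def \<tau>\<^sub>2_def by (intro holo2_intros W')+
  have j\<tau>: "jac (\<tau>\<^sub>1, \<tau>\<^sub>2) w = 1" for w
    unfolding \<tau>\<^sub>1_def[abs_def] \<tau>\<^sub>2_def[abs_def]
    using jac_eqI[OF has_cderiv_diff[OF has_cderiv_fst has_cderiv_const] has_cderiv_diff[OF has_cderiv_snd has_cderiv_const]]
    by simp
  have \<tau>a: "\<tau>\<^sub>1 (f a, g a) = 0" "\<tau>\<^sub>2 (f a, g a) = 0" by (simp_all add: \<tau>\<^sub>1_def \<tau>\<^sub>2_def)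
  have \<tau>W: "(\<tau>\<^sub>1 w, \<tau>\<^sub>2 w) \<in> W" if "w \<in> W'" for w
    using that by (cases w) (simp add: W'_def \<tau>\<^sub>1_def \<tau>\<^sub>2_def)
  show ?thesis
  proof (rule has_cuspI[of U' "\<lambda>z. \<phi>\<^sub>1 (f0 z, l z)" "\<lambda>z. \<phi>\<^sub>2 (f0 z, l z)" a W'
        "\<lambda>w. \<psi>\<^sub>1 (\<tau>\<^sub>1 w, \<tau>\<^sub>2 w)" "\<lambda>w. \<psi>\<^sub>2 (\<tau>\<^sub>1 w, \<tau>\<^sub>2 w)"])
    show "holo2_on U' (\<lambda>z. \<phi>\<^sub>1 (f0 z, l z))" "holo2_on U' (\<lambda>z. \<phi>\<^sub>2 (f0 z, l z))"
      by (rule holo2_on_compose2[OF n(1) f0U' lU' \<Phi>M] holo2_on_compose2[OF n(2) f0U' lU' \<Phi>M]; assumption)+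
    show "holo2_on W' (\<lambda>w. \<psi>\<^sub>1 (\<tau>\<^sub>1 w, \<tau>\<^sub>2 w))" "holo2_on W' (\<lambda>w. \<psi>\<^sub>2 (\<tau>\<^sub>1 w, \<tau>\<^sub>2 w))"
      by (rule holo2_on_compose2[OF n(5) \<tau> \<tau>W] holo2_on_compose2[OF n(6) \<tau> \<tau>W]; assumption)+
    show "jac (\<lambda>z. \<phi>\<^sub>1 (f0 z, l z), \<lambda>z. \<phi>\<^sub>2 (f0 z, l z)) a \<noteq> 0"
      using jac_compose[OF n(1,2) f0U' lU' aU' \<Phi>M[OF aU']] n(10) \<Phi>a \<Delta>a by (simp add: \<Phi>_def \<Delta>_def)
    have "(f a, g a) \<in> W'" using n(7) by (simp add: W'_def zero_prod_def)
    from jac_compose[OF n(5,6) \<tau> this \<tau>W[OF this]]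
    show "jac (\<lambda>w. \<psi>\<^sub>1 (\<tau>\<^sub>1 w, \<tau>\<^sub>2 w), \<lambda>w. \<psi>\<^sub>2 (\<tau>\<^sub>1 w, \<tau>\<^sub>2 w)) (f a, g a) \<noteq> 0"
      using n(13) by (simp add: j\<tau> \<tau>a)
    show "continuous_on UNIV (\<lambda>z. (f z, g z))"
      by (intro continuous_intros holo2_on_continuous f g)
    show "(f z, g z) \<in> W' \<and> (\<psi>\<^sub>1 (\<tau>\<^sub>1 (f z, g z), \<tau>\<^sub>2 (f z, g z)), \<psi>\<^sub>2 (\<tau>\<^sub>1 (f z, g z), \<tau>\<^sub>2 (f z, g z)))
        = cusp_std (\<phi>\<^sub>1 (f0 z, l z), \<phi>\<^sub>2 (f0 z, l z))" if z: "z \<in> U'" for z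
    proof -
      have "z \<in> U" using z by (simp add: U'_def)
      then show ?thesis
        using n_eq[OF \<Phi>M[OF z]] gG[of z, symmetric] by (simp add: W'_def \<tau>\<^sub>1_def \<tau>\<^sub>2_def f0_def)
    qed
  qed (use aU' n \<Phi>a in \<open>auto simp: \<Phi>_def \<tau>\<^sub>1_def \<tau>\<^sub>2_def\<close>)
qed

section \<open>The index of a cusp\<close>

text \<open>Colength one makes every function vanishing at \<open>a\<close> a combination of
  \<open>p\<close> and \<open>q\<close>. Comparing first-order terms for the two coordinate
  functions inverts the matrix of gradients of \<open>p\<close> and \<open>q\<close>.\<close>

lemma jac_nz_of_spans_quot_1:
  assumes p: "holo2_on UNIV p" and q: "holo2_on UNIV q" and 0: "p a = 0" "q a = 0" and sp: "spans_quot a p q 1"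
  shows "jac (p, q) a \<noteq> 0"
proof -
  obtain b where b: "\<And>\<psi>. germ_at a \<psi> \<Longrightarrow> \<exists>c :: nat \<Rightarrow> complex. in_ideal2 a p q (\<lambda>z. \<psi> z - (\<Sum>k<1. c k * b k z))"
    using sp unfolding spans_quot_def by blast
  have b': "\<exists>c. in_ideal2 a p q (\<lambda>z. \<psi> z - c * b 0 z)" if "germ_at a \<psi>" for \<psi>
    using b[OF that] by auto
  have ideal0: "\<phi> a = 0" if "in_ideal2 a p q \<phi>" for \<phi>
    using that 0 unfolding in_ideal2_def by force
  have germ: "germ_at a \<psi>" if "holo2_on UNIV \<psi>" for \<psi> using that unfolding germ_at_def by blast
  obtain c where "in_ideal2 a p q (\<lambda>z. 1 - c * b 0 z)"
    using b'[OF germ[OF holo2_on_const[OF open_UNIV]]] by blast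
  from ideal0[OF this] have b0: "b 0 a \<noteq> 0" by auto
  have m: "\<exists>u v. \<alpha> = u * pdx p a + v * pdx q a \<and> \<beta> = u * pdy p a + v * pdy q a"
    if \<psi>: "holo2_on UNIV \<psi>" "\<psi> a = 0" "has_cderiv \<psi> a \<alpha> \<beta>" for \<psi> \<alpha> \<beta>
  proof -
    obtain c where c: "in_ideal2 a p q (\<lambda>z. \<psi> z - c * b 0 z)" using b'[OF germ[OF \<psi>(1)]] by blast
    \<comment> \<open>Every member of the ideal vanishes at \<open>a\<close>, while the spanning
      germ does not, so \<open>\<psi>\<close> itself lies in the ideal.\<close>
    from ideal0[OF this] have "c = 0" using b0 \<psi>(2) by simp
    then obtain U u v where U: "a \<in> U" "holo2_on U u" "holo2_on U v" "\<forall>z\<in>U. \<psi> z = u z * p z + v z * q z"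
      using c unfolding in_ideal2_def by auto
    have "has_cderiv (\<lambda>z. u z * p z + v z * q z) a (u a * pdx p a + v a * pdx q a) (u a * pdy p a + v a * pdy q a)"
      using has_cderiv_add[OF has_cderiv_mult[OF holo2_on_cderiv[OF U(2,1)] holo2_on_cderiv[OF p UNIV_I]]
          has_cderiv_mult[OF holo2_on_cderiv[OF U(3,1)] holo2_on_cderiv[OF q UNIV_I]]] 0 by simp
    then have "has_cderiv \<psi> a (u a * pdx p a + v a * pdx q a) (u a * pdy p a + v a * pdy q a)"
      by (rule has_cderiv_transform[OF _ holo2_on_open[OF U(2)] U(1)]) (use U in auto)
    then show ?thesis using \<psi>(3) has_cderiv_pdx has_cderiv_pdy by metis
  qed
  have "holo2_on UNIV (\<lambda>z. fst z - fst a)" "has_cderiv (\<lambda>z. fst z - fst a) a 1 0"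
    using has_cderiv_diff[OF has_cderiv_fst[of a] has_cderiv_const[of "fst a"]] by (auto intro!: holo2_intros)
  from m[OF this(1) _ this(2)] obtain u v where uv: "1 = u * pdx p a + v * pdx q a" "0 = u * pdy p a + v * pdy q a" by auto
  have "holo2_on UNIV (\<lambda>z. snd z - snd a)" "has_cderiv (\<lambda>z. snd z - snd a) a 0 1"
    using has_cderiv_diff[OF has_cderiv_snd[of a] has_cderiv_const[of "snd a"]] by (auto intro!: holo2_intros)
  from m[OF this(1) _ this(2)] obtain u' v' where uv': "0 = u' * pdx p a + v' * pdx q a" "1 = u' * pdy p a + v' * pdy q a" by auto
  have "(u * v' - u' * v) * jac (p, q) a = 
      (u * pdx p a + v * pdx q a) * (u' * pdy p a + v' * pdy q a) - (u * pdy p a + v * pdy q a) * (u' * pdx p a + v' * pdx q a)"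
    by (simp add: jac_def algebra_simps)
  also have "\<dots> = 1" by (simp flip: uv uv')
  finally show ?thesis by auto
qed

text \<open>The order of \<open>enat\<close> is well-founded, so the infimum of a nonempty set is
  attained; the empty set would give infinity.\<close>

lemma local_dim_spans:
  assumes "local_dim a p q = enat k"
  shows "spans_quot a p q k"
proof -
  let ?S = "enat ` {n. spans_quot a p q n}"
  have "?S \<noteq> {}"
  proof
    assume "?S = {}"
    then have "local_dim a p q = Inf {}" unfolding local_dim_def by simp
    then show False using assms by (simp add: Inf_enat_def)
  qed
  then obtain x where "x \<in> ?S" by blast
  then have "(LEAST x. x \<in> ?S) \<in> ?S" by (rule LeastI)
  then have "Inf ?S \<in> ?S" using \<open>?S \<noteq> {}\<close> unfolding Inf_enat_def by (simp only: if_False)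
  then show ?thesis using assms unfolding local_dim_def by auto
qed

lemma local_dim_le: "spans_quot a p q n \<Longrightarrow> local_dim a p q \<le> enat n"
  unfolding local_dim_def by (rule INF_lower) simp

text \<open>\<open>H\<close> plays the inverse of the target chart followed by \<open>T\<close>, so
  that \<open>(f, g)\<close> is \<open>H\<close> after \<open>cusp_std\<close> after
  \<open>\<phi>\<close>. The Jacobian of \<open>cusp_std\<close> is \<open>k = 3 y^2 + x\<close>;
  hence \<open>J\<close> is \<open>k\<close> times a unit, and \<open>J11\<close> is
  \<open>L = {k, P}\<close> times a unit modulo \<open>k\<close>.\<close>

lemma cusp_jacobians:
  assumes f: "holo2_on UNIV f" and g: "holo2_on UNIV g"
    and H: "holo2_on W H\<^sub>1" "holo2_on W H\<^sub>2" "jac (H\<^sub>1, H\<^sub>2) (0, 0) \<noteq> 0" "pdx H\<^sub>1 (0, 0) \<noteq> 0"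
    and \<phi>: "holo2_on U \<phi>\<^sub>1" "holo2_on U \<phi>\<^sub>2" "a \<in> U" "\<phi>\<^sub>1 a = 0" "\<phi>\<^sub>2 a = 0" "jac (\<phi>\<^sub>1, \<phi>\<^sub>2) a \<noteq> 0"
    and W: "\<And>z. z \<in> U \<Longrightarrow> cusp_std (\<phi>\<^sub>1 z, \<phi>\<^sub>2 z) \<in> W"
    and eq: "\<And>z. z \<in> U \<Longrightarrow> f z = H\<^sub>1 (cusp_std (\<phi>\<^sub>1 z, \<phi>\<^sub>2 z))" "\<And>z. z \<in> U \<Longrightarrow> g z = H\<^sub>2 (cusp_std (\<phi>\<^sub>1 z, \<phi>\<^sub>2 z))"
  shows "jac (f, g) a = 0" "jac11 (f, g) a = 0" "jac (jac (f, g), jac11 (f, g)) a \<noteq> 0" "pdx f a \<noteq> 0 \<or> pdy f a \<noteq> 0"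
proof -
  define s where "s w = snd w ^ 3 + fst w * snd w" for w :: c2
  have std: "cusp_std w = (fst w, s w)" for w by (simp add: cusp_std_def s_def)
  define V where "V = cusp_std -` W"
  have "continuous_on UNIV cusp_std" unfolding cusp_std_def by (intro continuous_intros)
  then have V: "open V" unfolding V_def using holo2_on_open[OF H(1)] open_vimage by blast
  have VW: "(fst w, s w) \<in> W" if "w \<in> V" for w using that by (simp add: V_def std)
  have fV: "holo2_on V fst" and sV: "holo2_on V s" and yV: "holo2_on V snd"
    unfolding s_def by (intro holo2_intros V)+
  have comp: "holo2_on V (\<lambda>w. h (fst w, s w))" if "holo2_on W h" for h
    by (rule holo2_on_compose2[OF that fV sV VW])
  have ds: "has_cderiv s w (snd w) (3 * (snd w)\<^sup>2 + fst w)" for w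
    using has_cderiv_add[OF has_cderiv_mult[OF has_cderiv_snd has_cderiv_mult[OF has_cderiv_snd has_cderiv_snd]]
        has_cderiv_mult[OF has_cderiv_fst has_cderiv_snd], of w]
    by (simp add: s_def[abs_def] power3_eq_cube power2_eq_square algebra_simps)
  define k where "k w = 3 * (snd w)\<^sup>2 + fst w" for w :: c2
  have kV: "holo2_on V k" unfolding k_def by (intro holo2_intros V)
  have dk: "has_cderiv k w 1 (6 * snd w)" for w
    using has_cderiv_add[OF has_cderiv_mult[OF has_cderiv_const[of 3] has_cderiv_mult[OF has_cderiv_snd has_cderiv_snd]]
        has_cderiv_fst, of w]
    by (simp add: k_def[abs_def] power2_eq_square algebra_simps)
  define P where "P w = H\<^sub>1 (fst w, s w)" for w
  define Q where "Q w = H\<^sub>2 (fst w, s w)" for w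
  have PV: "holo2_on V P" and QV: "holo2_on V Q" unfolding P_def Q_def by (intro comp H)+
  define h1 where "h1 w = pdx H\<^sub>1 (fst w, s w)" for w
  define h2 where "h2 w = pdy H\<^sub>1 (fst w, s w)" for w
  have hV: "holo2_on V h1" "holo2_on V h2" unfolding h1_def h2_def by (intro comp holo2_on_pdx holo2_on_pdy H)+
  have dP: "has_cderiv P w (h1 w + h2 w * snd w) (h2 w * k w)" if "w \<in> V" for w
    using has_cderiv_compose2[OF holo2_on_cderiv[OF H(1) VW[OF that]] has_cderiv_fst ds]
    by (simp add: P_def[abs_def] h1_def h2_def k_def)
  have V0: "(0, 0) \<in> V" using W[OF \<phi>(3)] \<phi>(4,5) by (simp add: V_def)
  define \<Delta> where "\<Delta> = jac (\<phi>\<^sub>1, \<phi>\<^sub>2)"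
  have \<Delta>U: "holo2_on U \<Delta>" unfolding \<Delta>_def by (rule holo2_on_jac[OF \<phi>(1,2)])
  have cV: "(\<phi>\<^sub>1 z, \<phi>\<^sub>2 z) \<in> V" if "z \<in> U" for z using W[OF that] by (simp add: V_def)
  have compU: "holo2_on U (\<lambda>z. h (\<phi>\<^sub>1 z, \<phi>\<^sub>2 z))" if "holo2_on V h" for h
    by (rule holo2_on_compose2[OF that \<phi>(1,2) cV])
  have jcomp: "jac (\<lambda>z. h (\<phi>\<^sub>1 z, \<phi>\<^sub>2 z), \<lambda>z. h' (\<phi>\<^sub>1 z, \<phi>\<^sub>2 z)) z = jac (h, h') (\<phi>\<^sub>1 z, \<phi>\<^sub>2 z) * \<Delta> z"
    if "holo2_on V h" "holo2_on V h'" "z \<in> U" for h h' z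
    unfolding \<Delta>_def by (rule jac_compose[OF that(1,2) \<phi>(1,2) that(3) cV[OF that(3)]])
  have fU: "holo2_on U f" and gU: "holo2_on U g"
    using holo2_on_subset[OF _ holo2_on_open[OF \<phi>(1)]] f g by auto
  have fP: "f z = P (\<phi>\<^sub>1 z, \<phi>\<^sub>2 z)" and gQ: "g z = Q (\<phi>\<^sub>1 z, \<phi>\<^sub>2 z)" if "z \<in> U" for z
    using eq that by (simp_all add: P_def Q_def std)
  define p where "p z = k (\<phi>\<^sub>1 z, \<phi>\<^sub>2 z)" for z
  define u where "u z = jac (H\<^sub>1, H\<^sub>2) (\<phi>\<^sub>1 z, s (\<phi>\<^sub>1 z, \<phi>\<^sub>2 z)) * \<Delta> z" for z
  have pU: "holo2_on U p" unfolding p_def by (rule compU[OF kV])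
  have uU: "holo2_on U u" unfolding u_def
    using compU[OF comp[OF holo2_on_jac[OF H(1,2)]]] \<Delta>U by (auto intro: holo2_intros)
  have J_eq: "jac (f, g) z = p z * u z" if z: "z \<in> U" for z
  proof -
    have "jac (f, g) z = jac (\<lambda>z. P (\<phi>\<^sub>1 z, \<phi>\<^sub>2 z), \<lambda>z. Q (\<phi>\<^sub>1 z, \<phi>\<^sub>2 z)) z"
      by (rule jac_cong[OF z fU gU fP gQ])
    also have "\<dots> = jac (P, Q) (\<phi>\<^sub>1 z, \<phi>\<^sub>2 z) * \<Delta> z" by (rule jcomp[OF PV QV z])
    also have "jac (P, Q) (\<phi>\<^sub>1 z, \<phi>\<^sub>2 z) = jac (H\<^sub>1, H\<^sub>2) (\<phi>\<^sub>1 z, s (\<phi>\<^sub>1 z, \<phi>\<^sub>2 z)) * jac (fst, s) (\<phi>\<^sub>1 z, \<phi>\<^sub>2 z)"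
      unfolding P_def Q_def using jac_compose[OF H(1,2) fV sV cV[OF z] VW[OF cV[OF z]]] by simp
    also have "jac (fst, s) (\<phi>\<^sub>1 z, \<phi>\<^sub>2 z) = p z"
      using jac_eqI[OF has_cderiv_fst ds] by (simp add: p_def k_def)
    finally show ?thesis by (simp add: u_def)
  qed
  define L where "L = jac (k, P)"
  have LV: "holo2_on V L" unfolding L_def by (rule holo2_on_jac[OF kV PV])
  have L_eq: "h2 w * k w - 6 * snd w * (h1 w + h2 w * snd w) = L w" if "w \<in> V" for w
    unfolding L_def jac_eqI[OF dk dP[OF that]] by simp
  define q where "q z = L (\<phi>\<^sub>1 z, \<phi>\<^sub>2 z)" for z
  have qU: "holo2_on U q" unfolding q_def by (rule compU[OF LV])
  define e where "e = jac (u, f)"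
  have eU: "holo2_on U e" unfolding e_def by (rule holo2_on_jac[OF uU fU])
  have uvU: "holo2_on U (\<lambda>z. p z * u z)" by (intro holo2_intros pU uU)
  define v where "v z = u z * \<Delta> z" for z
  have vU: "holo2_on U v" unfolding v_def by (intro holo2_intros uU \<Delta>U)
  have J11_eq: "jac11 (f, g) z = q z * v z + p z * e z" if z: "z \<in> U" for z
  proof -
    have "jac11 (f, g) z = jac (jac (f, g), f) z" by (simp add: jac11_eq_jac)
    also have "\<dots> = jac (\<lambda>z. p z * u z, f) z"
      by (rule jac_cong[symmetric, OF z uvU fU]) (use J_eq in auto)
    also have "\<dots> = u z * jac (p, f) z + p z * jac (u, f) z"
      by (rule jac_mult_left[OF pU uU fU z])
    also have "jac (p, f) z = jac (\<lambda>z. k (\<phi>\<^sub>1 z, \<phi>\<^sub>2 z), \<lambda>z. P (\<phi>\<^sub>1 z, \<phi>\<^sub>2 z)) z"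
      by (rule jac_cong[OF z pU fU]) (use fP in \<open>auto simp: p_def\<close>)
    also have "\<dots> = q z * \<Delta> z" using jcomp[OF kV PV z] by (simp add: q_def L_def)
    finally show ?thesis by (simp add: v_def e_def algebra_simps)
  qed
  have p0: "p a = 0" using \<phi>(4,5) by (simp add: p_def k_def)
  have q0: "q a = 0" using \<phi>(4,5) L_eq[OF V0] by (simp add: q_def k_def)
  show "jac (f, g) a = 0" "jac11 (f, g) a = 0"
    using J_eq[OF \<phi>(3)] J11_eq[OF \<phi>(3)] p0 q0 by simp_all
  have h10: "h1 (0, 0) \<noteq> 0" using H(4) by (simp add: h1_def s_def)
  \<comment> \<open>The gradient of \<open>k\<close> at the origin is \<open>(1, 0)\<close>, so only
    the \<open>y\<close>-derivative of \<open>L\<close> counts. The assumption on \<open>pdx\<close>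
    of \<open>H\<^sub>1\<close>, encoded in \<open>h1\<close>, makes it nonzero.\<close>
  have "jac (k, L) (0, 0) = - 6 * h1 (0, 0)"
  proof -
    note d = holo2_on_cderiv[OF hV(1) V0] holo2_on_cderiv[OF hV(2) V0]
    have "\<exists>c. has_cderiv (\<lambda>w. h2 w * k w - 6 * snd w * (h1 w + h2 w * snd w)) (0, 0) c (- 6 * h1 (0, 0))"
      using has_cderiv_diff[OF has_cderiv_mult[OF d(2) dk] has_cderiv_mult[OF has_cderiv_mult[OF has_cderiv_const[of 6] has_cderiv_snd]
          has_cderiv_add[OF d(1) has_cderiv_mult[OF d(2) has_cderiv_snd]]]]
      by (auto simp: k_def)
    then obtain c where c: "has_cderiv (\<lambda>w. h2 w * k w - 6 * snd w * (h1 w + h2 w * snd w)) (0, 0) c (- 6 * h1 (0, 0))" ..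
    from jac_eqI[OF dk has_cderiv_transform[OF c V V0 L_eq]] show ?thesis by simp
  qed
  then have "jac (p, q) a \<noteq> 0"
    using jcomp[OF kV LV \<phi>(3)] \<phi>(4,5,6) h10 by (simp add: p_def[abs_def] q_def[abs_def] \<Delta>_def)
  moreover have "u a \<noteq> 0" using H(3) \<phi>(4-6) by (simp add: u_def s_def \<Delta>_def)
  moreover have "v a \<noteq> 0" using \<open>u a \<noteq> 0\<close> \<phi>(6) by (simp add: v_def \<Delta>_def)
  moreover have "jac (jac (f, g), jac11 (f, g)) a = jac (\<lambda>z. p z * u z, \<lambda>z. q z * v z + p z * e z) a"
    by (rule jac_cong[symmetric, OF \<phi>(3) uvU])
       (use J_eq J11_eq pU qU eU vU in \<open>auto intro!: holo2_intros\<close>)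
  ultimately show "jac (jac (f, g), jac11 (f, g)) a \<noteq> 0"
    using jac_combination[OF pU qU uU vU eU \<phi>(3) p0 q0] by simp
  show "pdx f a \<noteq> 0 \<or> pdy f a \<noteq> 0"
  proof (rule ccontr)
    assume "\<not> ?thesis"
    then have f0: "pdx f a = 0" "pdy f a = 0" by auto
    \<comment> \<open>At \<open>a\<close> the differential of \<open>f\<close> is
      \<open>h1 (0, 0)\<close> times that of \<open>\<phi>\<^sub>1\<close>, which is nonzero because
      \<open>\<phi>\<close> is a chart.\<close>
    have P: "has_cderiv P (\<phi>\<^sub>1 a, \<phi>\<^sub>2 a) (h1 (0, 0)) 0" using dP[OF V0] \<phi>(4,5) by (simp add: k_def)
    have df: "has_cderiv f a (h1 (0, 0) * pdx \<phi>\<^sub>1 a) (h1 (0, 0) * pdy \<phi>\<^sub>1 a)"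
      using has_cderiv_transform[OF has_cderiv_compose2[OF P holo2_on_cderiv[OF \<phi>(1,3)] holo2_on_cderiv[OF \<phi>(2,3)]]
          holo2_on_open[OF \<phi>(1)] \<phi>(3) fP[symmetric]] by simp
    have "pdx \<phi>\<^sub>1 a = 0" "pdy \<phi>\<^sub>1 a = 0"
      using has_cderiv_pdx[OF df] has_cderiv_pdy[OF df] f0 h10 by simp_all
    then show False using \<phi>(6) by (simp add: jac_def)
  qed
qed

section \<open>Linear changes of the target and the two implications\<close>

lemma poly2_le_holo2_on:
  assumes "poly2_le d f"
  shows "holo2_on UNIV f"
proof -
  obtain c where c: "\<And>x y. f (x, y) = (\<Sum>i\<le>d. \<Sum>j\<le>d - i. c i j * x ^ i * y ^ j)"
    using assms unfolding poly2_le_def by blast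
  have "holo2_on UNIV (\<lambda>z. \<Sum>i\<le>d. \<Sum>j\<le>d - i. c i j * fst z ^ i * snd z ^ j)"
    by (intro holo2_intros; simp)
  then show ?thesis by (rule holo2_on_cong) (use c in auto)
qed

lemma holo2_on_tcomp:
  assumes "holo2_on U (fst F)" "holo2_on U (snd F)"
  shows "holo2_on U (fst (tcomp T F))" "holo2_on U (snd (tcomp T F))"
  unfolding tcomp_def fst_conv snd_conv by (intro holo2_intros assms holo2_on_open[OF assms(1)])+

lemma cderiv_tcomp:
  assumes "holo2_on U (fst F)" "holo2_on U (snd F)" "z \<in> U"
  shows "has_cderiv (fst (tcomp T F)) z (T$1$1 * pdx (fst F) z + T$1$2 * pdx (snd F) z) (T$1$1 * pdy (fst F) z + T$1$2 * pdy (snd F) z)"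
    "has_cderiv (snd (tcomp T F)) z (T$2$1 * pdx (fst F) z + T$2$2 * pdx (snd F) z) (T$2$1 * pdy (fst F) z + T$2$2 * pdy (snd F) z)"
proof -
  note d = holo2_on_cderiv[OF assms(1,3)] holo2_on_cderiv[OF assms(2,3)]
  have "has_cderiv (\<lambda>z. b * fst F z + c * snd F z) z (b * pdx (fst F) z + c * pdx (snd F) z) (b * pdy (fst F) z + c * pdy (snd F) z)" for b c
    using has_cderiv_add[OF has_cderiv_mult[OF has_cderiv_const[of b] d(1)] has_cderiv_mult[OF has_cderiv_const[of c] d(2)]] by simp
  then show "has_cderiv (fst (tcomp T F)) z (T$1$1 * pdx (fst F) z + T$1$2 * pdx (snd F) z) (T$1$1 * pdy (fst F) z + T$1$2 * pdy (snd F) z)"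
    "has_cderiv (snd (tcomp T F)) z (T$2$1 * pdx (fst F) z + T$2$2 * pdx (snd F) z) (T$2$1 * pdy (fst F) z + T$2$2 * pdy (snd F) z)"
    by (simp_all add: tcomp_def)
qed

lemma jac_tcomp:
  assumes "holo2_on U (fst F)" "holo2_on U (snd F)" "z \<in> U"
  shows "jac (tcomp T F) z = det T * jac F z"
  using jac_eqI[OF cderiv_tcomp[OF assms]] by (simp add: det_2 jac_def algebra_simps)

text \<open>If the value is 0, adding a small real multiple of the conjugate vector to the first row
  changes it by a nonzero multiple of \<open>|\<alpha>|^2 + |\<beta>|^2\<close>.\<close>

lemma exists_generic_row:
  fixes T :: "complex^2^2"
  assumes "open S" "T \<in> S" "\<alpha> \<noteq> 0 \<or> \<beta> \<noteq> 0"
  shows "\<exists>T'\<in>S. T'$1$1 * \<alpha> + T'$1$2 * \<beta> \<noteq> 0"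
proof (cases "T$1$1 * \<alpha> + T$1$2 * \<beta> = 0")
  case False
  then show ?thesis using assms by blast
next
  case True
  define E :: "complex^2^2" where "E = (\<chi> i j. if i = 1 then (if j = 1 then cnj \<alpha> else cnj \<beta>) else 0)"
  have E: "E$1$1 = cnj \<alpha>" "E$1$2 = cnj \<beta>" by (simp_all add: E_def)
  have "((\<lambda>\<epsilon>::real. T + \<epsilon> *\<^sub>R E) \<longlongrightarrow> T + 0 *\<^sub>R E) (at 0)" by (intro tendsto_intros)
  then have "eventually (\<lambda>\<epsilon>. T + \<epsilon> *\<^sub>R E \<in> S) (at 0)"
    by (rule topological_tendstoD) (use assms in auto)
  moreover have "eventually (\<lambda>\<epsilon>::real. \<epsilon> \<noteq> 0) (at 0)" by (simp add: eventually_at_filter)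
  ultimately have "eventually (\<lambda>\<epsilon>. T + \<epsilon> *\<^sub>R E \<in> S \<and> \<epsilon> \<noteq> 0) (at 0)" by (rule eventually_conj)
  then obtain \<epsilon> where \<epsilon>: "T + \<epsilon> *\<^sub>R E \<in> S" "\<epsilon> \<noteq> 0"
    using eventually_happens[of _ "at (0::real)"] by auto
  have "(T + \<epsilon> *\<^sub>R E)$1$1 * \<alpha> + (T + \<epsilon> *\<^sub>R E)$1$2 * \<beta> = (T$1$1 * \<alpha> + T$1$2 * \<beta>) + \<epsilon> *\<^sub>R (\<alpha> * cnj \<alpha> + \<beta> * cnj \<beta>)"
    by (simp add: E algebra_simps)
  then have "(T + \<epsilon> *\<^sub>R E)$1$1 * \<alpha> + (T + \<epsilon> *\<^sub>R E)$1$2 * \<beta> \<noteq> 0"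
    using True \<epsilon>(2) mult_cnj_add_neq_0[OF assms(3)] by simp
  then show ?thesis using \<epsilon>(1) by blast
qed

text \<open>The linear isomorphism given by \<open>T\<close> is absorbed into the target
  chart.\<close>

lemma has_cusp_of_tcomp:
  assumes cusp: "has_cusp (app (tcomp T F)) a" and T: "invertible T"
  shows "has_cusp (app F) a"
proof -
  define D where "D = T$1$1 * T$2$2 - T$1$2 * T$2$1"
  have D: "D \<noteq> 0" using T by (simp add: invertible_det_nz det_2 D_def)
  define \<tau> where "\<tau> w = (T$1$1 * fst w + T$1$2 * snd w, T$2$1 * fst w + T$2$2 * snd w)" for w :: c2
  define \<sigma> where "\<sigma> w = ((T$2$2 * fst w - T$1$2 * snd w) / D, (T$1$1 * snd w - T$2$1 * fst w) / D)" for w :: c2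
  have e: "b / D = x" if "b = D * x" for b x using that D by simp
  have \<sigma>\<tau>: "\<sigma> (\<tau> w) = w" for w
  proof -
    have "(T$2$2 * (T$1$1 * x + T$1$2 * y) - T$1$2 * (T$2$1 * x + T$2$2 * y)) / D = x"
      "(T$1$1 * (T$2$1 * x + T$2$2 * y) - T$2$1 * (T$1$1 * x + T$1$2 * y)) / D = y" for x y
      by (rule e, simp add: D_def algebra_simps)+
    then show ?thesis by (cases w) (simp add: \<sigma>_def \<tau>_def)
  qed
  have \<tau>\<sigma>: "\<tau> (\<sigma> w) = w" for w
  proof -
    have "(T$1$1 * (T$2$2 * x - T$1$2 * y) + T$1$2 * (T$1$1 * y - T$2$1 * x)) / D = x"
      "(T$2$1 * (T$2$2 * x - T$1$2 * y) + T$2$2 * (T$1$1 * y - T$2$1 * x)) / D = y" for x y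
      by (rule e, simp add: D_def algebra_simps)+
    then show ?thesis by (cases w) (simp add: \<sigma>_def \<tau>_def add_divide_distrib)
  qed
  have app: "app (tcomp T F) z = \<tau> (app F z)" for z by (simp add: app_def tcomp_def \<tau>_def)
  obtain U U' W W' \<phi> \<psi> where c: "a \<in> U" "biholo U U' \<phi>" "\<phi> a = (0, 0)" "\<tau> (app F a) \<in> W" "biholo W W' \<psi>"
    "\<psi> (\<tau> (app F a)) = (0, 0)" "\<forall>z\<in>U. \<tau> (app F z) \<in> W \<and> \<psi> (\<tau> (app F z)) = cusp_std (\<phi> z)"
    using cusp unfolding has_cusp_def app by blast
  obtain \<kappa> where \<kappa>: "holo_map_on W' \<kappa>" "\<forall>w\<in>W. \<kappa> (\<psi> w) = w" and W': "open W'" "\<psi> ` W = W'" and \<psi>: "holo_map_on W \<psi>"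
    using c(5) unfolding biholo_def by blast
  define W2 where "W2 = \<tau> -` W"
  have "open W" using \<psi> holo2_on_open unfolding holo_map_on_def by blast
  moreover have "continuous_on UNIV \<tau>" unfolding \<tau>_def by (intro continuous_intros)
  ultimately have W2: "open W2" unfolding W2_def using open_vimage by blast
  have "holo_map_on W2 (\<lambda>w. \<psi> (\<tau> w))"
  proof -
    have "holo2_on W2 (\<lambda>w. h (T$1$1 * fst w + T$1$2 * snd w, T$2$1 * fst w + T$2$2 * snd w))" if "holo2_on W h" for h
      by (intro holo2_on_compose2[OF that] holo2_intros W2) (auto simp: W2_def \<tau>_def)
    then show ?thesis using \<psi> unfolding holo_map_on_def \<tau>_def by auto
  qed
  moreover have "(\<lambda>w. \<psi> (\<tau> w)) ` W2 = W'"
  proof -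
    have "\<tau> ` W2 = W" unfolding W2_def using \<tau>\<sigma> by (metis surj_image_vimage_eq surjI)
    then show ?thesis using W'(2) by (metis image_image)
  qed
  moreover have "holo_map_on W' (\<lambda>w. \<sigma> (\<kappa> w))"
    using \<kappa>(1) D W'(1) unfolding holo_map_on_def \<sigma>_def by (auto intro!: holo2_intros)
  moreover have "\<forall>w\<in>W2. \<sigma> (\<kappa> (\<psi> (\<tau> w))) = w" using \<kappa>(2) \<sigma>\<tau> by (simp add: W2_def)
  ultimately have "biholo W2 W' (\<lambda>w. \<psi> (\<tau> w))"
    unfolding biholo_def using W'(1) by (intro conjI exI[of _ "\<lambda>w. \<sigma> (\<kappa> w)"])
  then show ?thesis unfolding has_cusp_def using c
    by (intro exI[of _ U] exI[of _ U'] exI[of _ W2] exI[of _ W'] exI[of _ \<phi>] exI[of _ "\<lambda>w. \<psi> (\<tau> w)"])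
       (simp add: W2_def)
qed

text \<open>The discriminant of \<open>cusp_std\<close> is tangent to the first axis, so
  \<open>(\<alpha>, \<beta>)\<close>, the image of that axis under the inverse target chart
  \<open>K\<close>, spans the cuspidal tangent in the target of \<open>F\<close>. The generic
  \<open>T\<close> are those whose first row does not annihilate it.\<close>

lemma cusp_index_of_has_cusp:
  assumes f: "holo2_on UNIV (fst F)" "holo2_on UNIV (snd F)" and cusp: "has_cusp (app F) a"
  shows "cusp_index_is a F 1"
proof -
  obtain U U' W W' \<phi> \<psi> where c: "a \<in> U" "biholo U U' \<phi>" "\<phi> a = (0, 0)" "app F a \<in> W" "biholo W W' \<psi>"
    "\<psi> (app F a) = (0, 0)" "\<And>z. z \<in> U \<Longrightarrow> app F z \<in> W \<and> \<psi> (app F z) = cusp_std (\<phi> z)"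
    using cusp unfolding has_cusp_def by blast
  obtain \<kappa> where \<kappa>: "holo_map_on W' \<kappa>" "\<And>w. w \<in> W \<Longrightarrow> \<kappa> (\<psi> w) = w" and W': "open W'" "\<psi> ` W = W'" and \<psi>: "holo_map_on W \<psi>"
    using c(5) unfolding biholo_def by blast
  have "open W" using \<psi> holo2_on_open unfolding holo_map_on_def by blast
  have "biholo W' W \<kappa>"
    unfolding biholo_def using \<kappa> \<psi> W' \<open>open W\<close> by (force intro!: exI[of _ \<psi>])
  have W'0: "(0, 0) \<in> W'" using c(4,6) W'(2) by force
  define K where "K = (\<lambda>w. fst (\<kappa> w), \<lambda>w. snd (\<kappa> w))"
  have K: "holo2_on W' (fst K)" "holo2_on W' (snd K)" using \<kappa>(1) by (simp_all add: K_def holo_map_on_def)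
  have jK: "jac K (0, 0) \<noteq> 0" unfolding K_def by (rule biholo_jac_nz[OF \<open>biholo W' W \<kappa>\<close> W'0])
  define \<alpha> where "\<alpha> = pdx (fst K) (0, 0)"
  define \<beta> where "\<beta> = pdx (snd K) (0, 0)"
  have \<alpha>\<beta>: "\<alpha> \<noteq> 0 \<or> \<beta> \<noteq> 0" using jK by (auto simp: jac_def \<alpha>_def \<beta>_def)
  define S :: "(complex^2^2) set" where "S = {T. invertible T \<and> T$1$1 * \<alpha> + T$1$2 * \<beta> \<noteq> 0}"
  have inv_eq: "{T :: complex^2^2. invertible T} = {T. T$1$1 * T$2$2 - T$1$2 * T$2$1 \<noteq> 0}"
    by (simp add: invertible_det_nz det_2)
  have open_inv: "open {T :: complex^2^2. invertible T}"
    unfolding inv_eq by (intro open_Collect_neq continuous_intros)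
  have "open {T :: complex^2^2. T$1$1 * \<alpha> + T$1$2 * \<beta> \<noteq> 0}"
    by (intro open_Collect_neq continuous_intros)
  then have "open S" unfolding S_def using open_inv by (simp add: open_Int Collect_conj_eq)
  moreover have "{T. invertible T} \<subseteq> closure S"
  proof
    fix T :: "complex^2^2" assume T: "T \<in> {T. invertible T}"
    show "T \<in> closure S"
      unfolding closure_approachable
    proof (intro allI impI)
      fix \<epsilon> :: real assume "\<epsilon> > 0"
      then have "T \<in> ball T \<epsilon> \<inter> {T. invertible T}" using T by simp
      from exists_generic_row[OF open_Int[OF open_ball open_inv] this \<alpha>\<beta>]
      obtain T' where "T' \<in> ball T \<epsilon> \<inter> {T. invertible T}" "T'$1$1 * \<alpha> + T'$1$2 * \<beta> \<noteq> 0" by blast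
      then show "\<exists>y\<in>S. dist y T < \<epsilon>" by (intro bexI[of _ T']) (auto simp: S_def dist_commute)
    qed
  qed
  moreover have "grad_transverse a F (tcomp T F) \<and>
         (\<exists>k1 k2. local_dim a (jac (tcomp T F)) (jac11 (tcomp T F)) = enat k1 \<and>
                  local_dim a (pdx (fst (tcomp T F))) (pdy (fst (tcomp T F))) = enat k2 \<and>
                  int k1 - int k2 = 1)" if T: "T \<in> S" for T
  proof -
    define f' where "f' = fst (tcomp T F)"
    define g' where "g' = snd (tcomp T F)"
    have TF: "tcomp T F = (f', g')" by (simp add: f'_def g'_def)
    have h: "holo2_on UNIV f'" "holo2_on UNIV g'"
      using holo2_on_tcomp[OF f] by (simp_all add: f'_def g'_def)
    define H\<^sub>1 where "H\<^sub>1 = fst (tcomp T K)"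
    define H\<^sub>2 where "H\<^sub>2 = snd (tcomp T K)"
    have H: "holo2_on W' H\<^sub>1" "holo2_on W' H\<^sub>2" using holo2_on_tcomp[OF K] by (simp_all add: H\<^sub>1_def H\<^sub>2_def)
    have jH: "jac (H\<^sub>1, H\<^sub>2) (0, 0) \<noteq> 0"
      using jac_tcomp[OF K W'0, of T] jK T by (simp add: H\<^sub>1_def H\<^sub>2_def S_def invertible_det_nz)
    have pH: "pdx H\<^sub>1 (0, 0) \<noteq> 0"
      using has_cderiv_pdx[OF cderiv_tcomp(1)[OF K W'0, of T]] T by (simp add: H\<^sub>1_def S_def \<alpha>_def \<beta>_def)
    define \<phi>\<^sub>1 where "\<phi>\<^sub>1 z = fst (\<phi> z)" for z
    define \<phi>\<^sub>2 where "\<phi>\<^sub>2 z = snd (\<phi> z)" for z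
    have \<phi>: "holo2_on U \<phi>\<^sub>1" "holo2_on U \<phi>\<^sub>2" "\<phi>\<^sub>1 a = 0" "\<phi>\<^sub>2 a = 0"
      using c(2,3) by (auto simp: \<phi>\<^sub>1_def[abs_def] \<phi>\<^sub>2_def[abs_def] biholo_def holo_map_on_def)
    have j\<phi>: "jac (\<phi>\<^sub>1, \<phi>\<^sub>2) a \<noteq> 0"
      using biholo_jac_nz[OF c(2,1)] by (simp add: \<phi>\<^sub>1_def[abs_def] \<phi>\<^sub>2_def[abs_def])
    have inW: "cusp_std (\<phi>\<^sub>1 z, \<phi>\<^sub>2 z) \<in> W'" if "z \<in> U" for z
      using c(7)[OF that] W'(2) by (force simp: \<phi>\<^sub>1_def \<phi>\<^sub>2_def)
    have F\<kappa>: "\<kappa> (cusp_std (\<phi>\<^sub>1 z, \<phi>\<^sub>2 z)) = app F z" if "z \<in> U" for z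
      using c(7)[OF that] \<kappa>(2) by (metis \<phi>\<^sub>1_def \<phi>\<^sub>2_def prod.collapse)
    have eq: "f' z = H\<^sub>1 (cusp_std (\<phi>\<^sub>1 z, \<phi>\<^sub>2 z))" "g' z = H\<^sub>2 (cusp_std (\<phi>\<^sub>1 z, \<phi>\<^sub>2 z))" if "z \<in> U" for z
      using F\<kappa>[OF that] by (simp_all add: f'_def g'_def H\<^sub>1_def H\<^sub>2_def tcomp_def K_def app_def)
    note cj = cusp_jacobians[OF h H jH pH \<phi>(1,2) c(1) \<phi>(3,4) j\<phi> inW eq]
    have jh: "holo2_on UNIV (jac (f', g'))" "holo2_on UNIV (jac11 (f', g'))"
      using holo2_on_jac[OF h] holo2_on_jac[OF holo2_on_jac[OF h] h(1)] by (simp_all add: jac11_eq_jac)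
    have 1: "local_dim a (jac (f', g')) (jac11 (f', g')) = enat 1"
      by (rule local_dim_eq_1[OF jh UNIV_I cj(3,1,2)])
    have 0: "local_dim a (pdx f') (pdy f') = enat 0"
      by (rule local_dim_eq_0[OF holo2_on_pdx[OF h(1)] holo2_on_pdy[OF h(1)] UNIV_I cj(4)])
    \<comment> \<open>On \<open>V\<close> the gradient of \<open>f'\<close> has no zero at all, so
      the set in the transversality condition is empty.\<close>
    define V where "V = {z. pdx f' z \<noteq> 0} \<union> {z. pdy f' z \<noteq> 0}"
    have "open V" unfolding V_def
      by (intro open_Un open_Collect_neq continuous_intros holo2_on_continuous holo2_on_pdx holo2_on_pdy h)
    then have "grad_transverse a F (f', g')"
      unfolding grad_transverse_def using cj(4) by (intro exI[of _ V]) (auto simp: V_def)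
    then show ?thesis unfolding TF fst_conv using 1 0 by (intro conjI exI[of _ 1] exI[of _ 0]) auto
  qed
  ultimately show ?thesis unfolding cusp_index_is_def by (intro exI[of _ S]) (auto simp: S_def)
qed

lemma has_cusp_of_cusp_index:
  assumes f: "holo2_on UNIV (fst F)" "holo2_on UNIV (snd F)" and index: "cusp_index_is a F 1"
  shows "has_cusp (app F) a"
proof -
  obtain S where S: "open S" "S \<subseteq> {T. invertible T}" "{T. invertible T} \<subseteq> closure S"
    and idx: "\<And>T. T \<in> S \<Longrightarrow> grad_transverse a F (tcomp T F) \<and>
         (\<exists>k1 k2. local_dim a (jac (tcomp T F)) (jac11 (tcomp T F)) = enat k1 \<and>
                  local_dim a (pdx (fst (tcomp T F))) (pdy (fst (tcomp T F))) = enat k2 \<and>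
                  int k1 - int k2 = 1)"
    using index unfolding cusp_index_is_def by blast
  have "invertible (mat 1 :: complex^2^2)" by (simp add: invertible_det_nz)
  then have "S \<noteq> {}" using S(3) by auto
  then obtain T\<^sub>0 where T\<^sub>0: "T\<^sub>0 \<in> S" by blast
  note d = cderiv_tcomp[OF f UNIV_I]
  show ?thesis
  proof (cases "pdx (fst F) a = 0 \<and> pdy (fst F) a = 0 \<and> pdx (snd F) a = 0 \<and> pdy (snd F) a = 0")
    case True
    define f' where "f' = fst (tcomp T\<^sub>0 F)"
    define g' where "g' = snd (tcomp T\<^sub>0 F)"
    have TF: "tcomp T\<^sub>0 F = (f', g')" by (simp add: f'_def g'_def)
    have h: "holo2_on UNIV f'" "holo2_on UNIV g'"
      using holo2_on_tcomp[OF f] by (simp_all add: f'_def g'_def)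
    obtain k1 k2 where k: "local_dim a (jac (f', g')) (jac11 (f', g')) = enat k1" "local_dim a (pdx f') (pdy f') = enat k2"
      "int k1 - int k2 = 1" using idx[OF T\<^sub>0] unfolding TF fst_conv by blast
    obtain V where V: "open V" "a \<in> V" "{z\<in>V. jac F z = 0 \<and> pdx f' z = 0 \<and> pdy f' z = 0} \<subseteq> {a}"
      using idx[OF T\<^sub>0] unfolding TF fst_conv grad_transverse_def by blast
    \<comment> \<open>Critical points of \<open>f'\<close> are critical for \<open>F\<close>, so
      transversality already isolates the zeros of the gradient of \<open>f'\<close>.\<close>
    have "jac F z = 0" if "pdx f' z = 0" "pdy f' z = 0" for z
    proof -
      have "jac (f', g') z = 0" using that by (simp add: jac_def)
      then show ?thesis using jac_tcomp[OF f UNIV_I, of T\<^sub>0 z] S(2) T\<^sub>0 unfolding TF by (auto simp: invertible_det_nz)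
    qed
    then have V': "{z\<in>V. pdx f' z = 0 \<and> pdy f' z = 0} \<subseteq> {a}" using V(3) by blast
    have "pdx f' a = 0" "pdy f' a = 0" "pdx g' a = 0" "pdy g' a = 0"
      using True d[of T\<^sub>0 a] by (simp_all add: f'_def g'_def has_cderiv_pdx has_cderiv_pdy)
    note r0 = spans_quot_rank0[OF h this V(1,2) V' local_dim_spans[OF k(1)]]
    have "k2 \<le> k1 - 2" using local_dim_le[OF r0(2)] k(2) by simp
    then show ?thesis using k(3) r0(1) by linarith
  next
    case False
    \<comment> \<open>A nonzero differential has a nonzero column; the open set \<open>S\<close>
      contains a \<open>T\<close> whose first row does not annihilate it.\<close>
    have "\<exists>T\<in>S. pdx (fst (tcomp T F)) a \<noteq> 0 \<or> pdy (fst (tcomp T F)) a \<noteq> 0"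
    proof (cases "pdx (fst F) a \<noteq> 0 \<or> pdx (snd F) a \<noteq> 0")
      case True
      from exists_generic_row[OF S(1) T\<^sub>0 this] show ?thesis
        using has_cderiv_pdx[OF d(1)] by auto
    next
      case 2: False
      then have "pdy (fst F) a \<noteq> 0 \<or> pdy (snd F) a \<noteq> 0" using False by auto
      from exists_generic_row[OF S(1) T\<^sub>0 this] show ?thesis
        using has_cderiv_pdy[OF d(1)] by auto
    qed
    then obtain T where T: "T \<in> S" "pdx (fst (tcomp T F)) a \<noteq> 0 \<or> pdy (fst (tcomp T F)) a \<noteq> 0" by blast
    define f' where "f' = fst (tcomp T F)"
    define g' where "g' = snd (tcomp T F)"
    have TF: "tcomp T F = (f', g')" by (simp add: f'_def g'_def)
    have h: "holo2_on UNIV f'" "holo2_on UNIV g'"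
      using holo2_on_tcomp[OF f] by (simp_all add: f'_def g'_def)
    have df: "pdx f' a \<noteq> 0 \<or> pdy f' a \<noteq> 0" using T(2) by (simp add: f'_def)
    obtain k1 k2 where k: "local_dim a (jac (f', g')) (jac11 (f', g')) = enat k1" "local_dim a (pdx f') (pdy f') = enat k2"
      "int k1 - int k2 = 1" using idx[OF T(1)] unfolding TF fst_conv by blast
    have "local_dim a (pdx f') (pdy f') = enat 0"
      by (rule local_dim_eq_0[OF holo2_on_pdx[OF h(1)] holo2_on_pdy[OF h(1)] UNIV_I df])
    then have k1: "k1 = 1" using k(2,3) by simp
    have jh: "holo2_on UNIV (jac (f', g'))" "holo2_on UNIV (jac11 (f', g'))"
      using holo2_on_jac[OF h] holo2_on_jac[OF holo2_on_jac[OF h] h(1)] by (simp_all add: jac11_eq_jac)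
    \<comment> \<open>A generator nonzero at \<open>a\<close> would make the colength 0 instead of
      1.\<close>
    have J0: "jac (f', g') a = 0" "jac11 (f', g') a = 0"
      using local_dim_eq_0[OF jh UNIV_I, of a] k(1) k1 by auto
    have "jac (jac (f', g'), jac11 (f', g')) a \<noteq> 0"
      using jac_nz_of_spans_quot_1[OF jh J0] local_dim_spans[OF k(1)] k1 by simp
    from whitney_cusp[OF h df J0 this] have "has_cusp (app (tcomp T F)) a"
      unfolding TF app_def fst_conv snd_conv .
    then show ?thesis by (rule has_cusp_of_tcomp) (use S(2) T(1) in auto)
  qed
qed

theorem theorem2p9:
  fixes d1 d2 :: nat and F :: pmap and a :: c2
  assumes "0 < d1" and "0 < d2" and "F \<in> Omega2 d1 d2" and "generalized_cusp F a"
  shows "has_cusp (app F) a \<longleftrightarrow> cusp_index_is a F 1"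
proof -
  have "holo2_on UNIV (fst F)" "holo2_on UNIV (snd F)"
    using assms(3) by (auto simp: Omega2_def intro: poly2_le_holo2_on)
  then show ?thesis using cusp_index_of_has_cusp has_cusp_of_cusp_index by blast
qed

end
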